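(* Let $R$ be a nonzero semiprime $F$-algebra. Then: 1) $I(P(R))=O(I(P(R)))$ is orthogonally complete; 2) if $S\subseteq I(P(R))$, then $O(S)=O(O(S))$ is the set of all $\sum^{\perp}_{a\in I}\xi_a x_a\in I(P(R))$ with $\{\xi_a\}_{a\in I}\subseteq B(R)$ dense orthogonal and $\{x_a\}_{a\in I}\subseteq S$; 3) $O(P(R))$ is a semiprime $\mathrm{CM}(R)$-algebra with the operations $$\sum^{\perp}_{a\in I}\xi_a x_a\star\sum^{\perp}_{b\in J}\chi_b y_b=\sum^{\perp}_{a\in I,\,b\in J}\xi_a\chi_b(x_a\star y_b)\qquad(\star=+,\cdot)$$ for dense orthogonal $\{\xi_a\}_{a\in I},\{\chi_b\}_{b\in J}\subseteq B(R)$ and $\{x_a\}_{a\in I},\{y_b\}_{b\in J}\subseteq P(R)$; 4) $O(P(R))$ is a completely invariant $M(P(R))'$-submodule of $I(P(R))$, and $$\mathrm{End}(O(P(R)))_{M(P(R))'}=\mathrm{End}(O(P(R)))_{M(O(P(R)))'}=\mathrm{CM}(R)\,\mathrm{Id}_{O(P(R))};$$ 5) $O(R)$ is a semiprime $F$-subalgebra of $O(P(R))$, and if for some $n\ge 1$ every element of $P(R)$ is a $\mathrm{CM}(R)$-linear combination of $n$ elements of $R$, then $O(P(R))=\mathrm{CM}(R)\,O(R)$; 6) for any $S=O(S)\subseteq I(P(R))$ there is $x\in S$ with $\mathrm{Ann}_{\mathrm{CM}(R)}S=\mathrm{Ann}_{\mathrm{CM}(R)}x$.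
   Context: $F$ is an associative commutative ring with $1$; $F$-modules are unitary; $F$-algebras are linear, not necessarily associative or unital. For an $F$-algebra $R$ and $x\in R$ let $l_x:y\mapsto xy$, $r_x:y\mapsto yx$; $M(R)$ is the associative subalgebra of $\mathrm{End}_F(R)$ generated by all $l_x,r_x$ ($x\in R$), and $M(R)'=F\,\mathrm{Id}_R+M(R)$. Operators from $M(R)'$ act on the right, so $R$ is a right $M(R)'$-module whose submodules are the ideals of $R$. $R$ is semiprime if $I^2\ne\{0\}$ for every nonzero ideal $I$. For a right module $M$ over a ring $A$, $\mathrm{End}(M)_A$ is its endomorphism ring, and a submodule is completely invariant if it is invariant under $\mathrm{End}(M)_A$. Let $R$ be nonzero semiprime. $I(R)$ is a fixed injective hull of the right $M(R)'$-module $R$; $P(R)=\mathrm{End}(I(R))_{M(R)'}R$ (the quasi-injective hull of $R$); $\mathrm{CM}(R)=\mathrm{End}(P(R))_{M(R)'}$ is the Martindale centroid (a commutative von Neumann regular $F$-algebra). $P(R)=\mathrm{CM}(R)R$ is regarded as a $\mathrm{CM}(R)$-algebra (the central closure of $R$) with $(\sum_i\phi_ia_i)(\sum_j\psi_jb_j)=\sum_{i,j}(\phi_i\psi_j)(a_ib_j)$, $\phi_i,\psi_j\in\mathrm{CM}(R)$, $a_i,b_j\in R$; accordingly $M(P(R))'=\mathrm{CM}(R)\mathrm{Id}_{P(R)}+M(P(R))$ and likewise $M(O(P(R)))'=\mathrm{CM}(R)\mathrm{Id}+M(O(P(R)))$. $I(P(R))$ is an injective hull of the right $M(P(R))'$-module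 $P(R)$; $\mathrm{CM}(R)\subseteq M(P(R))'$ acts on it. $B(R)=\{\alpha\in\mathrm{CM}(R)\mid\alpha=\alpha^2\}$ is a Boolean ring with the multiplication of $\mathrm{CM}(R)$ and addition $\alpha\oplus\beta=(\alpha-\beta)^2$. A set $B\subseteq B(R)$ is dense if $\mathrm{Ann}_{B(R)}B=\{0\}$, and orthogonal if $\alpha\beta=0$ for distinct $\alpha,\beta\in B$. A set $S\subseteq I(P(R))$ is orthogonally complete if for every dense orthogonal $\{\xi_a\}_{a\in I}\subseteq B(R)$ and every $\{x_a\}_{a\in I}\subseteq S$ there is $x\in S$ with $\xi_ax=\xi_ax_a$ for all $a\in I$; such $x$ is unique in $I(P(R))$ and is denoted $\sum^{\perp}_{a\in I}\xi_ax_a$. The orthogonal completion $O(S)$ of $S\subseteq I(P(R))$ is the intersection of all orthogonally complete subsets of $I(P(R))$ containing $S$.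
   Formalization: In part 6 the set S is assumed nonempty: the empty set satisfies S = O(S), since no empty family is dense, but contains no element x, so the claim fails for it as literally stated. *)

theory Defs
  imports "HOL-Algebra.Module" "HOL-Algebra.Generated_Groups"
begin

text \<open>
  Right modules over a (not necessarily commutative) ring. The record of \<^theory>\<open>HOL-Algebra.Module\<close>
  is reused: \<open>a \<odot>\<^bsub>M\<^esub> x\<close> stands for the right action \<open>x a\<close>, whence the order of the factors in
  \<open>act_assoc\<close>. The predicate \<^const>\<open>submodule\<close> of the library does not mention the multiplication of the
  ring of scalars and is used for right modules as well. In a record that is only used as a module the
  fields \<open>mult\<close> and \<open>one\<close> are irrelevant.
\<close>

locale right_module = A?: ring A + M?: abelian_group M 
  for A :: "('b, 'm) ring_scheme" (structure) and M :: "('b, 'c, 'n) module_scheme" (structure) +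
  assumes act_closed: "\<lbrakk>a \<in> carrier A; x \<in> carrier M\<rbrakk> \<Longrightarrow> a \<odot>\<^bsub>M\<^esub> x \<in> carrier M"
    and act_add_left: "\<lbrakk>a \<in> carrier A; b \<in> carrier A; x \<in> carrier M\<rbrakk> \<Longrightarrow>
      (a \<oplus> b) \<odot>\<^bsub>M\<^esub> x = a \<odot>\<^bsub>M\<^esub> x \<oplus>\<^bsub>M\<^esub> b \<odot>\<^bsub>M\<^esub> x"
    and act_add_right: "\<lbrakk>a \<in> carrier A; x \<in> carrier M; y \<in> carrier M\<rbrakk> \<Longrightarrow>
      a \<odot>\<^bsub>M\<^esub> (x \<oplus>\<^bsub>M\<^esub> y) = a \<odot>\<^bsub>M\<^esub> x \<oplus>\<^bsub>M\<^esub> a \<odot>\<^bsub>M\<^esub> y"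
    and act_assoc: "\<lbrakk>a \<in> carrier A; b \<in> carrier A; x \<in> carrier M\<rbrakk> \<Longrightarrow>
      (a \<otimes> b) \<odot>\<^bsub>M\<^esub> x = b \<odot>\<^bsub>M\<^esub> (a \<odot>\<^bsub>M\<^esub> x)"
    and act_one: "x \<in> carrier M \<Longrightarrow> \<one> \<odot>\<^bsub>M\<^esub> x = x"

definition mod_hom ::
    "('b, 'm) ring_scheme \<Rightarrow> ('b, 'c) module \<Rightarrow> ('b, 'd) module \<Rightarrow> ('c \<Rightarrow> 'd) set" where
  "mod_hom A M N = {h \<in> carrier M \<rightarrow> carrier N.
     (\<forall>x\<in>carrier M. \<forall>y\<in>carrier M. h (x \<oplus>\<^bsub>M\<^esub> y) = h x \<oplus>\<^bsub>N\<^esub> h y) \<and>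
     (\<forall>a\<in>carrier A. \<forall>x\<in>carrier M. h (a \<odot>\<^bsub>M\<^esub> x) = a \<odot>\<^bsub>N\<^esub> h x)}"

text \<open>Endomorphisms are represented by functions that are \<open>undefined\<close> outside the carrier, so that
  equality of endomorphisms is equality of functions.\<close>

definition mod_End :: "('b, 'm) ring_scheme \<Rightarrow> ('b, 'c) module \<Rightarrow> ('c \<Rightarrow> 'c) ring" where
  "mod_End A M =
    \<lparr>carrier = mod_hom A M M \<inter> extensional (carrier M),
     mult = (\<lambda>f g. \<lambda>x\<in>carrier M. f (g x)),
     one = (\<lambda>x\<in>carrier M. x),
     zero = (\<lambda>x\<in>carrier M. \<zero>\<^bsub>M\<^esub>),
     add = (\<lambda>f g. \<lambda>x\<in>carrier M. f x \<oplus>\<^bsub>M\<^esub> g x)\<rparr>"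

text \<open>
  A homomorphism from a submodule \<open>K\<close> of \<open>N\<close> to \<open>E\<close> extends to \<open>N\<close>. A definition cannot quantify over
  modules of all types; here \<open>N\<close> ranges over all modules on subsets of the disjoint sum of the
  types of the scalars and of \<open>E\<close>. This contains a copy of the ring itself, so by Baer's argument
  the extension property holds for modules \<open>N\<close> on every type: see
  \<open>injective_module_extend\<close> below.
\<close>

definition injective_module :: "('b, 'm) ring_scheme \<Rightarrow> ('b, 'c) module \<Rightarrow> bool" where
  "injective_module A E \<longleftrightarrow> right_module A E \<and>
     (\<forall>(N :: ('b, 'b + 'c) module) K h.
        right_module A N \<and> submodule K A N \<and> h \<in> mod_hom A (N\<lparr>carrier := K\<rparr>) E \<longrightarrow>
        (\<exists>g\<in>mod_hom A N E. \<forall>x\<in>K. g x = h x))"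

lemma injective_module_extend:
  fixes A :: "('b, 'm) ring_scheme" and E :: "('b, 'c) module" and N :: "('b, 'd) module"
  assumes E: "injective_module A E" and N: "right_module A N"
    and K: "submodule K A N" and h: "h \<in> mod_hom A (N\<lparr>carrier := K\<rparr>) E"
  shows "\<exists>g\<in>mod_hom A N E. \<forall>x\<in>K. g x = h x"
proof -
  interpret N: right_module A N by fact
  interpret E: right_module A E using E by (simp add: injective_module_def)
  interpret K: submodule K A N by fact
  \<comment> \<open>graphs of homomorphisms from submodules of \<open>N\<close> that extend \<open>h\<close>\<close>
  define X where "X = {G. (\<lambda>x. (x, h x)) ` K \<subseteq> G \<and> G \<subseteq> carrier N \<times> carrier E \<and> single_valued G \<and>
    (\<forall>x y x' y'. (x, y) \<in> G \<and> (x', y') \<in> G \<longrightarrow> (x \<oplus>\<^bsub>N\<^esub> x', y \<oplus>\<^bsub>E\<^esub> y') \<in> G) \<and>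
    (\<forall>a\<in>carrier A. \<forall>(x, y)\<in>G. (a \<odot>\<^bsub>N\<^esub> x, a \<odot>\<^bsub>E\<^esub> y) \<in> G)}"
  have Ksub: "K \<subseteq> carrier N" using K.subset by simp
  have Xh: "\<And>G x. G \<in> X \<Longrightarrow> x \<in> K \<Longrightarrow> (x, h x) \<in> G"
    and Xsub: "\<And>G. G \<in> X \<Longrightarrow> G \<subseteq> carrier N \<times> carrier E"
    and Xs: "\<And>G x y z. G \<in> X \<Longrightarrow> (x, y) \<in> G \<Longrightarrow> (x, z) \<in> G \<Longrightarrow> y = z"
    and Xa: "\<And>G x y x' y'. G \<in> X \<Longrightarrow> (x, y) \<in> G \<Longrightarrow> (x', y') \<in> G \<Longrightarrow>
      (x \<oplus>\<^bsub>N\<^esub> x', y \<oplus>\<^bsub>E\<^esub> y') \<in> G"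
    and Xm: "\<And>G a x y. G \<in> X \<Longrightarrow> a \<in> carrier A \<Longrightarrow> (x, y) \<in> G \<Longrightarrow> (a \<odot>\<^bsub>N\<^esub> x, a \<odot>\<^bsub>E\<^esub> y) \<in> G"
    unfolding X_def by (blast dest: single_valuedD)+
  have XI: "G \<in> X" if "\<And>x. x \<in> K \<Longrightarrow> (x, h x) \<in> G" "G \<subseteq> carrier N \<times> carrier E" "single_valued G"
      "\<And>x y x' y'. (x, y) \<in> G \<Longrightarrow> (x', y') \<in> G \<Longrightarrow> (x \<oplus>\<^bsub>N\<^esub> x', y \<oplus>\<^bsub>E\<^esub> y') \<in> G"
      "\<And>a x y. a \<in> carrier A \<Longrightarrow> (x, y) \<in> G \<Longrightarrow> (a \<odot>\<^bsub>N\<^esub> x, a \<odot>\<^bsub>E\<^esub> y) \<in> G" for G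
    unfolding X_def mem_Collect_eq
  proof (intro conjI allI impI ballI)
    show "(\<lambda>x. (x, h x)) ` K \<subseteq> G" using that(1) by blast
  next
    fix x y x' y' assume "(x, y) \<in> G \<and> (x', y') \<in> G"
    then show "(x \<oplus>\<^bsub>N\<^esub> x', y \<oplus>\<^bsub>E\<^esub> y') \<in> G" using that(4) by blast
  next
    fix a p assume "a \<in> carrier A" "p \<in> G"
    then show "case p of (x, y) \<Rightarrow> (a \<odot>\<^bsub>N\<^esub> x, a \<odot>\<^bsub>E\<^esub> y) \<in> G" using that(5) by (cases p) simp
  qed (rule that)+
  have Ka: "\<And>x y. x \<in> K \<Longrightarrow> y \<in> K \<Longrightarrow> x \<oplus>\<^bsub>N\<^esub> y \<in> K" using K.m_closed by simp
  have hE: "\<And>x. x \<in> K \<Longrightarrow> h x \<in> carrier E"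
    and hadd: "\<And>x y. x \<in> K \<Longrightarrow> y \<in> K \<Longrightarrow> h (x \<oplus>\<^bsub>N\<^esub> y) = h x \<oplus>\<^bsub>E\<^esub> h y"
    and hsm: "\<And>a x. a \<in> carrier A \<Longrightarrow> x \<in> K \<Longrightarrow> h (a \<odot>\<^bsub>N\<^esub> x) = a \<odot>\<^bsub>E\<^esub> h x"
    using h by (auto simp: mod_hom_def)
  have graph_h: "(\<lambda>x. (x, h x)) ` K \<in> X"
  proof (rule XI)
    show "single_valued ((\<lambda>x. (x, h x)) ` K)" by (rule single_valuedI) auto
    show "(\<lambda>x. (x, h x)) ` K \<subseteq> carrier N \<times> carrier E" using Ksub hE by blast
  next
    fix x y x' y' assume "(x, y) \<in> (\<lambda>x. (x, h x)) ` K" "(x', y') \<in> (\<lambda>x. (x, h x)) ` K"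
    then have "x \<in> K" "x' \<in> K" "y = h x" "y' = h x'" by auto
    then show "(x \<oplus>\<^bsub>N\<^esub> x', y \<oplus>\<^bsub>E\<^esub> y') \<in> (\<lambda>x. (x, h x)) ` K"
      using Ka hadd by (intro image_eqI[of _ _ "x \<oplus>\<^bsub>N\<^esub> x'"]) simp_all
  next
    fix a x y assume a: "a \<in> carrier A" and "(x, y) \<in> (\<lambda>x. (x, h x)) ` K"
    then have "y = h x" "x \<in> K" by auto
    then show "(a \<odot>\<^bsub>N\<^esub> x, a \<odot>\<^bsub>E\<^esub> y) \<in> (\<lambda>x. (x, h x)) ` K"
      using a hsm K.smult_closed by (auto intro!: image_eqI[of _ _ "a \<odot>\<^bsub>N\<^esub> x"])
  qed simp
  have "\<exists>G\<in>X. \<forall>H\<in>X. G \<subseteq> H \<longrightarrow> H = G"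
  proof (rule subset_Zorn_nonempty)
    show "X \<noteq> {}" using graph_h by blast
    fix \<C> assume ne: "\<C> \<noteq> {}" and ch: "subset.chain X \<C>"
    have sub: "\<C> \<subseteq> X" and tot: "\<And>G H. G \<in> \<C> \<Longrightarrow> H \<in> \<C> \<Longrightarrow> G \<subseteq> H \<or> H \<subseteq> G"
      using ch by (auto simp: subset_chain_def)
    have two: "\<exists>G\<in>\<C>. p \<in> G \<and> q \<in> G" if "p \<in> \<Union>\<C>" "q \<in> \<Union>\<C>" for p q
      using that tot by blast
    have 1: "(x, h x) \<in> \<Union>\<C>" if "x \<in> K" for x using that ne sub Xh by blast
    have 2: "\<Union>\<C> \<subseteq> carrier N \<times> carrier E" using sub Xsub by blast
    have 3: "single_valued (\<Union>\<C>)"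
    proof (rule single_valuedI)
      fix x y z assume "(x, y) \<in> \<Union>\<C>" "(x, z) \<in> \<Union>\<C>"
      then obtain G where "G \<in> \<C>" "(x, y) \<in> G" "(x, z) \<in> G" using two by blast
      then show "y = z" using sub Xs by blast
    qed
    have 4: "(x \<oplus>\<^bsub>N\<^esub> x', y \<oplus>\<^bsub>E\<^esub> y') \<in> \<Union>\<C>" if "(x, y) \<in> \<Union>\<C>" "(x', y') \<in> \<Union>\<C>" for x y x' y'
    proof -
      from two[OF that] obtain G where "G \<in> \<C>" "(x, y) \<in> G" "(x', y') \<in> G" by blast
      moreover from this have "(x \<oplus>\<^bsub>N\<^esub> x', y \<oplus>\<^bsub>E\<^esub> y') \<in> G" using sub Xa by blast
      ultimately show ?thesis by blast
    qed
    have 5: "(a \<odot>\<^bsub>N\<^esub> x, a \<odot>\<^bsub>E\<^esub> y) \<in> \<Union>\<C>" if "a \<in> carrier A" "(x, y) \<in> \<Union>\<C>" for a x y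
    proof -
      from that obtain G where G: "G \<in> \<C>" "(x, y) \<in> G" by blast
      then have "(a \<odot>\<^bsub>N\<^esub> x, a \<odot>\<^bsub>E\<^esub> y) \<in> G" using sub that Xm by blast
      then show ?thesis using G by blast
    qed
    show "\<Union>\<C> \<in> X" by (rule XI) (fact 1 2 3 4 5)+
  qed
  then obtain G where G: "G \<in> X" and max: "\<And>H. H \<in> X \<Longrightarrow> G \<subseteq> H \<Longrightarrow> H = G" by blast
  note Gh = Xh[OF G] and Gs = Xs[OF G] and Ga = Xa[OF G] and Gm = Xm[OF G]
  have GN: "x \<in> carrier N" if "(x, y) \<in> G" for x y using Xsub[OF G] that by blast
  have GE: "y \<in> carrier E" if "(x, y) \<in> G" for x y using Xsub[OF G] that by blast
  have lzero: "\<zero>\<^bsub>A\<^esub> \<odot>\<^bsub>M\<^esub> x = \<zero>\<^bsub>M\<^esub>" if "right_module A M" "x \<in> carrier M" for M :: "('b, 'e) module" and x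
  proof -
    interpret M: right_module A M by fact
    have "\<zero>\<^bsub>A\<^esub> \<odot>\<^bsub>M\<^esub> x \<oplus>\<^bsub>M\<^esub> \<zero>\<^bsub>A\<^esub> \<odot>\<^bsub>M\<^esub> x = \<zero>\<^bsub>A\<^esub> \<odot>\<^bsub>M\<^esub> x"
      using M.act_add_left[of "\<zero>\<^bsub>A\<^esub>" "\<zero>\<^bsub>A\<^esub>" x] that by simp
    then show ?thesis using that M.act_closed[of "\<zero>\<^bsub>A\<^esub>" x] by (simp add: M.M.add.l_cancel_one)
  qed
  have lneg: "(\<ominus>\<^bsub>A\<^esub> a) \<odot>\<^bsub>M\<^esub> x = \<ominus>\<^bsub>M\<^esub> (a \<odot>\<^bsub>M\<^esub> x)"
    if "right_module A M" "a \<in> carrier A" "x \<in> carrier M" for M :: "('b, 'e) module" and a x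
  proof -
    interpret M: right_module A M by fact
    have "(\<ominus>\<^bsub>A\<^esub> a) \<odot>\<^bsub>M\<^esub> x \<oplus>\<^bsub>M\<^esub> a \<odot>\<^bsub>M\<^esub> x = \<zero>\<^bsub>M\<^esub>"
      using M.act_add_left[of "\<ominus>\<^bsub>A\<^esub> a" a x] that lzero[OF that(1,3)] by (simp add: N.A.l_neg)
    then show ?thesis using that M.act_closed by (simp add: M.M.minus_equality)
  qed
  have Gn: "(\<ominus>\<^bsub>N\<^esub> x, \<ominus>\<^bsub>E\<^esub> y) \<in> G" if "(x, y) \<in> G" for x y
    using Gm[of "\<ominus>\<^bsub>A\<^esub> \<one>\<^bsub>A\<^esub>", OF _ that] lneg[OF N, of "\<one>\<^bsub>A\<^esub>" x] lneg[OF E.right_module_axioms, of "\<one>\<^bsub>A\<^esub>" y]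
      GN[OF that] GE[OF that] by (simp add: N.act_one E.act_one)
  have G0: "(\<zero>\<^bsub>N\<^esub>, \<zero>\<^bsub>E\<^esub>) \<in> G"
  proof -
    have *: "(\<zero>\<^bsub>N\<^esub>, h \<zero>\<^bsub>N\<^esub>) \<in> G" using Gh K.one_closed by simp
    show ?thesis
      using Gm[of "\<zero>\<^bsub>A\<^esub>", OF _ *] lzero[OF N] lzero[OF E.right_module_axioms] GN[OF *] GE[OF *] by simp
  qed
  have total: "\<exists>y. (x, y) \<in> G" if x: "x \<in> carrier N" for x
  proof -
    define D where "D = {a \<in> carrier A. \<exists>y. (a \<odot>\<^bsub>N\<^esub> x, y) \<in> G}"
    define AA :: "('b, 'b + 'c) module" where "AA =
      \<lparr>carrier = Inl ` carrier A, mult = undefined, one = undefined, zero = Inl \<zero>\<^bsub>A\<^esub>,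
       add = (\<lambda>u v. Inl (projl u \<oplus>\<^bsub>A\<^esub> projl v)), smult = (\<lambda>b u. Inl (projl u \<otimes>\<^bsub>A\<^esub> b))\<rparr>"
    define k where "k = (\<lambda>u :: 'b + 'c. THE y. (projl u \<odot>\<^bsub>N\<^esub> x, y) \<in> G)" 
    have k: "k (Inl a) = y" if "(a \<odot>\<^bsub>N\<^esub> x, y) \<in> G" for a y
      using that Gs by (auto simp: k_def)
    have AAab: "abelian_group AA"
    proof (rule abelian_groupI)
      fix u assume "u \<in> carrier AA"
      then obtain a where "a \<in> carrier A" "u = Inl a" by (auto simp: AA_def)
      then show "\<exists>v\<in>carrier AA. v \<oplus>\<^bsub>AA\<^esub> u = \<zero>\<^bsub>AA\<^esub>"
        by (intro bexI[of _ "Inl (\<ominus>\<^bsub>A\<^esub> a)"]) (auto simp: AA_def N.A.l_neg)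
    qed (auto simp: AA_def N.A.a_assoc intro: N.A.a_comm)
    interpret AA: abelian_group AA by fact
    have AAm: "right_module A AA"
      by unfold_locales (auto simp: AA_def N.A.l_distr N.A.r_distr N.A.m_assoc)
    have D0: "\<zero>\<^bsub>A\<^esub> \<in> D" using G0 lzero[OF N x] by (auto simp: D_def)
    have Da: "a \<oplus>\<^bsub>A\<^esub> b \<in> D" if "a \<in> D" "b \<in> D" for a b
      using that Ga x by (auto simp: D_def N.act_add_left; blast)
    have Dm: "a \<otimes>\<^bsub>A\<^esub> b \<in> D" if "a \<in> D" "b \<in> carrier A" for a b
      using that Gm x by (auto simp: D_def N.act_assoc; blast)
    have Dn: "\<ominus>\<^bsub>A\<^esub> a \<in> D" if "a \<in> D" for a
      using that Gn lneg[OF N _ x, of a] by (auto simp: D_def)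
    have DA: "D \<subseteq> carrier A" by (auto simp: D_def)
    have inv: "inv\<^bsub>add_monoid AA\<^esub> (Inl a) = Inl (\<ominus>\<^bsub>A\<^esub> a)" if "a \<in> carrier A" for a
      using that AA.minus_equality[of "Inl (\<ominus>\<^bsub>A\<^esub> a)" "Inl a"]
      by (auto simp: AA_def N.A.l_neg a_inv_def)
    have subD: "submodule (Inl ` D) A AA"
    proof (intro submodule.intro subgroup.intro submodule_axioms.intro)
      show "Inl ` D \<subseteq> carrier (add_monoid AA)" using DA by (auto simp: AA_def)
      show "\<one>\<^bsub>add_monoid AA\<^esub> \<in> Inl ` D" using D0 by (auto simp: AA_def)
      show "u \<otimes>\<^bsub>add_monoid AA\<^esub> v \<in> Inl ` D" if "u \<in> Inl ` D" "v \<in> Inl ` D" for u v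
        using that Da by (auto simp: AA_def)
      show "inv\<^bsub>add_monoid AA\<^esub> u \<in> Inl ` D" if "u \<in> Inl ` D" for u
        using that Dn DA inv by (auto simp: subset_iff)
      show "b \<odot>\<^bsub>AA\<^esub> u \<in> Inl ` D" if "b \<in> carrier A" "u \<in> Inl ` D" for b u
        using that Dm by (auto simp: AA_def)
    qed
    have homk: "k \<in> mod_hom A (AA\<lparr>carrier := Inl ` D\<rparr>) E"
    proof -
      have "k (Inl a) \<in> carrier E" if "a \<in> D" for a
        using that k GE by (auto simp: D_def)
      moreover have "k (Inl (a \<oplus>\<^bsub>A\<^esub> b)) = k (Inl a) \<oplus>\<^bsub>E\<^esub> k (Inl b)" if "a \<in> D" "b \<in> D" for a b
      proof -
        obtain y z where yz: "(a \<odot>\<^bsub>N\<^esub> x, y) \<in> G" "(b \<odot>\<^bsub>N\<^esub> x, z) \<in> G" using \<open>a \<in> D\<close> \<open>b \<in> D\<close> by (auto simp: D_def)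
        then have "((a \<oplus>\<^bsub>A\<^esub> b) \<odot>\<^bsub>N\<^esub> x, y \<oplus>\<^bsub>E\<^esub> z) \<in> G" using Ga[OF yz] x that DA by (auto simp: N.act_add_left subset_iff)
        then show ?thesis using yz k by auto
      qed
      moreover have "k (Inl (a \<otimes>\<^bsub>A\<^esub> b)) = b \<odot>\<^bsub>E\<^esub> k (Inl a)" if "a \<in> D" "b \<in> carrier A" for a b
      proof -
        obtain y where y: "(a \<odot>\<^bsub>N\<^esub> x, y) \<in> G" using \<open>a \<in> D\<close> by (auto simp: D_def)
        then have "((a \<otimes>\<^bsub>A\<^esub> b) \<odot>\<^bsub>N\<^esub> x, b \<odot>\<^bsub>E\<^esub> y) \<in> G" using Gm[OF that(2) y] x that DA by (auto simp: N.act_assoc subset_iff)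
        then show ?thesis using y k by auto
      qed
      ultimately show ?thesis by (auto simp: mod_hom_def AA_def)
    qed
    obtain g where g: "g \<in> mod_hom A AA E" and gk: "\<forall>u\<in>Inl ` D. g u = k u"
      using E AAm subD homk unfolding injective_module_def by blast
    define e where "e = g (Inl \<one>\<^bsub>A\<^esub>)"
    have e: "e \<in> carrier E" using g by (auto simp: e_def mod_hom_def AA_def)
    have ge: "g (Inl a) = a \<odot>\<^bsub>E\<^esub> e" if a: "a \<in> carrier A" for a
    proof -
      have "a \<odot>\<^bsub>AA\<^esub> Inl \<one>\<^bsub>A\<^esub> = Inl a" using a by (simp add: AA_def)
      moreover have "Inl \<one>\<^bsub>A\<^esub> \<in> carrier AA" by (simp add: AA_def)
      ultimately show ?thesis using g a unfolding e_def mod_hom_def by force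
    qed
    define H where "H = {(y \<oplus>\<^bsub>N\<^esub> a \<odot>\<^bsub>N\<^esub> x, z \<oplus>\<^bsub>E\<^esub> a \<odot>\<^bsub>E\<^esub> e) | y z a. (y, z) \<in> G \<and> a \<in> carrier A}"
    have HI: "(y \<oplus>\<^bsub>N\<^esub> a \<odot>\<^bsub>N\<^esub> x, z \<oplus>\<^bsub>E\<^esub> a \<odot>\<^bsub>E\<^esub> e) \<in> H" if "(y, z) \<in> G" "a \<in> carrier A" for y z a
      using that by (auto simp: H_def)
    have GH: "G \<subseteq> H"
    proof
      fix p assume p: "p \<in> G"
      obtain y z where "p = (y, z)" by force
      then show "p \<in> H" using HI[of y z "\<zero>\<^bsub>A\<^esub>"] p GN GE lzero[OF N x] lzero[OF E.right_module_axioms e] by auto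
    qed
    have key: "z = a \<odot>\<^bsub>E\<^esub> e" if "(a \<odot>\<^bsub>N\<^esub> x, z) \<in> G" "a \<in> carrier A" for a z
    proof -
      have "a \<in> D" using that by (auto simp: D_def)
      then show ?thesis using gk ge[OF that(2)] k[OF that(1)] by auto
    qed
    have Hs: "single_valued H"
    proof (rule single_valuedI)
      fix w u v assume "(w, u) \<in> H" "(w, v) \<in> H"
      then obtain y z a y' z' a' where 1: "(y, z) \<in> G" "a \<in> carrier A" "(y', z') \<in> G" "a' \<in> carrier A"
        and w: "w = y \<oplus>\<^bsub>N\<^esub> a \<odot>\<^bsub>N\<^esub> x" "w = y' \<oplus>\<^bsub>N\<^esub> a' \<odot>\<^bsub>N\<^esub> x"
        and u: "u = z \<oplus>\<^bsub>E\<^esub> a \<odot>\<^bsub>E\<^esub> e" and v: "v = z' \<oplus>\<^bsub>E\<^esub> a' \<odot>\<^bsub>E\<^esub> e"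
        unfolding H_def by blast
      note c = GN[OF 1(1)] GN[OF 1(3)] GE[OF 1(1)] GE[OF 1(3)] N.act_closed[OF 1(2) x] N.act_closed[OF 1(4) x]
        E.act_closed[OF 1(2) e] E.act_closed[OF 1(4) e]
      let ?b = "a \<oplus>\<^bsub>A\<^esub> \<ominus>\<^bsub>A\<^esub> a'"
      have b: "?b \<in> carrier A" using 1 by simp
      have "?b \<odot>\<^bsub>N\<^esub> x = a \<odot>\<^bsub>N\<^esub> x \<oplus>\<^bsub>N\<^esub> \<ominus>\<^bsub>N\<^esub> (a' \<odot>\<^bsub>N\<^esub> x)"
        using 1 x by (simp add: N.act_add_left lneg[OF N])
      also have "\<dots> = y' \<oplus>\<^bsub>N\<^esub> \<ominus>\<^bsub>N\<^esub> y"
      proof -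
        have "a \<odot>\<^bsub>N\<^esub> x = y' \<oplus>\<^bsub>N\<^esub> a' \<odot>\<^bsub>N\<^esub> x \<oplus>\<^bsub>N\<^esub> \<ominus>\<^bsub>N\<^esub> y"
          using w c N.M.r_neg2 by (metis N.M.a_comm N.M.a_inv_closed N.M.a_closed N.M.r_neg1)
        then show ?thesis using c by (simp add: N.M.a_ac N.M.r_neg2 N.M.r_neg1 N.M.r_neg)
      qed
      finally have "(?b \<odot>\<^bsub>N\<^esub> x, z' \<oplus>\<^bsub>E\<^esub> \<ominus>\<^bsub>E\<^esub> z) \<in> G" using Ga[OF 1(3) Gn[OF 1(1)]] by simp
      then have "z' \<oplus>\<^bsub>E\<^esub> \<ominus>\<^bsub>E\<^esub> z = ?b \<odot>\<^bsub>E\<^esub> e" using key b by blast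
      also have "\<dots> = a \<odot>\<^bsub>E\<^esub> e \<oplus>\<^bsub>E\<^esub> \<ominus>\<^bsub>E\<^esub> (a' \<odot>\<^bsub>E\<^esub> e)"
        using 1 e by (simp add: E.act_add_left lneg[OF E.right_module_axioms])
      finally have q: "z' \<oplus>\<^bsub>E\<^esub> \<ominus>\<^bsub>E\<^esub> z = a \<odot>\<^bsub>E\<^esub> e \<oplus>\<^bsub>E\<^esub> \<ominus>\<^bsub>E\<^esub> (a' \<odot>\<^bsub>E\<^esub> e)" .
      have "z' = z \<oplus>\<^bsub>E\<^esub> (z' \<oplus>\<^bsub>E\<^esub> \<ominus>\<^bsub>E\<^esub> z)" using c by (simp add: E.M.a_ac E.M.r_neg2 E.M.r_neg1 E.M.r_neg)
      then have "z' \<oplus>\<^bsub>E\<^esub> a' \<odot>\<^bsub>E\<^esub> e = z \<oplus>\<^bsub>E\<^esub> (a \<odot>\<^bsub>E\<^esub> e \<oplus>\<^bsub>E\<^esub> \<ominus>\<^bsub>E\<^esub> (a' \<odot>\<^bsub>E\<^esub> e)) \<oplus>\<^bsub>E\<^esub> a' \<odot>\<^bsub>E\<^esub> e"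
        using q by simp
      also have "\<dots> = z \<oplus>\<^bsub>E\<^esub> a \<odot>\<^bsub>E\<^esub> e" using c by (simp add: E.M.a_assoc E.M.l_neg)
      finally show "u = v" using u v by simp
    qed
    have Hsub: "H \<subseteq> carrier N \<times> carrier E"
      using GN GE x e N.act_closed E.act_closed by (auto simp: H_def)
    have Hadd: "(p \<oplus>\<^bsub>N\<^esub> p', q \<oplus>\<^bsub>E\<^esub> q') \<in> H" if "(p, q) \<in> H" "(p', q') \<in> H" for p q p' q'
    proof -
      from that obtain y z a y' z' a' where 1: "(y, z) \<in> G" "a \<in> carrier A" "(y', z') \<in> G" "a' \<in> carrier A"
        and w: "p = y \<oplus>\<^bsub>N\<^esub> a \<odot>\<^bsub>N\<^esub> x" "p' = y' \<oplus>\<^bsub>N\<^esub> a' \<odot>\<^bsub>N\<^esub> x"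
        and u: "q = z \<oplus>\<^bsub>E\<^esub> a \<odot>\<^bsub>E\<^esub> e" "q' = z' \<oplus>\<^bsub>E\<^esub> a' \<odot>\<^bsub>E\<^esub> e"
        unfolding H_def by blast
      note c = GN[OF 1(1)] GN[OF 1(3)] GE[OF 1(1)] GE[OF 1(3)] N.act_closed[OF 1(2) x] N.act_closed[OF 1(4) x]
        E.act_closed[OF 1(2) e] E.act_closed[OF 1(4) e]
      have "p \<oplus>\<^bsub>N\<^esub> p' = (y \<oplus>\<^bsub>N\<^esub> y') \<oplus>\<^bsub>N\<^esub> (a \<oplus>\<^bsub>A\<^esub> a') \<odot>\<^bsub>N\<^esub> x"
        using c 1 x by (simp add: w N.act_add_left N.M.a_ac)
      moreover have "q \<oplus>\<^bsub>E\<^esub> q' = (z \<oplus>\<^bsub>E\<^esub> z') \<oplus>\<^bsub>E\<^esub> (a \<oplus>\<^bsub>A\<^esub> a') \<odot>\<^bsub>E\<^esub> e"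
        using c 1 e by (simp add: u E.act_add_left E.M.a_ac)
      ultimately show ?thesis using HI[OF Ga[OF 1(1,3)], of "a \<oplus>\<^bsub>A\<^esub> a'"] 1 by simp
    qed
    have Hmul: "(b \<odot>\<^bsub>N\<^esub> p, b \<odot>\<^bsub>E\<^esub> q) \<in> H" if "b \<in> carrier A" "(p, q) \<in> H" for b p q
    proof -
      from that obtain y z a where 1: "(y, z) \<in> G" "a \<in> carrier A"
        and w: "p = y \<oplus>\<^bsub>N\<^esub> a \<odot>\<^bsub>N\<^esub> x" "q = z \<oplus>\<^bsub>E\<^esub> a \<odot>\<^bsub>E\<^esub> e"
        unfolding H_def by blast
      have "b \<odot>\<^bsub>N\<^esub> p = b \<odot>\<^bsub>N\<^esub> y \<oplus>\<^bsub>N\<^esub> (a \<otimes>\<^bsub>A\<^esub> b) \<odot>\<^bsub>N\<^esub> x"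
        using 1 that x GN[OF 1(1)] by (simp add: w N.act_add_right N.act_assoc N.act_closed)
      moreover have "b \<odot>\<^bsub>E\<^esub> q = b \<odot>\<^bsub>E\<^esub> z \<oplus>\<^bsub>E\<^esub> (a \<otimes>\<^bsub>A\<^esub> b) \<odot>\<^bsub>E\<^esub> e"
        using 1 that e GE[OF 1(1)] by (simp add: w E.act_add_right E.act_assoc E.act_closed)
      ultimately show ?thesis using HI[OF Gm[OF that(1) 1(1)], of "a \<otimes>\<^bsub>A\<^esub> b"] 1 that by simp
    qed
    have "H \<in> X" by (rule XI) (use GH Gh in blast, fact Hsub, fact Hs, fact Hadd, fact Hmul)
    then have "H = G" using max GH by blast
    moreover have "(x, e) \<in> H"
      using HI[OF G0, of "\<one>\<^bsub>A\<^esub>"] x e by (simp add: N.act_one E.act_one)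
    ultimately show ?thesis by blast
  qed
  define g where "g = (\<lambda>x. THE y. (x, y) \<in> G)"
  have g: "g x = y" if "(x, y) \<in> G" for x y
    using that Gs by (auto simp: g_def)
  have gG: "(x, g x) \<in> G" if "x \<in> carrier N" for x
    using total[OF that] g by auto
  have "g \<in> mod_hom A N E"
    unfolding mod_hom_def using gG GE by (auto intro!: g Ga Gm)
  moreover have "\<forall>x\<in>K. g x = h x" using g Gh by blast
  ultimately show ?thesis by blast
qed

text \<open>Injective hulls contain the given module literally, not just up to an embedding.\<close>

definition injective_hull ::
    "('b, 'm) ring_scheme \<Rightarrow> ('b, 'c) module \<Rightarrow> ('b, 'c) module \<Rightarrow> bool" where
  "injective_hull A M E \<longleftrightarrow> right_module A M \<and> injective_module A E \<and>
     submodule (carrier M) A E \<and>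
     (\<forall>x\<in>carrier M. \<forall>y\<in>carrier M. x \<oplus>\<^bsub>E\<^esub> y = x \<oplus>\<^bsub>M\<^esub> y) \<and>
     (\<forall>a\<in>carrier A. \<forall>x\<in>carrier M. a \<odot>\<^bsub>E\<^esub> x = a \<odot>\<^bsub>M\<^esub> x) \<and>
     (\<forall>K. submodule K A E \<and> K \<noteq> {\<zero>\<^bsub>E\<^esub>} \<longrightarrow> K \<inter> carrier M \<noteq> {\<zero>\<^bsub>E\<^esub>})"


text \<open>Algebras, not necessarily associative, commutative or unital; the field \<open>one\<close> of the record is
  irrelevant.\<close>

locale nonassoc_algebra = module F R for F (structure) and R (structure) +
  assumes mult_closed: "\<lbrakk>x \<in> carrier R; y \<in> carrier R\<rbrakk> \<Longrightarrow> x \<otimes>\<^bsub>R\<^esub> y \<in> carrier R"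
    and mult_add_left: "\<lbrakk>x \<in> carrier R; y \<in> carrier R; z \<in> carrier R\<rbrakk> \<Longrightarrow>
      (x \<oplus>\<^bsub>R\<^esub> y) \<otimes>\<^bsub>R\<^esub> z = x \<otimes>\<^bsub>R\<^esub> z \<oplus>\<^bsub>R\<^esub> y \<otimes>\<^bsub>R\<^esub> z"
    and mult_add_right: "\<lbrakk>x \<in> carrier R; y \<in> carrier R; z \<in> carrier R\<rbrakk> \<Longrightarrow>
      x \<otimes>\<^bsub>R\<^esub> (y \<oplus>\<^bsub>R\<^esub> z) = x \<otimes>\<^bsub>R\<^esub> y \<oplus>\<^bsub>R\<^esub> x \<otimes>\<^bsub>R\<^esub> z"
    and mult_smult_left: "\<lbrakk>c \<in> carrier F; x \<in> carrier R; y \<in> carrier R\<rbrakk> \<Longrightarrow>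
      (c \<odot>\<^bsub>R\<^esub> x) \<otimes>\<^bsub>R\<^esub> y = c \<odot>\<^bsub>R\<^esub> (x \<otimes>\<^bsub>R\<^esub> y)"
    and mult_smult_right: "\<lbrakk>c \<in> carrier F; x \<in> carrier R; y \<in> carrier R\<rbrakk> \<Longrightarrow>
      x \<otimes>\<^bsub>R\<^esub> (c \<odot>\<^bsub>R\<^esub> y) = c \<odot>\<^bsub>R\<^esub> (x \<otimes>\<^bsub>R\<^esub> y)"

definition nonassoc_subalgebra :: "'a set \<Rightarrow> ('f, 'm) ring_scheme \<Rightarrow> ('f, 'a) module \<Rightarrow> bool" where
  "nonassoc_subalgebra S F R \<longleftrightarrow> submodule S F R \<and> (\<forall>x\<in>S. \<forall>y\<in>S. x \<otimes>\<^bsub>R\<^esub> y \<in> S)"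

definition algebra_ideal :: "'a set \<Rightarrow> ('f, 'm) ring_scheme \<Rightarrow> ('f, 'a) module \<Rightarrow> bool" where
  "algebra_ideal I F R \<longleftrightarrow> submodule I F R \<and>
     (\<forall>x\<in>I. \<forall>y\<in>carrier R. x \<otimes>\<^bsub>R\<^esub> y \<in> I \<and> y \<otimes>\<^bsub>R\<^esub> x \<in> I)"

definition ideal_square :: "('f, 'a) module \<Rightarrow> 'a set \<Rightarrow> 'a set" where
  "ideal_square R I = generate (add_monoid R) {x \<otimes>\<^bsub>R\<^esub> y | x y. x \<in> I \<and> y \<in> I}"

definition semiprime_algebra :: "('f, 'm) ring_scheme \<Rightarrow> ('f, 'a) module \<Rightarrow> bool" where
  "semiprime_algebra F R \<longleftrightarrow> nonassoc_algebra F R \<and>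
     (\<forall>I. algebra_ideal I F R \<and> I \<noteq> {\<zero>\<^bsub>R\<^esub>} \<longrightarrow> ideal_square R I \<noteq> {\<zero>\<^bsub>R\<^esub>})"


text \<open>The algebra of \<open>F\<close>-linear operators of \<open>R\<close>. Operators act on the right: the product of \<open>f\<close> and \<open>g\<close>
  applies \<open>f\<close> first.\<close>

definition linear_operators :: "('f, 'm) ring_scheme \<Rightarrow> ('f, 'a) module \<Rightarrow> ('f, 'a \<Rightarrow> 'a) module" where
  "linear_operators F R =
    \<lparr>carrier = mod_hom F R R \<inter> extensional (carrier R),
     mult = (\<lambda>f g. \<lambda>x\<in>carrier R. g (f x)),
     one = (\<lambda>x\<in>carrier R. x),
     zero = (\<lambda>x\<in>carrier R. \<zero>\<^bsub>R\<^esub>),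
     add = (\<lambda>f g. \<lambda>x\<in>carrier R. f x \<oplus>\<^bsub>R\<^esub> g x),
     smult = (\<lambda>c f. \<lambda>x\<in>carrier R. c \<odot>\<^bsub>R\<^esub> f x)\<rparr>"

definition left_op :: "('f, 'a) module \<Rightarrow> 'a \<Rightarrow> 'a \<Rightarrow> 'a" where
  "left_op R x = (\<lambda>y\<in>carrier R. x \<otimes>\<^bsub>R\<^esub> y)"

definition right_op :: "('f, 'a) module \<Rightarrow> 'a \<Rightarrow> 'a \<Rightarrow> 'a" where
  "right_op R x = (\<lambda>y\<in>carrier R. y \<otimes>\<^bsub>R\<^esub> x)"

definition scalar_op :: "('f, 'a) module \<Rightarrow> 'f \<Rightarrow> 'a \<Rightarrow> 'a" where
  "scalar_op R c = (\<lambda>y\<in>carrier R. c \<odot>\<^bsub>R\<^esub> y)"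

text \<open>\<open>M(R)\<close>, and the ring \<open>M(R)' = F Id + M(R)\<close>:\<close>

definition mult_algebra :: "('f, 'm) ring_scheme \<Rightarrow> ('f, 'a) module \<Rightarrow> ('a \<Rightarrow> 'a) set" where
  "mult_algebra F R = \<Inter>{S. nonassoc_subalgebra S F (linear_operators F R) \<and>
     left_op R ` carrier R \<subseteq> S \<and> right_op R ` carrier R \<subseteq> S}"

definition unital_mult_ring :: "('f, 'm) ring_scheme \<Rightarrow> ('f, 'a) module \<Rightarrow> ('a \<Rightarrow> 'a) ring" where
  "unital_mult_ring F R = (let L = linear_operators F R in
    \<lparr>carrier = {scalar_op R c \<oplus>\<^bsub>L\<^esub> f | c f. c \<in> carrier F \<and> f \<in> mult_algebra F R},
     mult = mult L, one = one L, zero = zero L, add = add L\<rparr>)"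

text \<open>\<open>R\<close> as a right \<open>M(R)'\<close>-module:\<close>

definition mult_module :: "('f, 'a) module \<Rightarrow> ('a \<Rightarrow> 'a, 'a) module" where
  "mult_module R =
    \<lparr>carrier = carrier R, mult = mult R, one = one R, zero = zero R, add = add R,
     smult = (\<lambda>f x. f x)\<rparr>"


text \<open>In the following definitions \<open>E\<close> is an injective hull of the right \<open>M(R)'\<close>-module \<open>R\<close>.
  \<open>quasi_injective_hull F R E\<close> is \<open>P(R)\<close> as a right \<open>M(R)'\<close>-module.\<close>

definition quasi_injective_hull ::
    "('f, 'm) ring_scheme \<Rightarrow> ('f, 'a) module \<Rightarrow> ('a \<Rightarrow> 'a, 'a) module \<Rightarrow> ('a \<Rightarrow> 'a, 'a) module" where
  "quasi_injective_hull F R E = E\<lparr>carrier := generate (add_monoid E)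
     {\<phi> a | \<phi> a. \<phi> \<in> carrier (mod_End (unital_mult_ring F R) E) \<and> a \<in> carrier R}\<rparr>"

definition martindale_centroid ::
    "('f, 'm) ring_scheme \<Rightarrow> ('f, 'a) module \<Rightarrow> ('a \<Rightarrow> 'a, 'a) module \<Rightarrow> ('a \<Rightarrow> 'a) ring" where
  "martindale_centroid F R E = mod_End (unital_mult_ring F R) (quasi_injective_hull F R E)"

definition central_closure_mult ::
    "('f, 'm) ring_scheme \<Rightarrow> ('f, 'a) module \<Rightarrow> ('a \<Rightarrow> 'a, 'a) module \<Rightarrow> 'a \<Rightarrow> 'a \<Rightarrow> 'a" where
  "central_closure_mult F R E x y = (let C = martindale_centroid F R E in
     THE z. \<exists>(n::nat) (m::nat) \<phi> \<psi> a b.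
       \<phi> \<in> {..<n} \<rightarrow> carrier C \<and> a \<in> {..<n} \<rightarrow> carrier R \<and>
       \<psi> \<in> {..<m} \<rightarrow> carrier C \<and> b \<in> {..<m} \<rightarrow> carrier R \<and>
       x = (\<Oplus>\<^bsub>E\<^esub> i \<in> {..<n}. \<phi> i (a i)) \<and> y = (\<Oplus>\<^bsub>E\<^esub> j \<in> {..<m}. \<psi> j (b j)) \<and>
       z = (\<Oplus>\<^bsub>E\<^esub> i \<in> {..<n}. \<Oplus>\<^bsub>E\<^esub> j \<in> {..<m}. (\<phi> i \<otimes>\<^bsub>C\<^esub> \<psi> j) (a i \<otimes>\<^bsub>R\<^esub> b j)))"

definition central_closure ::
    "('f, 'm) ring_scheme \<Rightarrow> ('f, 'a) module \<Rightarrow> ('a \<Rightarrow> 'a, 'a) module \<Rightarrow> ('a \<Rightarrow> 'a, 'a) module" where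
  "central_closure F R E =
    \<lparr>carrier = carrier (quasi_injective_hull F R E),
     mult = central_closure_mult F R E,
     one = undefined,
     zero = zero E,
     add = add E,
     smult = (\<lambda>\<phi> x. \<phi> x)\<rparr>"

text \<open>The canonical map from \<open>F\<close> to the Martindale centroid, \<open>c \<mapsto> (x \<mapsto> x (c Id))\<close>:\<close>

definition base_scalar ::
    "('f, 'm) ring_scheme \<Rightarrow> ('f, 'a) module \<Rightarrow> ('a \<Rightarrow> 'a, 'a) module \<Rightarrow> 'f \<Rightarrow> 'a \<Rightarrow> 'a" where
  "base_scalar F R E c = (\<lambda>x\<in>carrier (quasi_injective_hull F R E). scalar_op R c \<odot>\<^bsub>E\<^esub> x)"

definition pullback_scalars :: "('f \<Rightarrow> 'b) \<Rightarrow> ('b, 'a) module \<Rightarrow> ('f, 'a) module" where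
  "pullback_scalars \<theta> M =
    \<lparr>carrier = carrier M, mult = mult M, one = one M, zero = zero M, add = add M,
     smult = (\<lambda>c x. \<theta> c \<odot>\<^bsub>M\<^esub> x)\<rparr>"


text \<open>
  In the following definitions \<open>C\<close> is the Martindale centroid and \<open>E\<close> is an injective hull of the right
  \<open>M(P(R))'\<close>-module \<open>P(R)\<close>. The operator \<open>\<phi> Id\<close> of \<open>P(R)\<close> is \<open>\<phi>\<close> itself, so that elements of \<open>C\<close> act on \<open>E\<close>
  by \<open>\<phi> \<odot>\<^bsub>E\<^esub> x\<close>.

  Families \<open>\<xi>\<close> are indexed by a set \<open>I\<close>. Orthogonality refers to distinct indices; hence
  \<open>0\<close> may occur repeatedly in an orthogonal family, but no other idempotent may.
\<close>

definition idempotents :: "'c ring \<Rightarrow> 'c set" where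
  "idempotents C = {\<alpha> \<in> carrier C. \<alpha> = \<alpha> \<otimes>\<^bsub>C\<^esub> \<alpha>}"

definition dense_idempotents :: "'c ring \<Rightarrow> 'c set \<Rightarrow> bool" where
  "dense_idempotents C B \<longleftrightarrow>
     B \<subseteq> idempotents C \<and> {\<beta> \<in> idempotents C. \<forall>\<alpha>\<in>B. \<beta> \<otimes>\<^bsub>C\<^esub> \<alpha> = \<zero>\<^bsub>C\<^esub>} = {\<zero>\<^bsub>C\<^esub>}"

definition dense_orthogonal :: "'c ring \<Rightarrow> 'i set \<Rightarrow> ('i \<Rightarrow> 'c) \<Rightarrow> bool" where
  "dense_orthogonal C I \<xi> \<longleftrightarrow> dense_idempotents C (\<xi> ` I) \<and>
     (\<forall>a\<in>I. \<forall>b\<in>I. a \<noteq> b \<longrightarrow> \<xi> a \<otimes>\<^bsub>C\<^esub> \<xi> b = \<zero>\<^bsub>C\<^esub>)"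

definition orth_sum :: "('c, 'a) module \<Rightarrow> 'i set \<Rightarrow> ('i \<Rightarrow> 'c) \<Rightarrow> ('i \<Rightarrow> 'a) \<Rightarrow> 'a" where
  "orth_sum E I \<xi> x = (THE u. u \<in> carrier E \<and> (\<forall>a\<in>I. \<xi> a \<odot>\<^bsub>E\<^esub> u = \<xi> a \<odot>\<^bsub>E\<^esub> x a))"

text \<open>Index sets are taken in the type of the elements of \<open>C\<close>. As the nonzero members of an orthogonal
  family are distinct, this is no restriction: see \<open>orth_complete_any_index\<close> below.\<close>

definition orth_complete :: "'c ring \<Rightarrow> ('c, 'a) module \<Rightarrow> 'a set \<Rightarrow> bool" where
  "orth_complete C E S \<longleftrightarrow> S \<subseteq> carrier E \<and>
     (\<forall>(I :: 'c set) \<xi> x. dense_orthogonal C I \<xi> \<and> x \<in> I \<rightarrow> S \<longrightarrow>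
        (\<exists>u\<in>S. \<forall>a\<in>I. \<xi> a \<odot>\<^bsub>E\<^esub> u = \<xi> a \<odot>\<^bsub>E\<^esub> x a))"

lemma orth_complete_any_index:
  fixes I :: "'i set"
  assumes S: "orth_complete C E S" and \<xi>: "dense_orthogonal C I \<xi>" and x: "x \<in> I \<rightarrow> S"
    and zero: "\<And>u. u \<in> carrier E \<Longrightarrow> \<zero>\<^bsub>C\<^esub> \<odot>\<^bsub>E\<^esub> u = \<zero>\<^bsub>E\<^esub>"
  shows "\<exists>u\<in>S. \<forall>a\<in>I. \<xi> a \<odot>\<^bsub>E\<^esub> u = \<xi> a \<odot>\<^bsub>E\<^esub> x a"
proof -
  have inj: "inj_on \<xi> {a \<in> I. \<xi> a \<noteq> \<zero>\<^bsub>C\<^esub>}"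
  proof (rule inj_onI; rule ccontr)
    fix a b assume ab: "a \<in> {a \<in> I. \<xi> a \<noteq> \<zero>\<^bsub>C\<^esub>}" "b \<in> {a \<in> I. \<xi> a \<noteq> \<zero>\<^bsub>C\<^esub>}" "\<xi> a = \<xi> b" "a \<noteq> b"
    then have "\<xi> a \<otimes>\<^bsub>C\<^esub> \<xi> b = \<zero>\<^bsub>C\<^esub>" using \<xi> by (auto simp: dense_orthogonal_def)
    moreover have "\<xi> a = \<xi> a \<otimes>\<^bsub>C\<^esub> \<xi> a" using \<xi> ab
      by (auto simp: dense_orthogonal_def dense_idempotents_def idempotents_def)
    ultimately show False using ab by auto
  qed
  define g where "g = (\<lambda>c. if c = \<zero>\<^bsub>C\<^esub> then (SOME a. a \<in> I) else inv_into {a \<in> I. \<xi> a \<noteq> \<zero>\<^bsub>C\<^esub>} \<xi> c)"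
  have g: "g (\<xi> a) = a" if "a \<in> I" "\<xi> a \<noteq> \<zero>\<^bsub>C\<^esub>" for a
    using that inv_into_f_f[OF inj] by (auto simp: g_def)
  have gI: "g c \<in> I" if "c \<in> \<xi> ` I" for c
    using that g by (cases "c = \<zero>\<^bsub>C\<^esub>") (auto simp: g_def intro: someI)
  have "dense_orthogonal C (\<xi> ` I) (\<lambda>c. c)"
    using \<xi> by (auto simp: dense_orthogonal_def)
  moreover have "(\<lambda>c. x (g c)) \<in> \<xi> ` I \<rightarrow> S" using gI x by blast
  ultimately obtain u where u: "u \<in> S" "\<forall>c\<in>\<xi> ` I. c \<odot>\<^bsub>E\<^esub> u = c \<odot>\<^bsub>E\<^esub> x (g c)"
    using S unfolding orth_complete_def by blast
  have "\<xi> a \<odot>\<^bsub>E\<^esub> u = \<xi> a \<odot>\<^bsub>E\<^esub> x a" if a: "a \<in> I" for a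
  proof (cases "\<xi> a = \<zero>\<^bsub>C\<^esub>")
    case True
    have "u \<in> carrier E" "x a \<in> carrier E" using S u x a by (auto simp: orth_complete_def)
    then show ?thesis using True zero by simp
  next
    case False then show ?thesis using u a g by force
  qed
  then show ?thesis using u by blast
qed

definition orth_completion :: "'c ring \<Rightarrow> ('c, 'a) module \<Rightarrow> 'a set \<Rightarrow> 'a set" where
  "orth_completion C E S = \<Inter>{T. orth_complete C E T \<and> S \<subseteq> T}"

text \<open>The orthogonal completion of a \<open>C\<close>-algebra \<open>P\<close> with underlying set in \<open>E\<close>. The addition and the
  action of \<open>C\<close> are those of \<open>E\<close>, the multiplication is extended from \<open>P\<close> by means of orthogonal sums.\<close>

definition orth_completion_mult ::
    "'c ring \<Rightarrow> ('c, 'a) module \<Rightarrow> ('c, 'a) module \<Rightarrow> 'a \<Rightarrow> 'a \<Rightarrow> 'a" where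
  "orth_completion_mult C P E u v =
     (THE w. \<exists>(I :: 'c set) \<xi> x (J :: 'c set) \<chi> y.
        dense_orthogonal C I \<xi> \<and> x \<in> I \<rightarrow> carrier P \<and>
        dense_orthogonal C J \<chi> \<and> y \<in> J \<rightarrow> carrier P \<and>
        u = orth_sum E I \<xi> x \<and> v = orth_sum E J \<chi> y \<and>
        w = orth_sum E (I \<times> J) (\<lambda>(a, b). \<xi> a \<otimes>\<^bsub>C\<^esub> \<chi> b) (\<lambda>(a, b). x a \<otimes>\<^bsub>P\<^esub> y b))"

definition orth_completion_algebra ::
    "'c ring \<Rightarrow> ('c, 'a) module \<Rightarrow> ('c, 'a) module \<Rightarrow> ('c, 'a) module" where
  "orth_completion_algebra C P E =
    \<lparr>carrier = orth_completion C E (carrier P),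
     mult = orth_completion_mult C P E,
     one = undefined,
     zero = zero E,
     add = add E,
     smult = smult E\<rparr>"

definition scalar_annihilator :: "'c ring \<Rightarrow> ('c, 'a) module \<Rightarrow> 'a set \<Rightarrow> 'c set" where
  "scalar_annihilator C E S = {\<phi> \<in> carrier C. \<forall>x\<in>S. \<phi> \<odot>\<^bsub>E\<^esub> x = \<zero>\<^bsub>E\<^esub>}"

end

theory Submission
  imports Defs
begin

text \<open>
  Everything rests on two facts about an injective hull \<open>E\<close> of a semiprime algebra \<open>R\<close>, regarded as a module
  over its multiplication ring. A homomorphism \<open>R \<rightarrow> E\<close> with essential kernel vanishes, because its image
  would contain a nonzero ideal with zero square. And every ideal \<open>N\<close> has the complement of all \<open>x\<close> with
  \<open>(xA)N = 0\<close>, such that the projection onto \<open>N\<close> extends to \<open>E\<close>. The first fact makes the endomorphisms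
  commute on products and hence on \<open>R\<close>; it also shows that homomorphisms from \<open>P(R)\<close> to \<open>I(P(R))\<close> are
  multiplications by elements of \<open>CM(R)\<close>. The second provides every \<open>u \<in> I(P(R))\<close> with a supporting
  idempotent, so that orthogonal sums are unique. They exist by injectivity, and
  \<open>O(S)\<close> consists of the \<open>u\<close> for which the idempotents \<open>\<epsilon>\<close> with \<open>\<epsilon>u \<in> \<epsilon>S\<close> are dense. Hence every identity
  in \<open>O(P(R))\<close> can be verified in \<open>P(R)\<close> after multiplication by such idempotents.
\<close>

section \<open>Right modules and their endomorphism rings\<close>

text \<open>In the absence of associativity a product is never rebracketed; it is only moved across
  a homomorphism, by f(x) y = f(xy) = x f(y). For the same reason the elements x with xN = 0 need
  not form an ideal, whence the condition (xA)N = 0 on the complement. The main obstacle is that two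
  hulls over different rings occur, I(R) over M(R)' and I(P(R)) over M(P(R))', which are related
  only through P(R). A homomorphism over M(P(R))' from a submodule N of P(R) into P(R) is one over
  M(R)' as well, extends to I(R), and restricts from there to an element of CM(R). If its values lie
  in I(P(R)), those elements of P(R) that are mapped into P(R) form an essential submodule, which
  determines the rest. The supporting idempotents arise in this way: on P(R) the projection onto N
  is multiplication by some e in CM(R). A further difficulty concerns O(R), whose ideals are stable
  under F but not under CM(R).\<close>

locale right_mod = right_module A E for A :: "('b, 'm) ring_scheme" (structure) and E :: "('b, 'c) module"
begin

abbreviation act_E (infixl "\<cdot>" 70) where "a \<cdot> x \<equiv> a \<odot>\<^bsub>E\<^esub> x"

abbreviation add_E (infixl "\<oplus>\<^sub>E" 65) where "x \<oplus>\<^sub>E y \<equiv> x \<oplus>\<^bsub>E\<^esub> y"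

abbreviation neg_E ("\<ominus>\<^sub>E _" [81] 80) where "\<ominus>\<^sub>E x \<equiv> \<ominus>\<^bsub>E\<^esub> x"

abbreviation zero_E ("\<zero>\<^sub>E") where "\<zero>\<^sub>E \<equiv> \<zero>\<^bsub>E\<^esub>"

abbreviation Sub :: "'c set \<Rightarrow> bool" where "Sub K \<equiv> submodule K A E"

text \<open>The target is always the whole of \<open>E\<close>, and nothing is required outside
  \<open>K\<close>, so that the restriction to a smaller submodule is the same function.\<close>

abbreviation Hom :: "'c set \<Rightarrow> ('c \<Rightarrow> 'c) set" where "Hom K \<equiv> mod_hom A (E\<lparr>carrier := K\<rparr>) E"

declare act_closed [simp, intro]

lemma act_zero_left [simp]: "x \<in> carrier E \<Longrightarrow> \<zero> \<cdot> x = \<zero>\<^sub>E"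
  using act_add_left[of \<zero> \<zero> x] act_closed[of \<zero> x] by (simp add: M.add.l_cancel_one)

lemma act_zero_right [simp]: "a \<in> carrier A \<Longrightarrow> a \<cdot> \<zero>\<^sub>E = \<zero>\<^sub>E"
  using act_add_right[of a "\<zero>\<^sub>E" "\<zero>\<^sub>E"] act_closed[of a "\<zero>\<^sub>E"] by (simp add: M.add.l_cancel_one)

lemma act_neg_left: "\<lbrakk>a \<in> carrier A; x \<in> carrier E\<rbrakk> \<Longrightarrow> (\<ominus> a) \<cdot> x = \<ominus>\<^sub>E (a \<cdot> x)"
  using act_add_left[of "\<ominus> a" a x] by (simp add: A.l_neg M.minus_equality)

lemma act_neg_right: "\<lbrakk>a \<in> carrier A; x \<in> carrier E\<rbrakk> \<Longrightarrow> a \<cdot> (\<ominus>\<^sub>E x) = \<ominus>\<^sub>E (a \<cdot> x)"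
  using act_add_right[of a "\<ominus>\<^sub>E x" x] by (simp add: M.l_neg M.minus_equality)

lemma diff_eq_zero: "\<lbrakk>x \<in> carrier E; y \<in> carrier E; x \<oplus>\<^sub>E \<ominus>\<^sub>E y = \<zero>\<^sub>E\<rbrakk> \<Longrightarrow> x = y"
  using M.minus_equality[of x "\<ominus>\<^sub>E y"] by simp

section \<open>Submodules of a right module\<close>

lemma SubD:
  assumes "Sub K"
  shows "x \<in> K \<Longrightarrow> x \<in> carrier E" "K \<subseteq> carrier E" "\<zero>\<^sub>E \<in> K"
    "\<lbrakk>x \<in> K; y \<in> K\<rbrakk> \<Longrightarrow> x \<oplus>\<^sub>E y \<in> K" "x \<in> K \<Longrightarrow> \<ominus>\<^sub>E x \<in> K"
    "\<lbrakk>a \<in> carrier A; x \<in> K\<rbrakk> \<Longrightarrow> a \<cdot> x \<in> K"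
proof -
  interpret K: submodule K A E by fact
  show "K \<subseteq> carrier E" "x \<in> K \<Longrightarrow> x \<in> carrier E" using K.subset by auto
  then show "\<zero>\<^sub>E \<in> K" "\<lbrakk>x \<in> K; y \<in> K\<rbrakk> \<Longrightarrow> x \<oplus>\<^sub>E y \<in> K" "x \<in> K \<Longrightarrow> \<ominus>\<^sub>E x \<in> K"
    "\<lbrakk>a \<in> carrier A; x \<in> K\<rbrakk> \<Longrightarrow> a \<cdot> x \<in> K"
    using K.one_closed K.m_closed[of x y] K.m_inv_closed[of x] K.smult_closed by (auto simp: a_inv_def)
qed

lemma SubI:
  assumes "K \<subseteq> carrier E" "\<zero>\<^sub>E \<in> K" "\<And>x y. \<lbrakk>x \<in> K; y \<in> K\<rbrakk> \<Longrightarrow> x \<oplus>\<^sub>E y \<in> K"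
    "\<And>a x. \<lbrakk>a \<in> carrier A; x \<in> K\<rbrakk> \<Longrightarrow> a \<cdot> x \<in> K"
  shows "Sub K"
proof (intro submodule.intro subgroup.intro submodule_axioms.intro)
  have "\<ominus>\<^sub>E x \<in> K" if "x \<in> K" for x
  proof -
    have "\<ominus>\<^sub>E x = (\<ominus> \<one>) \<cdot> x" using that assms(1) by (auto simp: act_neg_left act_one)
    then show ?thesis using that assms(4) by auto
  qed
  then show "\<And>x. x \<in> K \<Longrightarrow> inv\<^bsub>add_monoid E\<^esub> x \<in> K" by (simp add: a_inv_def)
qed (use assms in auto)

lemma Sub_carrier: "Sub (carrier E)" by (rule SubI) auto

lemma Sub_zero: "Sub {\<zero>\<^sub>E}" by (rule SubI) auto

lemma Sub_Int: "Sub K \<Longrightarrow> Sub L \<Longrightarrow> Sub (K \<inter> L)"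
  by (rule SubI) (use SubD in auto)

lemma Sub_cyclic: "x \<in> carrier E \<Longrightarrow> Sub ((\<lambda>a. a \<cdot> x) ` carrier A)"
proof (rule SubI)
  assume x: "x \<in> carrier E"
  then show "(\<lambda>a. a \<cdot> x) ` carrier A \<subseteq> carrier E" by auto
  show "\<zero>\<^sub>E \<in> (\<lambda>a. a \<cdot> x) ` carrier A" using x by (intro image_eqI[of _ _ \<zero>]) auto
  show "u \<oplus>\<^sub>E v \<in> (\<lambda>a. a \<cdot> x) ` carrier A"
    if "u \<in> (\<lambda>a. a \<cdot> x) ` carrier A" "v \<in> (\<lambda>a. a \<cdot> x) ` carrier A" for u v
  proof -
    from that obtain a b where "a \<in> carrier A" "b \<in> carrier A" "u = a \<cdot> x" "v = b \<cdot> x" by auto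
    then show ?thesis using x by (intro image_eqI[of _ _ "a \<oplus> b"]) (auto simp: act_add_left)
  qed
  show "b \<cdot> u \<in> (\<lambda>a. a \<cdot> x) ` carrier A"
    if "b \<in> carrier A" "u \<in> (\<lambda>a. a \<cdot> x) ` carrier A" for b u
  proof -
    from that obtain a where "a \<in> carrier A" "u = a \<cdot> x" by auto
    then show ?thesis using x that by (intro image_eqI[of _ _ "a \<otimes> b"]) (auto simp: act_assoc)
  qed
qed

lemma mem_cyclic: "x \<in> carrier E \<Longrightarrow> x \<in> (\<lambda>a. a \<cdot> x) ` carrier A"
  by (intro image_eqI[of _ _ \<one>]) (auto simp: act_one)

section \<open>Homomorphisms defined on a submodule\<close>

lemma HomI:
  assumes "\<And>x. x \<in> K \<Longrightarrow> f x \<in> carrier E"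
    "\<And>x y. \<lbrakk>x \<in> K; y \<in> K\<rbrakk> \<Longrightarrow> f (x \<oplus>\<^sub>E y) = f x \<oplus>\<^sub>E f y"
    "\<And>a x. \<lbrakk>a \<in> carrier A; x \<in> K\<rbrakk> \<Longrightarrow> f (a \<cdot> x) = a \<cdot> f x"
  shows "f \<in> Hom K"
  using assms by (auto simp: mod_hom_def)

lemma HomD:
  assumes "f \<in> Hom K"
  shows "x \<in> K \<Longrightarrow> f x \<in> carrier E"
    "\<lbrakk>x \<in> K; y \<in> K\<rbrakk> \<Longrightarrow> f (x \<oplus>\<^sub>E y) = f x \<oplus>\<^sub>E f y"
    "\<lbrakk>a \<in> carrier A; x \<in> K\<rbrakk> \<Longrightarrow> f (a \<cdot> x) = a \<cdot> f x"
  using assms by (auto simp: mod_hom_def)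

lemma Hom_zero:
  assumes "Sub K" "f \<in> Hom K" shows "f \<zero>\<^sub>E = \<zero>\<^sub>E"
  using HomD(2)[OF assms(2), of "\<zero>\<^sub>E" "\<zero>\<^sub>E"] HomD(1)[OF assms(2), of "\<zero>\<^sub>E"] SubD(3)[OF assms(1)]
  by (simp add: M.add.l_cancel_one)

lemma Hom_neg:
  assumes "Sub K" "f \<in> Hom K" "x \<in> K" shows "f (\<ominus>\<^sub>E x) = \<ominus>\<^sub>E f x"
proof -
  note x = SubD(1,5)[OF assms(1,3)]
  have "f (\<ominus>\<^sub>E x) \<oplus>\<^sub>E f x = \<zero>\<^sub>E"
    using HomD(2)[OF assms(2) x(2) assms(3)] Hom_zero[OF assms(1,2)] x by (simp add: M.l_neg)
  then show ?thesis using HomD(1)[OF assms(2)] x assms(3) by (simp add: M.minus_equality)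
qed

lemma Hom_restrict: "f \<in> Hom K \<Longrightarrow> L \<subseteq> K \<Longrightarrow> f \<in> Hom L"
  by (intro HomI) (auto dest: HomD)

lemma Hom_cong: "f \<in> Hom K \<Longrightarrow> Sub K \<Longrightarrow> (\<And>x. x \<in> K \<Longrightarrow> g x = f x) \<Longrightarrow> g \<in> Hom K"
  by (intro HomI) (auto simp: HomD SubD)

lemma Hom_comp: "f \<in> Hom K \<Longrightarrow> g \<in> Hom L \<Longrightarrow> (\<And>x. x \<in> K \<Longrightarrow> f x \<in> L) \<Longrightarrow> (\<lambda>x. g (f x)) \<in> Hom K"
  by (auto simp: mod_hom_def)

lemma Hom_diff:
  assumes "f \<in> Hom K" "g \<in> Hom K" "Sub K" shows "(\<lambda>x. f x \<oplus>\<^sub>E \<ominus>\<^sub>E g x) \<in> Hom K"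
proof (rule HomI)
  note F = HomD[OF assms(1)] and G = HomD[OF assms(2)]
  show "\<And>x. x \<in> K \<Longrightarrow> f x \<oplus>\<^sub>E \<ominus>\<^sub>E g x \<in> carrier E" using F G by simp
  show "\<And>x y. x \<in> K \<Longrightarrow> y \<in> K \<Longrightarrow>
    f (x \<oplus>\<^sub>E y) \<oplus>\<^sub>E \<ominus>\<^sub>E g (x \<oplus>\<^sub>E y) = f x \<oplus>\<^sub>E \<ominus>\<^sub>E g x \<oplus>\<^sub>E (f y \<oplus>\<^sub>E \<ominus>\<^sub>E g y)"
    using F G by (simp add: M.minus_add M.a_ac)
  show "\<And>a x. a \<in> carrier A \<Longrightarrow> x \<in> K \<Longrightarrow>
    f (a \<cdot> x) \<oplus>\<^sub>E \<ominus>\<^sub>E g (a \<cdot> x) = a \<cdot> (f x \<oplus>\<^sub>E \<ominus>\<^sub>E g x)"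
    using F G by (simp add: act_add_right act_neg_right)
qed

lemma Hom_id: "Sub K \<Longrightarrow> (\<lambda>x. x) \<in> Hom K"
  by (rule HomI) (auto dest: SubD)

lemma Sub_image:
  assumes "f \<in> Hom K" "Sub K" shows "Sub (f ` K)"
proof (rule SubI)
  show "f ` K \<subseteq> carrier E" using HomD[OF assms(1)] by auto
  show "\<zero>\<^sub>E \<in> f ` K" using SubD(3)[OF assms(2)] Hom_zero[OF assms(2,1)] by force
  show "u \<oplus>\<^sub>E v \<in> f ` K" if "u \<in> f ` K" "v \<in> f ` K" for u v
  proof -
    from that obtain x y where xy: "x \<in> K" "y \<in> K" "u = f x" "v = f y" by auto
    then have "u \<oplus>\<^sub>E v = f (x \<oplus>\<^sub>E y)" using HomD[OF assms(1)] by simp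
    then show ?thesis using xy SubD(4)[OF assms(2)] by blast
  qed
  show "a \<cdot> u \<in> f ` K" if "a \<in> carrier A" "u \<in> f ` K" for a u
  proof -
    from that obtain x where xy: "x \<in> K" "u = f x" by auto
    then have "a \<cdot> u = f (a \<cdot> x)" using HomD[OF assms(1)] that by simp
    then show ?thesis using xy SubD(6)[OF assms(2)] that by blast
  qed
qed

lemma Sub_preimage:
  assumes "f \<in> Hom K" "Sub K" "Sub L" shows "Sub {x \<in> K. f x \<in> L}"
  by (rule SubI) (use assms(2,3) HomD[OF assms(1)] Hom_zero[OF assms(2,1)] in \<open>auto dest: SubD\<close>)

lemma Sub_kernel:
  assumes "f \<in> Hom K" "Sub K" shows "Sub {x \<in> K. f x = \<zero>\<^sub>E}"
  using Sub_preimage[OF assms Sub_zero] by simp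

lemma Sub_abelian_group:
  fixes N (structure)
  assumes K: "Sub K" and N: "carrier N = K" "\<And>x y. x \<oplus>\<^bsub>N\<^esub> y = x \<oplus>\<^sub>E y" "\<zero>\<^bsub>N\<^esub> = \<zero>\<^sub>E"
  shows "abelian_group N"
proof (rule abelian_groupI)
  fix x assume "x \<in> carrier N"
  then show "\<exists>y\<in>carrier N. y \<oplus>\<^bsub>N\<^esub> x = \<zero>\<^bsub>N\<^esub>"
    using SubD[OF K] N by (intro bexI[of _ "\<ominus>\<^sub>E x"]) (auto simp: M.l_neg)
qed (use SubD[OF K] N in \<open>auto simp: M.a_ac\<close>)

end

section \<open>The ring of endomorphisms of a right module\<close>

lemma mod_End_simps [simp]:
  "f \<otimes>\<^bsub>mod_End A M\<^esub> g = (\<lambda>x\<in>carrier M. f (g x))"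
  "f \<oplus>\<^bsub>mod_End A M\<^esub> g = (\<lambda>x\<in>carrier M. f x \<oplus>\<^bsub>M\<^esub> g x)"
  "\<one>\<^bsub>mod_End A M\<^esub> = (\<lambda>x\<in>carrier M. x)"
  "\<zero>\<^bsub>mod_End A M\<^esub> = (\<lambda>x\<in>carrier M. \<zero>\<^bsub>M\<^esub>)"
  by (auto simp: mod_End_def)

lemma mod_End_iff:
  "f \<in> carrier (mod_End A M) \<longleftrightarrow> (\<forall>x\<in>carrier M. f x \<in> carrier M) \<and> f \<in> extensional (carrier M) \<and>
     (\<forall>x\<in>carrier M. \<forall>y\<in>carrier M. f (x \<oplus>\<^bsub>M\<^esub> y) = f x \<oplus>\<^bsub>M\<^esub> f y) \<and>
     (\<forall>a\<in>carrier A. \<forall>x\<in>carrier M. f (a \<odot>\<^bsub>M\<^esub> x) = a \<odot>\<^bsub>M\<^esub> f x)"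
  by (auto simp: mod_End_def mod_hom_def)

lemma mod_End_ring:
  assumes "right_module A M" shows "ring (mod_End A M)"
proof -
  interpret right_mod A M using assms by (simp add: right_mod_def)
  show ?thesis
  proof (rule ringI)
    show "abelian_group (mod_End A M)"
    proof (rule abelian_groupI)
      fix f assume f: "f \<in> carrier (mod_End A M)"
      show "\<exists>g\<in>carrier (mod_End A M). g \<oplus>\<^bsub>mod_End A M\<^esub> f = \<zero>\<^bsub>mod_End A M\<^esub>"
        by (rule bexI[of _ "\<lambda>x\<in>carrier M. \<ominus>\<^bsub>M\<^esub> f x"])
          (use f in \<open>auto simp: mod_End_iff M.l_neg M.r_neg M.minus_add M.a_ac act_neg_right fun_eq_iff\<close>)
    qed (auto simp: mod_End_iff M.a_ac act_add_right fun_eq_iff extensional_def)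
    show "Group.monoid (mod_End A M)"
      by (rule monoidI) (auto simp: mod_End_iff fun_eq_iff extensional_def)
  qed (auto simp: mod_End_iff M.a_ac fun_eq_iff extensional_def)
qed

lemma injective_module_right_mod: "injective_module A E \<Longrightarrow> right_mod A E"
  by (simp add: injective_module_def right_mod_def)

section \<open>Injective hulls of semiprime algebras\<close>

text \<open>\<open>E\<close> is an injective hull of a semiprime algebra \<open>R\<close> with product \<open>pr\<close>; \<open>A\<close> is generated by the
  multiplications \<open>l x\<close> and \<open>r x\<close> and the scalars \<open>Z\<close>. The ring underlying the algebra is left out so that
  the locale applies both to \<open>R\<close> over \<open>F\<close> and to \<open>P(R)\<close> over \<open>CM(R)\<close>.\<close>

locale semiprime_hull = right_mod A E for A :: "('b, 'm) ring_scheme" (structure) and E :: "('b, 'c) module" +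
  fixes R :: "'c set" and pr :: "'c \<Rightarrow> 'c \<Rightarrow> 'c" and l r :: "'c \<Rightarrow> 'b" and Z :: "'b set"
  assumes Sub_R: "Sub R"
    and l_closed [simp]: "x \<in> R \<Longrightarrow> l x \<in> carrier A"
    and r_closed [simp]: "x \<in> R \<Longrightarrow> r x \<in> carrier A"
    and l_act: "\<lbrakk>x \<in> R; y \<in> R\<rbrakk> \<Longrightarrow> l x \<cdot> y = pr x y"
    and r_act: "\<lbrakk>x \<in> R; y \<in> R\<rbrakk> \<Longrightarrow> r y \<cdot> x = pr x y"
    and injective: "injective_module A E"
    and meets_R: "\<lbrakk>Sub K; K \<noteq> {\<zero>\<^sub>E}\<rbrakk> \<Longrightarrow> K \<inter> R \<noteq> {\<zero>\<^sub>E}"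
    and semiprime: "\<lbrakk>Sub K; K \<subseteq> R; K \<noteq> {\<zero>\<^sub>E}\<rbrakk> \<Longrightarrow> \<exists>x\<in>K. \<exists>y\<in>K. pr x y \<noteq> \<zero>\<^sub>E"
    and Z_closed: "z \<in> Z \<Longrightarrow> z \<in> carrier A"
    and Z_central: "\<lbrakk>z \<in> Z; a \<in> carrier A\<rbrakk> \<Longrightarrow> z \<otimes> a = a \<otimes> z"
    and A_generated: "\<And>S. \<lbrakk>l ` R \<subseteq> S; r ` R \<subseteq> S; Z \<subseteq> S;
       \<And>a b. \<lbrakk>a \<in> carrier A; b \<in> carrier A; a \<in> S; b \<in> S\<rbrakk> \<Longrightarrow> a \<oplus> b \<in> S;
       \<And>a b. \<lbrakk>a \<in> carrier A; b \<in> carrier A; a \<in> S; b \<in> S\<rbrakk> \<Longrightarrow> a \<otimes> b \<in> S\<rbrakk> \<Longrightarrow> carrier A \<subseteq> S"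
begin

lemma A_induct:
  assumes "a \<in> carrier A" "\<And>x. x \<in> R \<Longrightarrow> Q (l x)" "\<And>x. x \<in> R \<Longrightarrow> Q (r x)" "\<And>z. z \<in> Z \<Longrightarrow> Q z"
    "\<And>a b. \<lbrakk>a \<in> carrier A; b \<in> carrier A; Q a; Q b\<rbrakk> \<Longrightarrow> Q (a \<oplus> b)"
    "\<And>a b. \<lbrakk>a \<in> carrier A; b \<in> carrier A; Q a; Q b\<rbrakk> \<Longrightarrow> Q (a \<otimes> b)"
  shows "Q a"
  using A_generated[of "{a. Q a}"] assms by blast


lemma R_carrier: "x \<in> R \<Longrightarrow> x \<in> carrier E" using SubD[OF Sub_R] by simp

lemma pr_closed: "\<lbrakk>x \<in> R; y \<in> R\<rbrakk> \<Longrightarrow> pr x y \<in> R"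
  using SubD(6)[OF Sub_R, of "l x" y] by (simp add: l_act)

lemma pr_add_left: "\<lbrakk>x \<in> R; y \<in> R; z \<in> R\<rbrakk> \<Longrightarrow> pr (x \<oplus>\<^sub>E y) z = pr x z \<oplus>\<^sub>E pr y z"
  using act_add_right[of "r z" x y] SubD(4)[OF Sub_R] by (simp add: r_act R_carrier)

lemma pr_add_right: "\<lbrakk>x \<in> R; y \<in> R; z \<in> R\<rbrakk> \<Longrightarrow> pr x (y \<oplus>\<^sub>E z) = pr x y \<oplus>\<^sub>E pr x z"
  using act_add_right[of "l x" y z] SubD(4)[OF Sub_R] by (simp add: l_act R_carrier)

lemma pr_zero_left: "y \<in> R \<Longrightarrow> pr \<zero>\<^sub>E y = \<zero>\<^sub>E"
  using r_act[of "\<zero>\<^sub>E" y] SubD(3)[OF Sub_R] by simp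

section \<open>Homomorphisms on \<open>R\<close> and essential ideals\<close>

lemma Hom_pr:
  assumes "f \<in> Hom R" "x \<in> R" "y \<in> R"
  shows "f (pr x y) = r y \<cdot> f x" "f (pr x y) = l x \<cdot> f y"
  using HomD(3)[OF assms(1), of "r y" x] HomD(3)[OF assms(1), of "l x" y] assms
  by (simp_all add: r_act l_act)

lemma Hom_extend: "Sub K \<Longrightarrow> f \<in> Hom K \<Longrightarrow> \<exists>g\<in>Hom (carrier E). \<forall>x\<in>K. g x = f x"
  using injective_module_extend[OF injective right_module_axioms] by simp

text \<open>Submodules of \<open>E\<close> are tested, not only those of \<open>R\<close>. By
  \<open>meets_R\<close> this amounts to the same, but it applies directly to the image of a
  homomorphism from \<open>R\<close> to \<open>E\<close>.\<close>

definition essential :: "'c set \<Rightarrow> bool" where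
  "essential H \<longleftrightarrow> Sub H \<and> H \<subseteq> R \<and> (\<forall>K. Sub K \<longrightarrow> K \<noteq> {\<zero>\<^sub>E} \<longrightarrow> K \<inter> H \<noteq> {\<zero>\<^sub>E})"

lemma essential_R: "essential R"
  using Sub_R meets_R by (auto simp: essential_def)

lemma essential_Int: "essential H \<Longrightarrow> essential H' \<Longrightarrow> essential (H \<inter> H')"
  unfolding essential_def by (metis Sub_Int Int_assoc le_infI1)

text \<open>Let \<open>n = f h\<close> and \<open>m\<close> lie both in the image and in the kernel.
  Then \<open>n m = f(h) m = f(h m) = h f(m) = 0\<close>, so all products in this ideal vanish. It
  is nonzero because the image meets the essential kernel.\<close>

lemma Hom_eq_zero:
  assumes f: "f \<in> Hom R" and ker: "essential {x \<in> R. f x = \<zero>\<^sub>E}" and x: "x \<in> R"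
  shows "f x = \<zero>\<^sub>E"
proof (rule ccontr)
  assume nz: "f x \<noteq> \<zero>\<^sub>E"
  let ?L = "{x \<in> R. f x = \<zero>\<^sub>E}" and ?T = "f ` R \<inter> R"
  have T: "Sub (f ` R)" using Sub_image[OF f Sub_R] .
  have L: "Sub ?L" using ker by (simp add: essential_def)
  have "f ` R \<inter> ?L \<noteq> {\<zero>\<^sub>E}" using ker T nz x unfolding essential_def by blast
  then obtain n m where nm: "n \<in> f ` R \<inter> ?L" "m \<in> f ` R \<inter> ?L" "pr n m \<noteq> \<zero>\<^sub>E"
    using semiprime[OF Sub_Int[OF T L]] by blast
  then obtain h where h: "h \<in> R" "n = f h" by auto
  have "pr n m = f (pr h m)" using Hom_pr(1)[OF f h(1), of m] nm h r_act[of n m] by simp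
  also have "\<dots> = \<zero>\<^sub>E" using Hom_pr(2)[OF f h(1), of m] nm h by simp
  finally show False using nm by simp
qed

lemma Hom_eqI:
  assumes "f \<in> Hom R" "g \<in> Hom R" "essential H" "\<And>x. x \<in> H \<Longrightarrow> f x = g x" "x \<in> R"
  shows "f x = g x"
proof -
  let ?d = "\<lambda>x. f x \<oplus>\<^sub>E \<ominus>\<^sub>E g x"
  have d: "?d \<in> Hom R" using Hom_diff[OF assms(1,2) Sub_R] .
  have sub: "H \<subseteq> {x \<in> R. ?d x = \<zero>\<^sub>E}"
    using assms(3,4) HomD(1)[OF assms(1)] HomD(1)[OF assms(2)] by (auto simp: essential_def M.r_neg subset_iff)
  have "essential {x \<in> R. ?d x = \<zero>\<^sub>E}"
    unfolding essential_def
  proof (intro conjI allI impI)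
    show "Sub {x \<in> R. ?d x = \<zero>\<^sub>E}" using Sub_kernel[OF d Sub_R] .
    fix K assume K: "Sub K" "K \<noteq> {\<zero>\<^sub>E}"
    then have "K \<inter> H \<noteq> {\<zero>\<^sub>E}" using assms(3) by (simp add: essential_def)
    moreover have "\<zero>\<^sub>E \<in> K \<inter> H" using K assms(3) SubD(3) by (simp add: essential_def)
    ultimately show "K \<inter> {x \<in> R. ?d x = \<zero>\<^sub>E} \<noteq> {\<zero>\<^sub>E}" using sub by blast
  qed auto
  then have "?d x = \<zero>\<^sub>E" using Hom_eq_zero[OF d _ assms(5)] by blast
  then show ?thesis using diff_eq_zero HomD(1)[OF assms(1)] HomD(1)[OF assms(2)] assms(5) by blast
qed

text \<open>A nonzero \<open>K\<close> meets \<open>R\<close> in a submodule whose image under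
  \<open>f\<close> is either zero, and then this submodule itself lies in the preimage, or meets
  \<open>H\<close> nontrivially.\<close>

lemma essential_preimage:
  assumes f: "f \<in> Hom R" and H: "essential H"
  shows "essential {x \<in> R. f x \<in> H}"
  unfolding essential_def
proof (intro conjI allI impI)
  have SH: "Sub H" using H by (simp add: essential_def)
  show "Sub {x \<in> R. f x \<in> H}" using Sub_preimage[OF f Sub_R SH] .
  fix K assume K: "Sub K" "K \<noteq> {\<zero>\<^sub>E}"
  have KR: "Sub (K \<inter> R)" using Sub_Int K(1) Sub_R by simp
  have 0: "\<zero>\<^sub>E \<in> K \<inter> R" using KR SubD(3) by blast
  obtain x where x: "x \<in> K \<inter> R" "x \<noteq> \<zero>\<^sub>E" using meets_R[OF K] 0 by blast
  have fK: "f \<in> Hom (K \<inter> R)" using Hom_restrict[OF f] by simp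
  show "K \<inter> {x \<in> R. f x \<in> H} \<noteq> {\<zero>\<^sub>E}"
  proof (cases "f ` (K \<inter> R) = {\<zero>\<^sub>E}")
    case True
    then have "f x = \<zero>\<^sub>E" using x by blast
    then have "x \<in> K \<inter> {x \<in> R. f x \<in> H}" using x SubD(3)[OF SH] by auto
    then show ?thesis using x by blast
  next
    case False
    then have "f ` (K \<inter> R) \<inter> H \<noteq> {\<zero>\<^sub>E}" using H Sub_image[OF fK KR] by (simp add: essential_def)
    moreover have "\<zero>\<^sub>E \<in> f ` (K \<inter> R) \<inter> H" using SubD(3)[OF SH] SubD(3)[OF Sub_image[OF fK KR]] by simp
    ultimately obtain y where y: "y \<in> K" "y \<in> R" "f y \<in> H" "f y \<noteq> \<zero>\<^sub>E" by blast
    then have "y \<noteq> \<zero>\<^sub>E" using Hom_zero[OF Sub_R f] by metis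
    then show ?thesis using y by auto
  qed
qed auto

text \<open>Endomorphisms commute on products, hence on \<open>R\<close> by semiprimeness.\<close>

lemma Hom_commute:
  assumes f: "f \<in> Hom (carrier E)" and g: "g \<in> Hom (carrier E)" and x: "x \<in> R"
  shows "f (g x) = g (f x)"
proof -
  have sub: "R \<subseteq> carrier E" using SubD(2)[OF Sub_R] .
  have fR: "f \<in> Hom R" and gR: "g \<in> Hom R" using Hom_restrict f g sub by blast+
  have fg: "(\<lambda>x. f (g x)) \<in> Hom R" and gf: "(\<lambda>x. g (f x)) \<in> Hom R"
    using Hom_comp[OF gR f] Hom_comp[OF fR g] HomD(1)[OF fR] HomD(1)[OF gR] by auto
  \<comment> \<open>On \<open>?H\<close> both maps stay in \<open>R\<close>, so that the images can
    again be written as factors of \<open>pr\<close>.\<close>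
  let ?H = "{x \<in> R. f x \<in> R} \<inter> {x \<in> R. g x \<in> R}"
  have H: "essential ?H"
    using essential_Int essential_preimage[OF fR essential_R] essential_preimage[OF gR essential_R] by blast
  have on_pr: "f (g (pr x y)) = g (f (pr x y))" if "x \<in> ?H" "y \<in> ?H" for x y
  proof -
    have "f (g (pr x y)) = f (pr (g x) y)" using that by (simp add: Hom_pr(1)[OF gR] r_act)
    also have "\<dots> = pr (g x) (f y)" using that by (simp add: Hom_pr(2)[OF fR] l_act)
    also have "\<dots> = g (pr x (f y))" using that by (simp add: Hom_pr(1)[OF gR] r_act)
    also have "\<dots> = g (f (pr x y))" using that by (simp add: Hom_pr(2)[OF fR] l_act)
    finally show ?thesis .
  qed
  let ?d = "\<lambda>x. f (g x) \<oplus>\<^sub>E \<ominus>\<^sub>E g (f x)"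
  have d: "?d \<in> Hom R" using Hom_diff[OF fg gf Sub_R] .
  have "essential {x \<in> R. ?d x = \<zero>\<^sub>E}"
    unfolding essential_def
  proof (intro conjI allI impI)
    show "Sub {x \<in> R. ?d x = \<zero>\<^sub>E}" using Sub_kernel[OF d Sub_R] .
    fix K assume K: "Sub K" "K \<noteq> {\<zero>\<^sub>E}"
    have "Sub (K \<inter> ?H)" "K \<inter> ?H \<noteq> {\<zero>\<^sub>E}" using H K Sub_Int unfolding essential_def by blast+
    then obtain x y where xy: "x \<in> K \<inter> ?H" "y \<in> K \<inter> ?H" "pr x y \<noteq> \<zero>\<^sub>E"
      using semiprime[of "K \<inter> ?H"] by blast
    have "pr x y \<in> K" using xy SubD(6)[OF K(1), of "l x" y] by (simp add: l_act)
    moreover have "pr x y \<in> R" using xy pr_closed by simp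
    moreover have "?d (pr x y) = \<zero>\<^sub>E"
      using on_pr[of x y] xy HomD(1)[OF gf, of "pr x y"] pr_closed by (simp add: M.r_neg)
    ultimately show "K \<inter> {x \<in> R. ?d x = \<zero>\<^sub>E} \<noteq> {\<zero>\<^sub>E}" using xy(3) by blast
  qed auto
  then have "?d x = \<zero>\<^sub>E" using Hom_eq_zero[OF d _ x] by blast
  then show ?thesis using diff_eq_zero HomD(1)[OF fg x] HomD(1)[OF gf x] by blast
qed

section \<open>Complements of ideals and projections\<close>

definition perp :: "'c set \<Rightarrow> 'c set" where
  "perp N = {x \<in> R. \<forall>a\<in>carrier A. \<forall>n\<in>N \<inter> R. pr (a \<cdot> x) n = \<zero>\<^sub>E}"

lemma perpD: "\<lbrakk>x \<in> perp N; n \<in> N \<inter> R\<rbrakk> \<Longrightarrow> pr x n = \<zero>\<^sub>E"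
  using act_one[of x] R_carrier unfolding perp_def by force

text \<open>Without associativity, \<open>pr x n = 0\<close> for all \<open>n\<close> does not pass
  from \<open>x\<close> to \<open>a \<cdot> x\<close>. The quantification over all operators in
  \<open>perp\<close> repairs this, as
  \<open>b \<cdot> (a \<cdot> x) = (a \<otimes> b) \<cdot> x\<close>.\<close>

lemma Sub_perp: "Sub (perp N)"
proof (rule SubI)
  note R = SubD[OF Sub_R]
  show "perp N \<subseteq> carrier E" using R by (auto simp: perp_def)
  show "\<zero>\<^sub>E \<in> perp N" using R by (auto simp: perp_def pr_zero_left)
  show "\<And>x y. x \<in> perp N \<Longrightarrow> y \<in> perp N \<Longrightarrow> x \<oplus>\<^sub>E y \<in> perp N"
    using R by (auto simp: perp_def pr_add_left act_add_right)
  show "\<And>a x. a \<in> carrier A \<Longrightarrow> x \<in> perp N \<Longrightarrow> a \<cdot> x \<in> perp N"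
  proof -
    fix a x assume a: "a \<in> carrier A" and x: "x \<in> perp N"
    have "pr (b \<cdot> (a \<cdot> x)) n = \<zero>\<^sub>E" if "b \<in> carrier A" "n \<in> N \<inter> R" for b n
    proof -
      have "b \<cdot> (a \<cdot> x) = (a \<otimes> b) \<cdot> x" using a x R that by (simp add: perp_def act_assoc)
      then show ?thesis using x a that by (simp add: perp_def)
    qed
    then show "a \<cdot> x \<in> perp N" using R x a by (auto simp: perp_def)
  qed
qed

lemma perp_Int: assumes "Sub N" shows "N \<inter> perp N = {\<zero>\<^sub>E}"
proof (rule ccontr)
  assume "N \<inter> perp N \<noteq> {\<zero>\<^sub>E}"
  moreover have "N \<inter> perp N \<subseteq> R" by (auto simp: perp_def)
  ultimately obtain x y where "x \<in> N \<inter> perp N" "y \<in> N \<inter> perp N" "pr x y \<noteq> \<zero>\<^sub>E"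
    using semiprime[OF Sub_Int[OF assms Sub_perp]] by blast
  then show False using perpD[of x N y] by (auto simp: perp_def)
qed

text \<open>Each factor pulls a product into its own submodule: \<open>pr (a \<cdot> x) n\<close>
  lies in \<open>K\<close> by right multiplication by \<open>n\<close>, and in \<open>N\<close> by
  left multiplication by \<open>a \<cdot> x\<close>. Hence it is zero.\<close>

lemma disjoint_perp:
  assumes N: "Sub N" and K: "Sub K" "K \<subseteq> R" "K \<inter> N = {\<zero>\<^sub>E}" shows "K \<subseteq> perp N"
proof
  fix x assume x: "x \<in> K"
  have "pr (a \<cdot> x) n = \<zero>\<^sub>E" if "a \<in> carrier A" "n \<in> N \<inter> R" for a n
  proof -
    have ax: "a \<cdot> x \<in> K" using SubD(6)[OF K(1) that(1) x] .
    then have "pr (a \<cdot> x) n \<in> K" using SubD(6)[OF K(1), of "r n"] that K(2) by (auto simp flip: r_act)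
    moreover have "pr (a \<cdot> x) n \<in> N"
      using SubD(6)[OF N, of "l (a \<cdot> x)" n] that K(2) ax by (auto simp flip: l_act)
    ultimately show ?thesis using K(3) by blast
  qed
  then show "x \<in> perp N" using x K(2) by (auto simp: perp_def)
qed

text \<open>\<open>g\<close> extends the projection of the direct sum of \<open>N\<close> and
  \<open>perp N\<close> onto \<open>N\<close>. Nothing guarantees that the extension maps into
  \<open>N\<close>; the last clause replaces this, saying that whatever kills \<open>N\<close> also
  kills \<open>g x\<close> for \<open>x\<close> in \<open>R\<close>. Taken for
  \<open>f = g - id\<close> and for multiplications, it makes \<open>g\<close> an idempotent scalar
  on the central closure.\<close>

lemma projection:
  assumes N: "Sub N"
  shows "\<exists>g\<in>Hom (carrier E). (\<forall>n\<in>N. g n = n) \<and>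
    (\<forall>f\<in>Hom (carrier E). (\<forall>n\<in>N. f n = \<zero>\<^sub>E) \<longrightarrow> (\<forall>x\<in>R. f (g x) = \<zero>\<^sub>E))"
proof -
  let ?M = "perp N"
  note N' = SubD[OF N] and M' = SubD[OF Sub_perp[of N]]
  define S where "S = {n \<oplus>\<^sub>E m | n m. n \<in> N \<and> m \<in> ?M}"
  define h where "h = (\<lambda>s. THE n. n \<in> N \<and> (\<exists>m\<in>?M. s = n \<oplus>\<^sub>E m))"
  have h: "h (n \<oplus>\<^sub>E m) = n" if nm: "n \<in> N" "m \<in> ?M" for n m
    unfolding h_def
  proof (rule the_equality)
    show "n \<in> N \<and> (\<exists>m'\<in>?M. n \<oplus>\<^sub>E m = n \<oplus>\<^sub>E m')" using nm by auto
    fix n' assume "n' \<in> N \<and> (\<exists>m'\<in>?M. n \<oplus>\<^sub>E m = n' \<oplus>\<^sub>E m')"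
    then obtain m' where n': "n' \<in> N" "m' \<in> ?M" and eq: "n \<oplus>\<^sub>E m = n' \<oplus>\<^sub>E m'" by auto
    note c = N'(1)[OF nm(1)] M'(1)[OF nm(2)] N'(1)[OF n'(1)] M'(1)[OF n'(2)]
    let ?q = "m \<oplus>\<^sub>E \<ominus>\<^sub>E m'"
    have "n' = n' \<oplus>\<^sub>E m' \<oplus>\<^sub>E \<ominus>\<^sub>E m'" using c by (simp add: M.a_assoc M.r_neg)
    also have "\<dots> = n \<oplus>\<^sub>E ?q" using c by (simp only: eq[symmetric] M.a_assoc M.a_inv_closed)
    also have "\<dots> = ?q \<oplus>\<^sub>E n" using c by (intro M.a_comm) simp_all
    finally have "n' \<oplus>\<^sub>E \<ominus>\<^sub>E n = ?q" using c by (simp add: M.a_assoc M.r_neg)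
    then have "n' \<oplus>\<^sub>E \<ominus>\<^sub>E n \<in> N" "n' \<oplus>\<^sub>E \<ominus>\<^sub>E n \<in> ?M"
      using N'(4)[OF n'(1) N'(5)[OF nm(1)]] M'(4)[OF nm(2) M'(5)[OF n'(2)]] by simp_all
    then have "n' \<oplus>\<^sub>E \<ominus>\<^sub>E n = \<zero>\<^sub>E" using perp_Int[OF N] by blast
    then show "n' = n" by (rule diff_eq_zero[OF c(3,1)])
  qed
  have SI: "n \<oplus>\<^sub>E m \<in> S" if "n \<in> N" "m \<in> ?M" for n m
    using that unfolding S_def by blast
  have S: "Sub S"
  proof (rule SubI)
    show "S \<subseteq> carrier E" using N' M' by (auto simp: S_def)
    have "\<zero>\<^sub>E = \<zero>\<^sub>E \<oplus>\<^sub>E \<zero>\<^sub>E" by simp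
    then show "\<zero>\<^sub>E \<in> S" using SI[OF N'(3) M'(3)] by simp
    show "x \<oplus>\<^sub>E y \<in> S" if "x \<in> S" "y \<in> S" for x y
    proof -
      from that obtain n m n' m' where 1: "n \<in> N" "m \<in> ?M" "n' \<in> N" "m' \<in> ?M" "x = n \<oplus>\<^sub>E m" "y = n' \<oplus>\<^sub>E m'"
        by (auto simp: S_def)
      then have "x \<oplus>\<^sub>E y = (n \<oplus>\<^sub>E n') \<oplus>\<^sub>E (m \<oplus>\<^sub>E m')" using N' M' by (simp add: M.a_ac)
      then show ?thesis using SI[OF N'(4) M'(4)] 1 by simp
    qed
    show "a \<cdot> x \<in> S" if "a \<in> carrier A" "x \<in> S" for a x
    proof -
      from that obtain n m where 1: "n \<in> N" "m \<in> ?M" "x = n \<oplus>\<^sub>E m" by (auto simp: S_def)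
      then have "a \<cdot> x = (a \<cdot> n) \<oplus>\<^sub>E (a \<cdot> m)" using N' M' that by (simp add: act_add_right)
      then show ?thesis using SI[OF N'(6) M'(6)] 1 that by simp
    qed
  qed
  have hS: "h \<in> Hom S"
  proof (rule HomI)
    show "\<And>x. x \<in> S \<Longrightarrow> h x \<in> carrier E" using h N' by (auto simp: S_def)
    show "h (x \<oplus>\<^sub>E y) = h x \<oplus>\<^sub>E h y" if "x \<in> S" "y \<in> S" for x y
    proof -
      from that obtain n m n' m' where 1: "n \<in> N" "m \<in> ?M" "n' \<in> N" "m' \<in> ?M" "x = n \<oplus>\<^sub>E m" "y = n' \<oplus>\<^sub>E m'"
        by (auto simp: S_def)
      then have "x \<oplus>\<^sub>E y = (n \<oplus>\<^sub>E n') \<oplus>\<^sub>E (m \<oplus>\<^sub>E m')" using N' M' by (simp add: M.a_ac)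
      then show ?thesis using 1 h N' M' by simp
    qed
    show "h (a \<cdot> x) = a \<cdot> h x" if "a \<in> carrier A" "x \<in> S" for a x
    proof -
      from that obtain n m where 1: "n \<in> N" "m \<in> ?M" "x = n \<oplus>\<^sub>E m" by (auto simp: S_def)
      then have "a \<cdot> x = (a \<cdot> n) \<oplus>\<^sub>E (a \<cdot> m)" using N' M' that by (simp add: act_add_right)
      then show ?thesis using 1 h N' M' that by simp
    qed
  qed
  obtain g where g: "g \<in> Hom (carrier E)" "\<And>x. x \<in> S \<Longrightarrow> g x = h x"
    using Hom_extend[OF S hS] by blast
  have gN: "g n = n" if "n \<in> N" for n
    using g(2)[OF SI[OF that M'(3)]] h[OF that M'(3)] N'(1)[OF that] by simp
  have gM: "g m = \<zero>\<^sub>E" if "m \<in> ?M" for m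
    using g(2)[OF SI[OF N'(3) that]] h[OF N'(3) that] M'(1)[OF that] by simp
  have "f (g x) = \<zero>\<^sub>E" if f: "f \<in> Hom (carrier E)" "\<And>n. n \<in> N \<Longrightarrow> f n = \<zero>\<^sub>E" and x: "x \<in> R" for f x
  proof -
    have gR: "g \<in> Hom R" using Hom_restrict[OF g(1)] SubD(2)[OF Sub_R] by blast
    have fg: "(\<lambda>x. f (g x)) \<in> Hom R" using Hom_comp[OF gR f(1)] HomD(1)[OF gR] by blast
    have f0: "f \<zero>\<^sub>E = \<zero>\<^sub>E" using Hom_zero[OF Sub_carrier f(1)] .
    have "essential {x \<in> R. f (g x) = \<zero>\<^sub>E}"
      unfolding essential_def
    proof (intro conjI allI impI)
      show "Sub {x \<in> R. f (g x) = \<zero>\<^sub>E}" using Sub_kernel[OF fg Sub_R] .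
      fix K assume K: "Sub K" "K \<noteq> {\<zero>\<^sub>E}"
      have KR: "Sub (K \<inter> R)" using Sub_Int K(1) Sub_R by blast
      have 0: "\<zero>\<^sub>E \<in> K \<inter> R" using SubD(3)[OF KR] .
      \<comment> \<open>A submodule of \<open>R\<close> that avoids \<open>N\<close> lies in
        \<open>perp N\<close>, where \<open>g\<close> vanishes; any other one contains a nonzero
        element of \<open>N\<close>, which \<open>g\<close> fixes and \<open>f\<close>
        kills.\<close>
      show "K \<inter> {x \<in> R. f (g x) = \<zero>\<^sub>E} \<noteq> {\<zero>\<^sub>E}"
      proof (cases "K \<inter> R \<inter> N = {\<zero>\<^sub>E}")
        case True
        then have "K \<inter> R \<subseteq> ?M" using disjoint_perp[OF N KR] by blast
        then have "K \<inter> R \<subseteq> {x \<in> R. f (g x) = \<zero>\<^sub>E}" using gM f0 by auto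
        then show ?thesis using meets_R[OF K] 0 by blast
      next
        case False
        then obtain x where "x \<in> K \<inter> R \<inter> N" "x \<noteq> \<zero>\<^sub>E" using 0 N'(3) by blast
        then show ?thesis using gN f(2) by auto
      qed
    qed auto
    then show ?thesis using Hom_eq_zero[OF fg _ x] by blast
  qed
  then show ?thesis using g(1) gN by (intro bexI[of _ g] conjI ballI impI) auto
qed

end

section \<open>The Martindale centroid and the central closure\<close>

text \<open>Elements of the centroid are additive on \<open>qhull\<close> only, hence the additively
  closed set \<open>K\<close>. With the identity for \<open>f\<close>, the second conclusion gives
  closure of \<open>K\<close> under finite sums.\<close>

lemma (in right_mod) additive_finsum:
  assumes K: "\<zero>\<^sub>E \<in> K" "K \<subseteq> carrier E" "\<And>x y. \<lbrakk>x \<in> K; y \<in> K\<rbrakk> \<Longrightarrow> x \<oplus>\<^sub>E y \<in> K"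
    and f: "f \<zero>\<^sub>E = \<zero>\<^sub>E" "\<And>x. x \<in> K \<Longrightarrow> f x \<in> carrier E"
      "\<And>x y. \<lbrakk>x \<in> K; y \<in> K\<rbrakk> \<Longrightarrow> f (x \<oplus>\<^sub>E y) = f x \<oplus>\<^sub>E f y"
    and S: "finite S" "g \<in> S \<rightarrow> K"
  shows "f (finsum E g S) = (\<Oplus>\<^bsub>E\<^esub>i\<in>S. f (g i)) \<and> finsum E g S \<in> K"
  using S
proof (induction S)
  case empty then show ?case using f(1) K(1) by simp
next
  case (insert i S)
  have "g \<in> S \<rightarrow> carrier E" "g i \<in> carrier E" "(\<lambda>i. f (g i)) \<in> S \<rightarrow> carrier E" "f (g i) \<in> carrier E"
    using insert.prems K(2) f(2) by auto
  then show ?case using insert f(3) K(3) by simp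
qed

context semiprime_hull
begin

section \<open>The quasi-injective hull and its endomorphisms\<close>

definition qhull :: "'c set" where
  "qhull = generate (add_monoid E) {\<phi> a | \<phi> a. \<phi> \<in> carrier (mod_End A E) \<and> a \<in> R}"

definition centroid :: "('c \<Rightarrow> 'c) ring" where "centroid = mod_End A (E\<lparr>carrier := qhull\<rparr>)"

lemma restrict_mod_End: "f \<in> Hom (carrier E) \<Longrightarrow> restrict f (carrier E) \<in> carrier (mod_End A E)"
  by (auto simp: mod_End_iff mod_hom_def)

lemma mod_End_Hom: "f \<in> carrier (mod_End A E) \<Longrightarrow> f \<in> Hom (carrier E)"
  by (auto simp: mod_End_def)

lemma qhull_incl:
  assumes "f \<in> Hom (carrier E)" "a \<in> R" shows "f a \<in> qhull"
proof -
  have "restrict f (carrier E) a \<in> qhull"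
    unfolding qhull_def using assms restrict_mod_End by (intro generate.incl) blast
  then show ?thesis using assms(2) R_carrier by simp
qed

lemma R_qhull: "a \<in> R \<Longrightarrow> a \<in> qhull"
  using qhull_incl[OF Hom_id[OF Sub_carrier]] by simp

lemma gens_carrier: "{\<phi> a | \<phi> a. \<phi> \<in> carrier (mod_End A E) \<and> a \<in> R} \<subseteq> carrier E"
proof
  fix x assume "x \<in> {\<phi> a | \<phi> a. \<phi> \<in> carrier (mod_End A E) \<and> a \<in> R}"
  then obtain f a where "f \<in> carrier (mod_End A E)" "a \<in> R" "x = f a" by blast
  then show "x \<in> carrier E" using HomD(1)[OF mod_End_Hom] R_carrier by simp
qed

lemma qhull_add: "\<lbrakk>x \<in> qhull; y \<in> qhull\<rbrakk> \<Longrightarrow> x \<oplus>\<^sub>E y \<in> qhull"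
  unfolding qhull_def using generate.eng[of x "add_monoid E" _ y] by simp

lemma qhull_carrier: "x \<in> qhull \<Longrightarrow> x \<in> carrier E"
  unfolding qhull_def using M.add.generate_in_carrier[OF gens_carrier] by simp

lemma qhull_zero: "\<zero>\<^sub>E \<in> qhull"
  using generate.one[of "add_monoid E"] by (simp add: qhull_def)

text \<open>The negative of \<open>f a\<close> is \<open>f\<close> applied to the negative of
  \<open>a\<close> and so again a generator; the case of inverses in \<open>generate\<close> is thus
  absorbed by \<open>gen\<close>.\<close>

lemma qhull_induct0 [consumes 1, case_names zero gen add]:
  assumes "p \<in> qhull" and 0: "Q \<zero>\<^sub>E" and gen: "\<And>f a. \<lbrakk>f \<in> Hom (carrier E); a \<in> R\<rbrakk> \<Longrightarrow> Q (f a)"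
    and add: "\<And>x y. \<lbrakk>x \<in> qhull; y \<in> qhull; Q x; Q y\<rbrakk> \<Longrightarrow> Q (x \<oplus>\<^sub>E y)"
  shows "Q p"
  using assms(1)[unfolded qhull_def]
proof (induction rule: generate.induct)
  case one then show ?case using 0 by simp
next
  case (incl h) then show ?case using gen mod_End_Hom by blast
next
  case (inv h)
  then obtain f a where fa: "f \<in> Hom (carrier E)" "a \<in> R" "h = f a" using mod_End_Hom by blast
  then have "\<ominus>\<^sub>E h = f (\<ominus>\<^sub>E a)" using Hom_neg[OF Sub_carrier fa(1)] R_carrier by simp
  then show ?case using gen[OF fa(1) SubD(5)[OF Sub_R fa(2)]] by (simp add: a_inv_def)
next
  case (eng x y) then show ?case using add by (simp add: qhull_def)
qed

lemma Sub_qhull: "Sub qhull"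
proof (rule SubI)
  fix a x assume a: "a \<in> carrier A" and "x \<in> qhull"
  from this(2) show "a \<cdot> x \<in> qhull"
  proof (induction rule: qhull_induct0)
    case zero then show ?case using qhull_zero a by simp
  next
    case (gen f b)
    then have "a \<cdot> f b = f (a \<cdot> b)" using HomD(3)[OF gen(1)] a R_carrier by simp
    then show ?case using qhull_incl[OF gen(1)] SubD(6)[OF Sub_R a] gen by simp
  next
    case (add x y) then show ?case using qhull_add a qhull_carrier by (simp add: act_add_right)
  qed
qed (use qhull_carrier qhull_zero qhull_add in auto)

lemma qhull_invariant:
  assumes f: "f \<in> Hom (carrier E)" and "p \<in> qhull" shows "f p \<in> qhull"
  using assms(2)
proof (induction rule: qhull_induct0)
  case zero then show ?case using qhull_zero Hom_zero[OF Sub_carrier f] by simp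
next
  case (gen g b)
  then show ?case using qhull_incl[OF Hom_comp[OF gen(1) f]] HomD(1)[OF gen(1)] by simp
next
  case (add x y) then show ?case using qhull_add qhull_carrier HomD(2)[OF f] by simp
qed

lemma centroid_iff: "c \<in> carrier centroid \<longleftrightarrow> (\<forall>x\<in>qhull. c x \<in> qhull) \<and> c \<in> extensional qhull \<and> c \<in> Hom qhull"
  using qhull_carrier by (auto simp: centroid_def mod_End_def mod_hom_def)

lemma centroid_D:
  assumes "c \<in> carrier centroid"
  shows "x \<in> qhull \<Longrightarrow> c x \<in> qhull" "c \<in> Hom qhull" "\<lbrakk>x \<in> qhull; y \<in> qhull\<rbrakk> \<Longrightarrow> c (x \<oplus>\<^sub>E y) = c x \<oplus>\<^sub>E c y"
    "\<lbrakk>a \<in> carrier A; x \<in> qhull\<rbrakk> \<Longrightarrow> c (a \<cdot> x) = a \<cdot> c x" "c \<zero>\<^sub>E = \<zero>\<^sub>E" "x \<in> qhull \<Longrightarrow> c x \<in> carrier E"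
  using assms HomD[of c qhull] Hom_zero[OF Sub_qhull, of c] qhull_carrier by (auto simp: centroid_iff)

lemma centroid_restrict:
  assumes g: "g \<in> Hom (carrier E)" shows "restrict g qhull \<in> carrier centroid"
proof -
  have "g \<in> Hom qhull" using Hom_restrict[OF g] qhull_carrier by blast
  then have "restrict g qhull \<in> Hom qhull" using Hom_cong[OF _ Sub_qhull] by simp
  then show ?thesis using qhull_invariant[OF g] by (auto simp: centroid_iff)
qed

text \<open>This is the quasi-injectivity of \<open>qhull\<close>. An extension of \<open>f\<close>
  to \<open>E\<close> maps \<open>qhull\<close> into itself because \<open>qhull\<close> is
  invariant under all endomorphisms of \<open>E\<close>; in particular the values of
  \<open>f\<close> lie in \<open>qhull\<close>.\<close>

lemma Hom_centroid:
  assumes "Sub N" "N \<subseteq> qhull" "f \<in> Hom N" shows "\<exists>c\<in>carrier centroid. \<forall>x\<in>N. c x = f x"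
proof -
  obtain g where g: "g \<in> Hom (carrier E)" "\<forall>x\<in>N. g x = f x" using Hom_extend[OF assms(1,3)] by blast
  show ?thesis by (rule bexI[OF _ centroid_restrict[OF g(1)]]) (use g assms(2) in auto)
qed

lemma centroid_extend: "c \<in> carrier centroid \<Longrightarrow> \<exists>g\<in>Hom (carrier E). \<forall>x\<in>qhull. g x = c x"
  using Hom_extend[OF Sub_qhull] by (simp add: centroid_iff)

lemma qhull_induct [consumes 1, case_names zero gen add]:
  assumes "p \<in> qhull" and 0: "Q \<zero>\<^sub>E" and gen: "\<And>c a. \<lbrakk>c \<in> carrier centroid; a \<in> R\<rbrakk> \<Longrightarrow> Q (c a)"
    and add: "\<And>x y. \<lbrakk>x \<in> qhull; y \<in> qhull; Q x; Q y\<rbrakk> \<Longrightarrow> Q (x \<oplus>\<^sub>E y)"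
  shows "Q p"
  using assms(1)
proof (induction rule: qhull_induct0)
  case (gen f a) then show ?case using assms(3)[OF centroid_restrict[OF gen(1)] gen(2)] R_qhull by simp
qed (use 0 add in auto)

text \<open>\<open>Hom_commute\<close> applies on \<open>R\<close> only, but a generator of
  \<open>qhull\<close> has the form \<open>h a\<close>. The endomorphism \<open>h\<close> is
  therefore moved outwards past the composite of \<open>f\<close> and \<open>g\<close>, these are
  interchanged at \<open>a\<close>, and \<open>h\<close> is moved back.\<close>

lemma centroid_commute:
  assumes c: "c \<in> carrier centroid" and d: "d \<in> carrier centroid" and "p \<in> qhull" shows "c (d p) = d (c p)"
proof -
  obtain f where f: "f \<in> Hom (carrier E)" "\<And>x. x \<in> qhull \<Longrightarrow> f x = c x" using centroid_extend[OF c] by blast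
  obtain g where g: "g \<in> Hom (carrier E)" "\<And>x. x \<in> qhull \<Longrightarrow> g x = d x" using centroid_extend[OF d] by blast
  note fg = Hom_comp[OF g(1) f(1)] Hom_comp[OF f(1) g(1)]
  from assms(3) have "f (g p) = g (f p)"
  proof (induction rule: qhull_induct0)
    case zero then show ?case using Hom_zero[OF Sub_carrier f(1)] Hom_zero[OF Sub_carrier g(1)] by simp
  next
    case (gen h a)
    have "f (g (h a)) = h (f (g a))"
      using Hom_commute[OF fg(1) gen] HomD(1)[OF g(1)] by simp
    also have "\<dots> = h (g (f a))" using Hom_commute[OF f(1) g(1) gen(2)] by simp
    also have "\<dots> = g (f (h a))"
      using Hom_commute[OF fg(2) gen] HomD(1)[OF f(1)] by simp
    finally show ?case .
  next
    case (add x y)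
    then show ?case using qhull_carrier HomD(1,2)[OF f(1)] HomD(1,2)[OF g(1)] by simp
  qed
  then show ?thesis using f(2) g(2) centroid_D(1)[OF c] centroid_D(1)[OF d] assms(3) by simp
qed

lemma right_module_qhull: "right_module A (E\<lparr>carrier := qhull\<rparr>)"
proof -
  note P = SubD[OF Sub_qhull]
  have "abelian_group (E\<lparr>carrier := qhull\<rparr>)" by (rule Sub_abelian_group[OF Sub_qhull]) simp_all
  then interpret P: abelian_group "E\<lparr>carrier := qhull\<rparr>" .
  show ?thesis
    by unfold_locales (use P in \<open>auto simp: act_add_left act_add_right act_assoc act_one\<close>)
qed

lemma centroid_ring: "ring centroid"
  unfolding centroid_def using mod_End_ring[OF right_module_qhull] .

lemma centroid_simps:
  "f \<otimes>\<^bsub>centroid\<^esub> g = (\<lambda>x\<in>qhull. f (g x))" "f \<oplus>\<^bsub>centroid\<^esub> g = (\<lambda>x\<in>qhull. f x \<oplus>\<^sub>E g x)"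
  "\<one>\<^bsub>centroid\<^esub> = (\<lambda>x\<in>qhull. x)" "\<zero>\<^bsub>centroid\<^esub> = (\<lambda>x\<in>qhull. \<zero>\<^sub>E)"
  by (simp_all add: centroid_def)

lemma centroid_cring: "cring centroid"
proof -
  interpret ring centroid by (rule centroid_ring)
  show ?thesis
    by unfold_locales (use centroid_commute in \<open>auto simp: centroid_simps intro!: restrict_ext\<close>)
qed

lemma Z_centroid: "z \<in> Z \<Longrightarrow> (\<lambda>x\<in>qhull. z \<cdot> x) \<in> carrier centroid"
proof -
  assume z: "z \<in> Z"
  have "(\<lambda>x. z \<cdot> x) \<in> Hom (carrier E)"
  proof (rule HomI)
    show "z \<cdot> (a \<cdot> x) = a \<cdot> (z \<cdot> x)" if "a \<in> carrier A" "x \<in> carrier E" for a x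
      using that z Z_closed Z_central act_assoc[of a z x] act_assoc[of z a x] by simp
  qed (use z Z_closed act_add_right in auto)
  then show ?thesis using centroid_restrict by fastforce
qed

section \<open>Well-definedness of the product of the central closure\<close>

definition is_rep :: "nat \<Rightarrow> (nat \<Rightarrow> 'c \<Rightarrow> 'c) \<Rightarrow> (nat \<Rightarrow> 'c) \<Rightarrow> 'c \<Rightarrow> bool" where
  "is_rep n \<phi> a x \<longleftrightarrow> \<phi> \<in> {..<n} \<rightarrow> carrier centroid \<and> a \<in> {..<n} \<rightarrow> R \<and> x = (\<Oplus>\<^bsub>E\<^esub> i \<in> {..<n}. \<phi> i (a i))"

lemma is_rep_Suc:
  assumes "is_rep n \<phi> a x" "c \<in> carrier centroid" "b \<in> R"
  shows "is_rep (Suc n) (\<phi>(n := c)) (a(n := b)) (x \<oplus>\<^sub>E c b)"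
proof -
  let ?\<phi> = "\<phi>(n := c)" and ?a = "a(n := b)"
  have c: "(\<lambda>i. \<phi> i (a i)) \<in> {..<n} \<rightarrow> carrier E" "c b \<in> carrier E"
    using assms centroid_D(6) R_qhull by (fastforce simp: is_rep_def Pi_def)+
  have *: "(\<Oplus>\<^bsub>E\<^esub> i \<in> {..<n}. ?\<phi> i (?a i)) = (\<Oplus>\<^bsub>E\<^esub> i \<in> {..<n}. \<phi> i (a i))"
    by (rule M.finsum_cong') (use c in auto)
  have "(\<lambda>i. ?\<phi> i (?a i)) \<in> {..<n} \<rightarrow> carrier E" using c by auto
  then have "(\<Oplus>\<^bsub>E\<^esub> i \<in> {..<Suc n}. ?\<phi> i (?a i)) = c b \<oplus>\<^sub>E (\<Oplus>\<^bsub>E\<^esub> i \<in> {..<n}. \<phi> i (a i))"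
    unfolding lessThan_Suc using c * by (subst M.finsum_insert) auto
  then show ?thesis using assms c by (auto simp: is_rep_def less_Suc_eq M.a_comm M.finsum_closed)
qed

lemma is_rep_empty: "is_rep 0 \<phi> a \<zero>\<^sub>E"
  by (simp add: is_rep_def)

lemma is_rep_single: "c \<in> carrier centroid \<Longrightarrow> b \<in> R \<Longrightarrow> is_rep 1 (\<lambda>_. c) (\<lambda>_. b) (c b)"
  using centroid_D(6) R_qhull by (auto simp: is_rep_def lessThan_Suc)

lemma is_rep_exists: assumes "p \<in> qhull" shows "\<exists>n \<phi> a. is_rep n \<phi> a p"
proof -
  \<comment> \<open>\<open>is_rep_Suc\<close> appends one summand at a time. Adding \<open>p\<close>
    to an arbitrary represented \<open>q\<close> lets the case of sums follow by applying the
    induction hypotheses in turn, without concatenating families.\<close>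
  from assms have "q \<in> carrier E \<longrightarrow> (\<exists>n \<phi> a. is_rep n \<phi> a q) \<longrightarrow> (\<exists>n \<phi> a. is_rep n \<phi> a (q \<oplus>\<^sub>E p))" for q
  proof (induction arbitrary: q rule: qhull_induct)
    case (gen c a) then show ?case using is_rep_Suc by blast
  next
    case (add x y)
    show ?case
      using add(3)[of q] add(4)[of "q \<oplus>\<^sub>E x"] qhull_carrier[OF add(1)] qhull_carrier[OF add(2)]
      by (auto simp: M.a_assoc) blast
  qed auto
  then show ?thesis using is_rep_empty[of undefined undefined] qhull_carrier[OF assms] M.l_zero M.zero_closed by metis
qed

lemma is_rep_qhull:
  assumes "is_rep n \<phi> a x" shows "x \<in> qhull"
proof -
  have "(\<Oplus>\<^bsub>E\<^esub> i \<in> {..<n}. \<phi> i (a i)) \<in> qhull"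
    using additive_finsum[of qhull "\<lambda>x. x" "{..<n}" "\<lambda>i. \<phi> i (a i)"] assms SubD[OF Sub_qhull] centroid_D(1) R_qhull
    by (fastforce simp: is_rep_def Pi_def)
  then show ?thesis using assms by (simp add: is_rep_def)
qed

text \<open>The product of \<open>x = \<Sum> \<phi> i (a i)\<close> with \<open>y\<close>. Only the
  left factor is expanded, as \<open>l (a i)\<close> acts on all of \<open>qhull\<close>;
  independence of the representation of \<open>y\<close> is thus built in, and only that of
  \<open>x\<close> remains.\<close>

definition csum :: "nat \<Rightarrow> (nat \<Rightarrow> 'c \<Rightarrow> 'c) \<Rightarrow> (nat \<Rightarrow> 'c) \<Rightarrow> 'c \<Rightarrow> 'c" where
  "csum n \<phi> a y = (\<Oplus>\<^bsub>E\<^esub> i \<in> {..<n}. \<phi> i (l (a i) \<cdot> y))"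

lemma qhull_act: "\<lbrakk>a \<in> carrier A; x \<in> qhull\<rbrakk> \<Longrightarrow> a \<cdot> x \<in> qhull"
  using SubD(6)[OF Sub_qhull] .

lemma csum_summand:
  assumes "is_rep n \<phi> a x" "i < n" "y \<in> qhull"
  shows "\<phi> i (l (a i) \<cdot> y) \<in> qhull" "\<phi> i (l (a i) \<cdot> y) \<in> carrier E" "\<phi> i \<in> carrier centroid" "a i \<in> R"
  using assms centroid_D(1)[of "\<phi> i", OF _ qhull_act] qhull_carrier by (auto simp: is_rep_def Pi_def)

lemma csum_closed:
  assumes "is_rep n \<phi> a x" "y \<in> qhull" shows "csum n \<phi> a y \<in> qhull"
  using additive_finsum[of qhull "\<lambda>x. x" "{..<n}" "\<lambda>i. \<phi> i (l (a i) \<cdot> y)"] csum_summand(1)[OF assms(1) _ assms(2)]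
    SubD[OF Sub_qhull] by (simp add: csum_def)

lemma csum_add:
  assumes "is_rep n \<phi> a x" "y \<in> qhull" "z \<in> qhull" shows "csum n \<phi> a (y \<oplus>\<^sub>E z) = csum n \<phi> a y \<oplus>\<^sub>E csum n \<phi> a z"
proof -
  note s = csum_summand[OF assms(1)]
  have "csum n \<phi> a (y \<oplus>\<^sub>E z) = (\<Oplus>\<^bsub>E\<^esub> i \<in> {..<n}. \<phi> i (l (a i) \<cdot> y) \<oplus>\<^sub>E \<phi> i (l (a i) \<cdot> z))"
    unfolding csum_def
  proof (rule M.finsum_cong')
    fix i assume "i \<in> {..<n}"
    then have i: "i < n" by simp
    show "\<phi> i (l (a i) \<cdot> (y \<oplus>\<^sub>E z)) = \<phi> i (l (a i) \<cdot> y) \<oplus>\<^sub>E \<phi> i (l (a i) \<cdot> z)"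
      using s[OF i] assms qhull_carrier qhull_act centroid_D(3)[OF s(3)[OF i assms(2)]] by (simp add: act_add_right)
  qed (use s assms in auto)
  also have "\<dots> = csum n \<phi> a y \<oplus>\<^sub>E csum n \<phi> a z"
    unfolding csum_def by (rule M.finsum_addf) (use s assms in auto)
  finally show ?thesis .
qed

lemma csum_smult:
  assumes "is_rep n \<phi> a x" "c \<in> carrier centroid" "y \<in> qhull" shows "csum n \<phi> a (c y) = c (csum n \<phi> a y)"
proof -
  note s = csum_summand[OF assms(1)]
  have "c (csum n \<phi> a y) = (\<Oplus>\<^bsub>E\<^esub> i \<in> {..<n}. c (\<phi> i (l (a i) \<cdot> y)))"
    using additive_finsum[of qhull c "{..<n}" "\<lambda>i. \<phi> i (l (a i) \<cdot> y)"] s(1)[OF _ assms(3)] SubD[OF Sub_qhull] centroid_D[OF assms(2)]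
    by (simp add: csum_def)
  also have "\<dots> = csum n \<phi> a (c y)"
    unfolding csum_def
  proof (rule M.finsum_cong')
    show "(\<lambda>i. \<phi> i (l (a i) \<cdot> c y)) \<in> {..<n} \<rightarrow> carrier E" using s centroid_D(1)[OF assms(2,3)] by auto
    fix i assume "i \<in> {..<n}"
    then have i: "i < n" by simp
    show "c (\<phi> i (l (a i) \<cdot> y)) = \<phi> i (l (a i) \<cdot> c y)"
      using s[OF i assms(3)] assms centroid_commute[OF assms(2) s(3)[OF i assms(3)]] qhull_act centroid_D(4)[OF assms(2), of "l (a i)" y] by simp
  qed simp
  finally show ?thesis by simp
qed

text \<open>\<open>\<phi> i (l (a i) \<cdot> b) = \<phi> i (r b \<cdot> a i) = r b \<cdot> \<phi> i
  (a i)\<close>, since right multiplication by \<open>b\<close> is an operator and commutes with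
  \<open>\<phi> i\<close>. The outcome involves \<open>x\<close> alone and not its
  representation.\<close>

lemma csum_gen:
  assumes "is_rep n \<phi> a x" "b \<in> R" shows "csum n \<phi> a b = r b \<cdot> x"
proof -
  note s = csum_summand[OF assms(1)]
  have x: "x = (\<Oplus>\<^bsub>E\<^esub> i \<in> {..<n}. \<phi> i (a i))" using assms by (simp add: is_rep_def)
  have 1: "\<phi> i (a i) \<in> qhull" if "i < n" for i using that s(3,4)[of i b] centroid_D(1) R_qhull assms by simp
  have "r b \<cdot> x = (\<Oplus>\<^bsub>E\<^esub> i \<in> {..<n}. r b \<cdot> (\<phi> i (a i)))"
    using additive_finsum[of qhull "\<lambda>x. r b \<cdot> x" "{..<n}" "\<lambda>i. \<phi> i (a i)"] 1 SubD[OF Sub_qhull] assms(2)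
    by (simp add: x act_add_right)
  also have "\<dots> = csum n \<phi> a b"
    unfolding csum_def
  proof (rule M.finsum_cong')
    show "(\<lambda>i. \<phi> i (l (a i) \<cdot> b)) \<in> {..<n} \<rightarrow> carrier E" using s assms R_qhull by auto
    fix i assume "i \<in> {..<n}"
    then have i: "i < n" by simp
    show "r b \<cdot> (\<phi> i (a i)) = \<phi> i (l (a i) \<cdot> b)"
      using s(3,4)[OF i R_qhull[OF assms(2)]] centroid_D(4)[of "\<phi> i" "r b" "a i"] assms(2) R_qhull
        by (simp add: l_act r_act)
  qed simp
  finally show ?thesis by simp
qed

text \<open>By additivity, the value of the product in the second factor is determined on multiples of elements of \<open>R\<close>.\<close>

lemma csum_unique:
  assumes "is_rep n \<phi> a x" "is_rep n' \<phi>' a' x" "y \<in> qhull" shows "csum n \<phi> a y = csum n' \<phi>' a' y"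
  using assms(3)
proof (induction rule: qhull_induct)
  case zero
  have "csum n \<phi> a \<zero>\<^sub>E = \<zero>\<^sub>E" if "is_rep n \<phi> a x" for n \<phi> a
    using csum_gen[OF that SubD(3)[OF Sub_R]] is_rep_qhull[OF that] csum_add[OF that qhull_zero qhull_zero]
      qhull_carrier[OF csum_closed[OF that qhull_zero]] by (simp add: M.add.l_cancel_one)
  then show ?case using assms by simp
next
  case (gen c b)
  then show ?case using csum_smult[OF _ gen(1) R_qhull] csum_gen assms by simp
next
  case (add u v) then show ?case using csum_add assms by simp
qed

text \<open>The description is that of \<open>central_closure_mult\<close>, so the two agree by
  unfolding once the locale is instantiated; \<open>cmul_rep\<close> is the form used for
  computation.\<close>

definition cmul :: "'c \<Rightarrow> 'c \<Rightarrow> 'c" where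
  "cmul x y = (THE z. \<exists>(n::nat) (m::nat) \<phi> \<psi> a b.
       \<phi> \<in> {..<n} \<rightarrow> carrier centroid \<and> a \<in> {..<n} \<rightarrow> R \<and> \<psi> \<in> {..<m} \<rightarrow> carrier centroid \<and> b \<in> {..<m} \<rightarrow> R \<and>
       x = (\<Oplus>\<^bsub>E\<^esub> i \<in> {..<n}. \<phi> i (a i)) \<and> y = (\<Oplus>\<^bsub>E\<^esub> j \<in> {..<m}. \<psi> j (b j)) \<and>
       z = (\<Oplus>\<^bsub>E\<^esub> i \<in> {..<n}. \<Oplus>\<^bsub>E\<^esub> j \<in> {..<m}. (\<phi> i \<otimes>\<^bsub>centroid\<^esub> \<psi> j) (pr (a i) (b j))))"

text \<open>Since \<open>\<psi> j\<close> commutes with the operator \<open>l (a i)\<close>, the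
  summand equals \<open>\<phi> i (l (a i) \<cdot> \<psi> j (b j))\<close>, and the sum over
  \<open>j\<close> collapses to \<open>y\<close> by additivity.\<close>

lemma double_sum:
  assumes x: "is_rep n \<phi> a x" and y: "is_rep m \<psi> b y"
  shows "(\<Oplus>\<^bsub>E\<^esub> i \<in> {..<n}. \<Oplus>\<^bsub>E\<^esub> j \<in> {..<m}. (\<phi> i \<otimes>\<^bsub>centroid\<^esub> \<psi> j) (pr (a i) (b j))) = csum n \<phi> a y"
  unfolding csum_def
proof (rule M.finsum_cong')
  note s = csum_summand[OF x]
  note y' = is_rep_qhull[OF y]
  show "(\<lambda>i. \<phi> i (l (a i) \<cdot> y)) \<in> {..<n} \<rightarrow> carrier E" using s y' by auto
  fix i assume "i \<in> {..<n}"
  then have i: "i < n" by simp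
  have b: "\<psi> j \<in> carrier centroid" "b j \<in> R" if "j < m" for j using csum_summand(3,4)[OF y that y'] .
  let ?f = "\<lambda>u. \<phi> i (l (a i) \<cdot> u)"
  have "?f y = (\<Oplus>\<^bsub>E\<^esub> j \<in> {..<m}. ?f (\<psi> j (b j)))"
    using additive_finsum[of qhull ?f "{..<m}" "\<lambda>j. \<psi> j (b j)"] SubD[OF Sub_qhull] centroid_D[OF s(3)[OF i y']] s(4)[OF i y']
      centroid_D(1)[OF b(1)] R_qhull[OF b(2)] y by (simp add: is_rep_def act_add_right)
  also have "\<dots> = (\<Oplus>\<^bsub>E\<^esub> j \<in> {..<m}. (\<phi> i \<otimes>\<^bsub>centroid\<^esub> \<psi> j) (pr (a i) (b j)))"
  proof (rule M.finsum_cong')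
    show "(\<lambda>j. (\<phi> i \<otimes>\<^bsub>centroid\<^esub> \<psi> j) (pr (a i) (b j))) \<in> {..<m} \<rightarrow> carrier E"
      using centroid_D(1,6)[OF s(3)[OF i y']] centroid_D(1)[OF b(1)] R_qhull pr_closed b(2) s(4)[OF i y']
        by (auto simp: centroid_simps)
    fix j assume "j \<in> {..<m}"
    then have j: "j < m" by simp
    show "?f (\<psi> j (b j)) = (\<phi> i \<otimes>\<^bsub>centroid\<^esub> \<psi> j) (pr (a i) (b j))"
      using centroid_D(4)[OF b(1)[OF j], of "l (a i)" "b j"] b[OF j] s(4)[OF i y'] R_qhull pr_closed
        by (simp add: centroid_simps l_act)
  qed simp
  finally show "(\<Oplus>\<^bsub>E\<^esub> j \<in> {..<m}. (\<phi> i \<otimes>\<^bsub>centroid\<^esub> \<psi> j) (pr (a i) (b j))) = ?f y" by simp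
qed simp

lemma cmul_rep:
  assumes x: "is_rep n \<phi> a x" and y: "y \<in> qhull" shows "cmul x y = csum n \<phi> a y"
proof -
  obtain m \<psi> b where y': "is_rep m \<psi> b y" using is_rep_exists[OF y] by blast
  show ?thesis
    unfolding cmul_def
  proof (rule the_equality, goal_cases)
    case 1
    show ?case
      by (intro exI[of _ n] exI[of _ m] exI[of _ \<phi>] exI[of _ \<psi>] exI[of _ a] exI[of _ b])
        (use x y' double_sum[OF x y'] in \<open>simp add: is_rep_def\<close>)
  next
    case (2 z)
    then obtain n' m' \<phi>' \<psi>' a' b' where "is_rep n' \<phi>' a' x" "is_rep m' \<psi>' b' y"
      "z = (\<Oplus>\<^bsub>E\<^esub> i \<in> {..<n'}. \<Oplus>\<^bsub>E\<^esub> j \<in> {..<m'}. (\<phi>' i \<otimes>\<^bsub>centroid\<^esub> \<psi>' j) (pr (a' i) (b' j)))"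
      unfolding is_rep_def by blast
    then show ?case using double_sum csum_unique[OF _ x y] by simp
  qed
qed

lemma cmul_gen_left: "\<lbrakk>c \<in> carrier centroid; a \<in> R; y \<in> qhull\<rbrakk> \<Longrightarrow> cmul (c a) y = c (l a \<cdot> y)"
  using cmul_rep[OF is_rep_single] centroid_D(6)[OF _ qhull_act[OF l_closed]] by (simp add: csum_def lessThan_Suc)

lemma cmul_closed: "\<lbrakk>x \<in> qhull; y \<in> qhull\<rbrakk> \<Longrightarrow> cmul x y \<in> qhull"
  using is_rep_exists cmul_rep csum_closed by metis

lemma cmul_add_right: "\<lbrakk>x \<in> qhull; y \<in> qhull; z \<in> qhull\<rbrakk> \<Longrightarrow> cmul x (y \<oplus>\<^sub>E z) = cmul x y \<oplus>\<^sub>E cmul x z"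
  using is_rep_exists[of x] cmul_rep csum_add qhull_add by auto

lemma cmul_smult_right: "\<lbrakk>c \<in> carrier centroid; x \<in> qhull; y \<in> qhull\<rbrakk> \<Longrightarrow> cmul x (c y) = c (cmul x y)"
  using is_rep_exists[of x] cmul_rep csum_smult centroid_D(1) by auto

lemma cmul_right: "\<lbrakk>x \<in> qhull; b \<in> R\<rbrakk> \<Longrightarrow> cmul x b = r b \<cdot> x"
  using is_rep_exists[of x] cmul_rep csum_gen R_qhull by metis

lemma cmul_left: "\<lbrakk>a \<in> R; y \<in> qhull\<rbrakk> \<Longrightarrow> cmul a y = l a \<cdot> y"
  using cmul_gen_left[of "\<lambda>x\<in>qhull. x" a y] centroid_restrict[OF Hom_id[OF Sub_carrier]] R_qhull qhull_act by simp

lemma cmul_R: "\<lbrakk>a \<in> R; b \<in> R\<rbrakk> \<Longrightarrow> cmul a b = pr a b"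
  using cmul_left R_qhull l_act by simp

lemma cmul_zero_right: "x \<in> qhull \<Longrightarrow> cmul x \<zero>\<^sub>E = \<zero>\<^sub>E"
  using cmul_add_right[of x "\<zero>\<^sub>E" "\<zero>\<^sub>E"] qhull_zero qhull_carrier[OF cmul_closed[of x "\<zero>\<^sub>E"]]
    by (simp add: M.add.l_cancel_one)

text \<open>\<open>csum\<close> gives no access to a sum on the left, where it depends on a
  representation. Induction on the right factor does: at \<open>c b\<close> the product is
  \<open>c (r b \<cdot> x)\<close>, which is additive in \<open>x\<close>.\<close>

lemma cmul_add_left:
  assumes "x \<in> qhull" "y \<in> qhull" "z \<in> qhull" shows "cmul (x \<oplus>\<^sub>E y) z = cmul x z \<oplus>\<^sub>E cmul y z"
  using assms(3)
proof (induction rule: qhull_induct)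
  case zero then show ?case using assms qhull_add by (simp add: cmul_zero_right)
next
  case (gen c b)
  then show ?case using assms qhull_add R_qhull qhull_act qhull_carrier
    by (simp add: cmul_smult_right cmul_right act_add_right centroid_D(3))
next
  case (add u v)
  then show ?case using assms qhull_add qhull_carrier cmul_closed by (simp add: cmul_add_right M.a_ac)
qed

lemma cmul_smult_left:
  assumes "c \<in> carrier centroid" "x \<in> qhull" "y \<in> qhull" shows "cmul (c x) y = c (cmul x y)"
  using assms(3)
proof (induction rule: qhull_induct)
  case zero then show ?case using assms centroid_D(1,5)[OF assms(1)] by (simp add: cmul_zero_right)
next
  case (gen d b)
  then show ?case
    using assms centroid_D(1)[OF assms(1)] R_qhull qhull_act centroid_D(4)[OF assms(1)] centroid_commute[OF assms(1) gen(1)]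
    by (simp add: cmul_smult_right cmul_right)
next
  case (add u v)
  then show ?case using assms centroid_D(1)[OF assms(1)] centroid_D(3)[OF assms(1)] cmul_closed
    by (simp add: cmul_add_right)
qed

text \<open>\<open>A\<close> is generated by \<open>l\<close>, \<open>r\<close> and
  \<open>Z\<close>, and the elements of \<open>Z\<close> act on \<open>qhull\<close> as elements of
  the centroid. So the operations of the central closure control the action of \<open>A\<close>: its
  ideals become submodules of \<open>E\<close> and, by \<open>qhull_Hom\<close>, maps compatible
  with its operations become homomorphisms.\<close>

lemma qhull_ideal_Sub:
  assumes K: "K \<subseteq> qhull" "\<zero>\<^sub>E \<in> K" "\<And>x y. \<lbrakk>x \<in> K; y \<in> K\<rbrakk> \<Longrightarrow> x \<oplus>\<^sub>E y \<in> K"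
    "\<And>c x. \<lbrakk>c \<in> carrier centroid; x \<in> K\<rbrakk> \<Longrightarrow> c x \<in> K"
    "\<And>a x. \<lbrakk>a \<in> R; x \<in> K\<rbrakk> \<Longrightarrow> cmul a x \<in> K" "\<And>a x. \<lbrakk>a \<in> R; x \<in> K\<rbrakk> \<Longrightarrow> cmul x a \<in> K"
  shows "Sub K"
proof (rule SubI)
  show "K \<subseteq> carrier E" using K(1) qhull_carrier by auto
  fix a x assume "a \<in> carrier A" "x \<in> K"
  have "\<forall>x\<in>K. a \<cdot> x \<in> K"
    using \<open>a \<in> carrier A\<close>
  proof (rule A_induct)
    show "\<forall>x\<in>K. l a \<cdot> x \<in> K" if "a \<in> R" for a using K(1,5) that by (auto simp flip: cmul_left)
    show "\<forall>x\<in>K. r a \<cdot> x \<in> K" if "a \<in> R" for a using K(1,6) that by (auto simp flip: cmul_right)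
    show "\<forall>x\<in>K. z \<cdot> x \<in> K" if "z \<in> Z" for z
    proof
      fix x assume x: "x \<in> K"
      then have "x \<in> qhull" using K(1) by blast
      then show "z \<cdot> x \<in> K" using K(4)[OF Z_centroid[OF that] x] by simp
    qed
  qed (use K qhull_carrier in \<open>auto simp: act_add_left act_assoc subset_iff\<close>)
  then show "a \<cdot> x \<in> K" using \<open>x \<in> K\<close> by blast
qed (use K in auto)

lemma qhull_Hom:
  assumes K: "Sub K" "K \<subseteq> qhull" and f: "\<And>x. x \<in> K \<Longrightarrow> f x \<in> qhull"
    "\<And>x y. \<lbrakk>x \<in> K; y \<in> K\<rbrakk> \<Longrightarrow> f (x \<oplus>\<^sub>E y) = f x \<oplus>\<^sub>E f y"
    "\<And>c x. \<lbrakk>c \<in> carrier centroid; x \<in> K\<rbrakk> \<Longrightarrow> f (c x) = c (f x)"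
    "\<And>a x. \<lbrakk>a \<in> R; x \<in> K\<rbrakk> \<Longrightarrow> f (cmul a x) = cmul a (f x)" "\<And>a x. \<lbrakk>a \<in> R; x \<in> K\<rbrakk> \<Longrightarrow> f (cmul x a) = cmul (f x) a"
  shows "f \<in> Hom K"
proof (rule HomI)
  show "\<And>x. x \<in> K \<Longrightarrow> f x \<in> carrier E" using f(1) qhull_carrier by auto
  fix a x assume "a \<in> carrier A" "x \<in> K"
  have "\<forall>x\<in>K. f (a \<cdot> x) = a \<cdot> f x"
    using \<open>a \<in> carrier A\<close>
  proof (rule A_induct)
    show "\<forall>x\<in>K. f (l a \<cdot> x) = l a \<cdot> f x" if "a \<in> R" for a using K(2) f(1,4) that by (auto simp flip: cmul_left)
    show "\<forall>x\<in>K. f (r a \<cdot> x) = r a \<cdot> f x" if "a \<in> R" for a using K(2) f(1,5) that by (auto simp flip: cmul_right)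
    show "\<forall>x\<in>K. f (z \<cdot> x) = z \<cdot> f x" if "z \<in> Z" for z
    proof
      fix x assume x: "x \<in> K"
      then have "x \<in> qhull" using K(2) by blast
      then show "f (z \<cdot> x) = z \<cdot> f x" using f(3)[OF Z_centroid[OF that] x] f(1)[OF x] by simp
    qed
  next
    fix a b assume "a \<in> carrier A" "b \<in> carrier A" "\<forall>x\<in>K. f (a \<cdot> x) = a \<cdot> f x" "\<forall>x\<in>K. f (b \<cdot> x) = b \<cdot> f x"
    then show "\<forall>x\<in>K. f ((a \<oplus> b) \<cdot> x) = (a \<oplus> b) \<cdot> f x" "\<forall>x\<in>K. f ((a \<otimes> b) \<cdot> x) = (a \<otimes> b) \<cdot> f x"
      using SubD[OF K(1)] f(1,2) qhull_carrier by (simp_all add: act_add_left act_assoc)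
  qed
  then show "f (a \<cdot> x) = a \<cdot> f x" using \<open>x \<in> K\<close> by blast
qed (use f in auto)

lemma qhull_semiprime:
  assumes "Sub K" "K \<subseteq> qhull" "K \<noteq> {\<zero>\<^sub>E}" shows "\<exists>x\<in>K. \<exists>y\<in>K. cmul x y \<noteq> \<zero>\<^sub>E"
  using semiprime[OF Sub_Int[OF assms(1) Sub_R] _ meets_R[OF assms(1,3)]]
  by (metis IntD1 IntD2 Int_lower2 cmul_R)

end

section \<open>Supports and orthogonal sums\<close>

text \<open>The situation of the hull \<open>I(P(R))\<close> of \<open>P = P(R)\<close> with \<open>C = CM(R)\<close>.\<close>

locale closed_hull = semiprime_hull A E P pr l r "carrier C"
  for A :: "('b, 'm) ring_scheme" (structure) and E :: "('b, 'c) module" and P pr l r and C :: "'b ring" +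
  assumes C_cring: "cring C"
    and C_add: "\<lbrakk>c \<in> carrier C; d \<in> carrier C\<rbrakk> \<Longrightarrow> c \<oplus>\<^bsub>C\<^esub> d = c \<oplus> d"
    and C_mult: "\<lbrakk>c \<in> carrier C; d \<in> carrier C\<rbrakk> \<Longrightarrow> c \<otimes>\<^bsub>C\<^esub> d = c \<otimes> d"
    and C_zero: "\<zero>\<^bsub>C\<^esub> = \<zero>" and C_one: "\<one>\<^bsub>C\<^esub> = \<one>"
    and Hom_C: "\<lbrakk>Sub N; N \<subseteq> P; f \<in> Hom N; \<And>x. x \<in> N \<Longrightarrow> f x \<in> P\<rbrakk> \<Longrightarrow> \<exists>c\<in>carrier C. \<forall>x\<in>N. f x = c \<cdot> x"
    and faithful: "\<lbrakk>c \<in> carrier C; \<And>x. x \<in> P \<Longrightarrow> c \<cdot> x = \<zero>\<^sub>E\<rbrakk> \<Longrightarrow> c = \<zero>\<^bsub>C\<^esub>"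
begin

section \<open>The action of the central scalars\<close>

abbreviation mult_C (infixl "\<otimes>\<^sub>C" 70) where "c \<otimes>\<^sub>C d \<equiv> c \<otimes>\<^bsub>C\<^esub> d"

abbreviation zero_C ("\<zero>\<^sub>C") where "\<zero>\<^sub>C \<equiv> \<zero>\<^bsub>C\<^esub>"

sublocale C: cring C by (rule C_cring)

lemma C_act_closed [simp]: "\<lbrakk>c \<in> carrier C; u \<in> carrier E\<rbrakk> \<Longrightarrow> c \<cdot> u \<in> carrier E"
  using Z_closed by simp

text \<open>The action of \<open>A\<close> is a right action and reverses products. Commutativity of
  \<open>C\<close> turns its restriction to \<open>C\<close> into a left action as well.\<close>

lemma C_act_mult: "\<lbrakk>c \<in> carrier C; d \<in> carrier C; u \<in> carrier E\<rbrakk> \<Longrightarrow> (c \<otimes>\<^sub>C d) \<cdot> u = c \<cdot> (d \<cdot> u)"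
  by (subst C.m_comm) (simp_all add: C_mult Z_closed act_assoc)

lemma C_act_add: "\<lbrakk>c \<in> carrier C; d \<in> carrier C; u \<in> carrier E\<rbrakk> \<Longrightarrow> (c \<oplus>\<^bsub>C\<^esub> d) \<cdot> u = c \<cdot> u \<oplus>\<^sub>E d \<cdot> u"
  by (simp add: C_add Z_closed act_add_left)

lemma C_act_zero [simp]: "u \<in> carrier E \<Longrightarrow> \<zero>\<^sub>C \<cdot> u = \<zero>\<^sub>E"
  by (simp add: C_zero)

lemma C_act_one [simp]: "u \<in> carrier E \<Longrightarrow> \<one>\<^bsub>C\<^esub> \<cdot> u = u"
  by (simp add: C_one act_one)

lemma C_act_zero_right [simp]: "c \<in> carrier C \<Longrightarrow> c \<cdot> \<zero>\<^sub>E = \<zero>\<^sub>E"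
  by (simp add: Z_closed)

lemma C_act_add_right: "\<lbrakk>c \<in> carrier C; u \<in> carrier E; v \<in> carrier E\<rbrakk> \<Longrightarrow> c \<cdot> (u \<oplus>\<^sub>E v) = c \<cdot> u \<oplus>\<^sub>E c \<cdot> v"
  by (simp add: Z_closed act_add_right)

lemma C_act_neg: "\<lbrakk>c \<in> carrier C; u \<in> carrier E\<rbrakk> \<Longrightarrow> (\<ominus>\<^bsub>C\<^esub> c) \<cdot> u = \<ominus>\<^sub>E (c \<cdot> u)"
  using C_act_add[of "\<ominus>\<^bsub>C\<^esub> c" c u] by (simp add: C.l_neg M.minus_equality)

lemma C_act_neg_right: "\<lbrakk>c \<in> carrier C; u \<in> carrier E\<rbrakk> \<Longrightarrow> c \<cdot> (\<ominus>\<^sub>E u) = \<ominus>\<^sub>E (c \<cdot> u)"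
  by (simp add: Z_closed act_neg_right)

lemma C_act_commute: "\<lbrakk>c \<in> carrier C; a \<in> carrier A; u \<in> carrier E\<rbrakk> \<Longrightarrow> c \<cdot> (a \<cdot> u) = a \<cdot> (c \<cdot> u)"
  using Z_closed[of c] Z_central[of c a] act_assoc[of a c u] act_assoc[of c a u] by simp

lemma C_Hom: "c \<in> carrier C \<Longrightarrow> (\<lambda>u. c \<cdot> u) \<in> Hom (carrier E)"
  by (rule HomI) (simp_all add: C_act_add_right C_act_commute)

lemma P_act: "\<lbrakk>a \<in> carrier A; x \<in> P\<rbrakk> \<Longrightarrow> a \<cdot> x \<in> P"
  using SubD(6)[OF Sub_R] .

lemma P_smult: "\<lbrakk>c \<in> carrier C; x \<in> P\<rbrakk> \<Longrightarrow> c \<cdot> x \<in> P"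
  using P_act Z_closed by blast

lemma pr_smult_left: "\<lbrakk>c \<in> carrier C; x \<in> P; y \<in> P\<rbrakk> \<Longrightarrow> pr (c \<cdot> x) y = c \<cdot> pr x y"
  using C_act_commute[of c "r y" x] P_smult R_carrier by (simp add: r_act)

lemma pr_smult_right: "\<lbrakk>c \<in> carrier C; x \<in> P; y \<in> P\<rbrakk> \<Longrightarrow> pr x (c \<cdot> y) = c \<cdot> pr x y"
  using C_act_commute[of c "l x" y] P_smult R_carrier by (simp add: l_act)

lemma C_eqI:
  assumes "c \<in> carrier C" "d \<in> carrier C" "\<And>x. x \<in> P \<Longrightarrow> c \<cdot> x = d \<cdot> x" shows "c = d"
proof -
  have "c \<oplus>\<^bsub>C\<^esub> \<ominus>\<^bsub>C\<^esub> d = \<zero>\<^sub>C"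
    by (rule faithful) (use assms R_carrier in \<open>simp_all add: C_act_add C_act_neg M.r_neg\<close>)
  then show ?thesis using assms C.minus_equality[of c "\<ominus>\<^bsub>C\<^esub> d"] by simp
qed

text \<open>\<open>Hom_C\<close> covers values in \<open>P\<close> only. The elements of
  \<open>P\<close> whose value lies in \<open>P\<close> form an essential submodule, on which
  \<open>f\<close> is multiplication by some \<open>c\<close>, and homomorphisms that agree on an
  essential submodule agree on \<open>P\<close>.\<close>

lemma Hom_P:
  assumes f: "f \<in> Hom P" shows "\<exists>c\<in>carrier C. \<forall>x\<in>P. f x = c \<cdot> x"
proof -
  let ?N = "{x \<in> P. f x \<in> P}"
  have N: "essential ?N" using essential_preimage[OF f essential_R] .
  then have "Sub ?N" by (simp add: essential_def)
  obtain c where c: "c \<in> carrier C" "\<And>x. x \<in> ?N \<Longrightarrow> f x = c \<cdot> x"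
    using Hom_C[OF \<open>Sub ?N\<close> _ Hom_restrict[OF f]] by blast
  have "f x = c \<cdot> x" if "x \<in> P" for x
    using Hom_eqI[OF f _ N c(2) that] Hom_restrict[OF C_Hom[OF c(1)]] R_carrier by blast
  then show ?thesis using c(1) by blast
qed

section \<open>Idempotents and supports\<close>

abbreviation idem :: "'b set" where "idem \<equiv> idempotents C"

lemma idemI: "\<lbrakk>e \<in> carrier C; e \<otimes>\<^sub>C e = e\<rbrakk> \<Longrightarrow> e \<in> idem"
  by (simp add: idempotents_def)

lemma idemD [simp]: "e \<in> idem \<Longrightarrow> e \<in> carrier C" "e \<in> idem \<Longrightarrow> e \<otimes>\<^sub>C e = e"
  by (auto simp: idempotents_def)

lemma idem_mult [simp]: "\<lbrakk>e \<in> idem; f \<in> idem\<rbrakk> \<Longrightarrow> e \<otimes>\<^sub>C f \<in> idem"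
proof -
  assume *: "e \<in> idem" "f \<in> idem"
  have "(e \<otimes>\<^sub>C f) \<otimes>\<^sub>C (e \<otimes>\<^sub>C f) = (e \<otimes>\<^sub>C e) \<otimes>\<^sub>C (f \<otimes>\<^sub>C f)"
    using *[THEN idemD(1)] by (simp only: C.m_ac C.m_closed)
  then have "e \<otimes>\<^sub>C f = (e \<otimes>\<^sub>C f) \<otimes>\<^sub>C (e \<otimes>\<^sub>C f)" using * by (simp only: idemD)
  moreover have "e \<otimes>\<^sub>C f \<in> carrier C" using * by simp
  ultimately show ?thesis unfolding idempotents_def by blast
qed

lemma idem_one [simp]: "\<one>\<^bsub>C\<^esub> \<in> idem" and idem_zero [simp]: "\<zero>\<^sub>C \<in> idem"
  by (simp_all add: idemI)

text \<open>On \<open>P\<close> the projection \<open>g\<close> onto \<open>N\<close> is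
  multiplication by some \<open>e\<close>. It is idempotent because \<open>g - id\<close> kills
  \<open>N\<close> and hence every \<open>g x\<close>. The last clause holds because a
  \<open>c\<close> that kills \<open>N\<close> kills \<open>g x = e \<cdot> x\<close>.\<close>

lemma support_ideal:
  assumes N: "Sub N" "N \<subseteq> P"
  shows "\<exists>e\<in>idem. (\<forall>n\<in>N. e \<cdot> n = n) \<and> (\<forall>c\<in>carrier C. (\<forall>n\<in>N. c \<cdot> n = \<zero>\<^sub>E) \<longrightarrow> c \<otimes>\<^sub>C e = \<zero>\<^sub>C)"
proof -
  obtain g where g: "g \<in> Hom (carrier E)" "\<And>n. n \<in> N \<Longrightarrow> g n = n"
    and ann: "\<And>f x. \<lbrakk>f \<in> Hom (carrier E); \<And>n. n \<in> N \<Longrightarrow> f n = \<zero>\<^sub>E; x \<in> P\<rbrakk> \<Longrightarrow> f (g x) = \<zero>\<^sub>E"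
    using projection[OF N(1)] by metis
  have gP: "g \<in> Hom P" using Hom_restrict[OF g(1)] R_carrier by blast
  obtain e where e: "e \<in> carrier C" "\<And>x. x \<in> P \<Longrightarrow> g x = e \<cdot> x" using Hom_P[OF gP] by blast
  have "e \<otimes>\<^sub>C e = e"
  proof (rule C_eqI)
    fix x assume x: "x \<in> P"
    let ?f = "\<lambda>x. g x \<oplus>\<^sub>E \<ominus>\<^sub>E x"
    have "?f (g x) = \<zero>\<^sub>E"
      by (rule ann[OF Hom_diff[OF g(1) Hom_id[OF Sub_carrier] Sub_carrier] _ x])
        (use g(2) SubD(1)[OF N(1)] in \<open>simp add: M.r_neg\<close>)
    then have "g (g x) = g x" using diff_eq_zero HomD(1)[OF g(1)] R_carrier[OF x] by blast
    then show "(e \<otimes>\<^sub>C e) \<cdot> x = e \<cdot> x"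
      using e x P_smult[OF e(1) x] R_carrier by (simp add: C_act_mult)
  qed (use e in auto)
  then have "e \<in> idem" using e idemI by blast
  moreover have "\<forall>n\<in>N. e \<cdot> n = n"
  proof
    fix n assume "n \<in> N"
    then show "e \<cdot> n = n" using e(2)[of n] g(2) N(2) by auto
  qed
  moreover have "c \<otimes>\<^sub>C e = \<zero>\<^sub>C" if c: "c \<in> carrier C" "\<forall>n\<in>N. c \<cdot> n = \<zero>\<^sub>E" for c
  proof (rule faithful)
    fix x assume x: "x \<in> P"
    then have "c \<cdot> g x = \<zero>\<^sub>E" using ann[OF C_Hom[OF c(1)] _ x] c(2) by blast
    then show "(c \<otimes>\<^sub>C e) \<cdot> x = \<zero>\<^sub>E" using c(1) e x R_carrier by (simp add: C_act_mult)
  qed (use c e in auto)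
  ultimately show ?thesis by blast
qed

text \<open>\<open>e\<close> is the support of the ideal formed by those multiples of
  \<open>u\<close> that lie in \<open>P\<close>. If \<open>v = u - e u\<close> were nonzero, some
  nonzero \<open>n = a \<cdot> v\<close> would lie in \<open>P\<close>; it is a multiple of
  \<open>u\<close> too, so \<open>n = e n = a \<cdot> (e v) = 0\<close>.\<close>

lemma support:
  assumes u: "u \<in> carrier E"
  shows "\<exists>e\<in>idem. e \<cdot> u = u \<and> (\<forall>c\<in>carrier C. c \<cdot> u = \<zero>\<^sub>E \<longrightarrow> c \<otimes>\<^sub>C e = \<zero>\<^sub>C)"
proof -
  let ?U = "(\<lambda>a. a \<cdot> u) ` carrier A"
  obtain e where e: "e \<in> idem" "\<And>n. n \<in> ?U \<inter> P \<Longrightarrow> e \<cdot> n = n"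
    and ann: "\<And>c. \<lbrakk>c \<in> carrier C; \<And>n. n \<in> ?U \<inter> P \<Longrightarrow> c \<cdot> n = \<zero>\<^sub>E\<rbrakk> \<Longrightarrow> c \<otimes>\<^sub>C e = \<zero>\<^sub>C"
    using support_ideal[OF Sub_Int[OF Sub_cyclic[OF u] Sub_R]] by (metis Int_lower2)
  have eC: "e \<in> carrier C" and ee: "e \<otimes>\<^sub>C e = e" using e by auto
  have "c \<otimes>\<^sub>C e = \<zero>\<^sub>C" if c: "c \<in> carrier C" "c \<cdot> u = \<zero>\<^sub>E" for c
  proof (rule ann[OF c(1)])
    fix n assume "n \<in> ?U \<inter> P"
    then obtain a where "a \<in> carrier A" "n = a \<cdot> u" by auto
    then show "c \<cdot> n = \<zero>\<^sub>E" using C_act_commute[OF c(1)] c u by simp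
  qed
  moreover have "e \<cdot> u = u"
  proof (rule ccontr)
    assume ne: "e \<cdot> u \<noteq> u"
    let ?v = "u \<oplus>\<^sub>E \<ominus>\<^sub>E (e \<cdot> u)"
    have v: "?v \<in> carrier E" using u eC by simp
    have ev: "e \<cdot> ?v = \<zero>\<^sub>E"
      using u eC C_act_mult[OF eC eC u] by (simp add: C_act_add_right C_act_neg_right ee M.r_neg)
    let ?V = "(\<lambda>a. a \<cdot> ?v) ` carrier A"
    have "?v \<noteq> \<zero>\<^sub>E" using diff_eq_zero[OF u C_act_closed[OF eC u]] ne by metis
    then have "?V \<noteq> {\<zero>\<^sub>E}" using mem_cyclic[OF v] by blast
    then have "?V \<inter> P \<noteq> {\<zero>\<^sub>E}" using meets_R[OF Sub_cyclic[OF v]] by blast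
    moreover have "\<zero>\<^sub>E \<in> ?V \<inter> P" using SubD(3)[OF Sub_Int[OF Sub_cyclic[OF v] Sub_R]] .
    ultimately obtain n where n: "n \<in> ?V \<inter> P" "n \<noteq> \<zero>\<^sub>E" by blast
    then obtain a where a: "a \<in> carrier A" "n = a \<cdot> ?v" by auto
    have U: "Sub ?U" using Sub_cyclic[OF u] .
    have "e \<cdot> u \<in> ?U" using Z_closed[OF eC] by blast
    then have "?v \<in> ?U" using SubD(4)[OF U mem_cyclic[OF u] SubD(5)[OF U]] by blast
    then have "n \<in> ?U \<inter> P" using SubD(6)[OF U a(1)] a n by auto
    then have "n = e \<cdot> n" using e(2) by simp
    also have "\<dots> = \<zero>\<^sub>E" using C_act_commute[OF eC a(1) v] ev a by simp
    finally show False using n by simp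
  qed
  ultimately show ?thesis using e by blast
qed

section \<open>Dense sets of idempotents\<close>

definition dense :: "'b set \<Rightarrow> bool" where
  "dense B \<longleftrightarrow> B \<subseteq> idem \<and> (\<forall>\<beta>\<in>idem. (\<forall>\<alpha>\<in>B. \<beta> \<otimes>\<^sub>C \<alpha> = \<zero>\<^sub>C) \<longrightarrow> \<beta> = \<zero>\<^sub>C)"

lemma dense_idempotents_iff: "dense_idempotents C B \<longleftrightarrow> dense B"
proof -
  have "{\<beta> \<in> idem. \<forall>\<alpha>\<in>B. \<beta> \<otimes>\<^sub>C \<alpha> = \<zero>\<^sub>C} = {\<zero>\<^sub>C} \<longleftrightarrow> (\<forall>\<beta>\<in>idem. (\<forall>\<alpha>\<in>B. \<beta> \<otimes>\<^sub>C \<alpha> = \<zero>\<^sub>C) \<longrightarrow> \<beta> = \<zero>\<^sub>C)"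
    if "B \<subseteq> idem"
  proof -
    have "\<zero>\<^sub>C \<in> {\<beta> \<in> idem. \<forall>\<alpha>\<in>B. \<beta> \<otimes>\<^sub>C \<alpha> = \<zero>\<^sub>C}" using that by auto
    then show ?thesis by blast
  qed
  then show ?thesis by (auto simp: dense_idempotents_def dense_def)
qed

lemma dense_orthogonal_iff:
  "dense_orthogonal C I \<xi> \<longleftrightarrow> dense (\<xi> ` I) \<and> (\<forall>a\<in>I. \<forall>b\<in>I. a \<noteq> b \<longrightarrow> \<xi> a \<otimes>\<^sub>C \<xi> b = \<zero>\<^sub>C)"
  by (simp add: dense_orthogonal_def dense_idempotents_iff)

lemma dense_orthogonal_idem: "dense_orthogonal C I \<xi> \<Longrightarrow> a \<in> I \<Longrightarrow> \<xi> a \<in> idem"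
  by (auto simp: dense_orthogonal_iff dense_def)

lemma dense_mono: "dense B \<Longrightarrow> B \<subseteq> B' \<Longrightarrow> B' \<subseteq> idem \<Longrightarrow> dense B'"
  unfolding dense_def by blast

lemma dense_idem: "dense idem"
  unfolding dense_def by (auto dest: bspec[of _ _ "\<one>\<^bsub>C\<^esub>"])

text \<open>If \<open>\<beta>\<close> kills all products, then each
  \<open>\<beta> \<epsilon>\<close> is an idempotent that kills \<open>B'\<close>, hence zero; so
  \<open>\<beta>\<close> kills \<open>B\<close>.\<close>

lemma dense_products:
  assumes "dense B" "dense B'" shows "dense {\<epsilon> \<otimes>\<^sub>C \<epsilon>' | \<epsilon> \<epsilon>'. \<epsilon> \<in> B \<and> \<epsilon>' \<in> B'}"
  unfolding dense_def
proof (intro conjI ballI impI)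
  have sub: "B \<subseteq> idem" "B' \<subseteq> idem" using assms by (auto simp: dense_def)
  then show "{\<epsilon> \<otimes>\<^sub>C \<epsilon>' | \<epsilon> \<epsilon>'. \<epsilon> \<in> B \<and> \<epsilon>' \<in> B'} \<subseteq> idem" using idem_mult by blast
  fix \<beta> assume \<beta>: "\<beta> \<in> idem" "\<forall>\<alpha>\<in>{\<epsilon> \<otimes>\<^sub>C \<epsilon>' | \<epsilon> \<epsilon>'. \<epsilon> \<in> B \<and> \<epsilon>' \<in> B'}. \<beta> \<otimes>\<^sub>C \<alpha> = \<zero>\<^sub>C"
  have "\<beta> \<otimes>\<^sub>C \<epsilon> = \<zero>\<^sub>C" if "\<epsilon> \<in> B" for \<epsilon>
  proof -
    have "(\<beta> \<otimes>\<^sub>C \<epsilon>) \<otimes>\<^sub>C \<epsilon>' = \<zero>\<^sub>C" if "\<epsilon>' \<in> B'" for \<epsilon>'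
    proof -
      have "\<beta> \<in> carrier C" "\<epsilon> \<in> carrier C" "\<epsilon>' \<in> carrier C" using \<beta> sub \<open>\<epsilon> \<in> B\<close> that idemD(1) by blast+
      then show ?thesis using \<beta>(2) \<open>\<epsilon> \<in> B\<close> that C.m_assoc by auto
    qed
    moreover have "\<beta> \<otimes>\<^sub>C \<epsilon> \<in> idem" using \<beta> that sub idem_mult by blast
    ultimately show ?thesis using assms(2) by (simp add: dense_def)
  qed
  then show "\<beta> = \<zero>\<^sub>C" using assms(1) \<beta>(1) by (simp add: dense_def)
qed

text \<open>The support of \<open>u - v\<close> is orthogonal to \<open>B\<close>, because every
  element of \<open>B\<close> kills \<open>u - v\<close>; density leaves only zero. Uniqueness of
  orthogonal sums is the case where \<open>B\<close> consists of the values of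
  \<open>\<xi>\<close>.\<close>

lemma dense_eqI:
  assumes B: "dense B" and uv: "u \<in> carrier E" "v \<in> carrier E" "\<And>\<epsilon>. \<epsilon> \<in> B \<Longrightarrow> \<epsilon> \<cdot> u = \<epsilon> \<cdot> v"
  shows "u = v"
proof -
  let ?w = "u \<oplus>\<^sub>E \<ominus>\<^sub>E v"
  have w: "?w \<in> carrier E" using uv by simp
  obtain e where e: "e \<in> idem" "e \<cdot> ?w = ?w" "\<And>c. \<lbrakk>c \<in> carrier C; c \<cdot> ?w = \<zero>\<^sub>E\<rbrakk> \<Longrightarrow> c \<otimes>\<^sub>C e = \<zero>\<^sub>C"
    using support[OF w] by blast
  have "e \<otimes>\<^sub>C \<epsilon> = \<zero>\<^sub>C" if "\<epsilon> \<in> B" for \<epsilon>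
  proof -
    have \<epsilon>: "\<epsilon> \<in> carrier C" using that B by (auto simp: dense_def)
    then have "\<epsilon> \<cdot> ?w = \<zero>\<^sub>E" using uv that by (simp add: C_act_add_right C_act_neg_right M.r_neg)
    then show ?thesis using e(3)[OF \<epsilon>] C.m_comm[of e \<epsilon>] e(1) \<epsilon> by simp
  qed
  then have "e = \<zero>\<^sub>C" using B e(1) by (simp add: dense_def)
  then have "?w = \<zero>\<^sub>E" using e(2) w by simp
  then show ?thesis using diff_eq_zero uv by blast
qed

text \<open>Baer's argument: the right ideal of all \<open>s\<close> for which the family \<open>(x\<^sub>a s)\<close> can be glued contains
  every \<open>\<xi>\<^sub>a\<close>. An extension to \<open>A\<close> of the resulting homomorphism maps \<open>1\<close> to an orthogonal sum.\<close>

lemma orth_sum_exists: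
  assumes \<xi>: "dense_orthogonal C I \<xi>" and x: "x \<in> I \<rightarrow> carrier E"
  shows "\<exists>u\<in>carrier E. \<forall>a\<in>I. \<xi> a \<cdot> u = \<xi> a \<cdot> x a"
proof -
  define AA :: "('b, 'b) module" where "AA =
    \<lparr>carrier = carrier A, mult = undefined, one = undefined, zero = \<zero>, add = add A, smult = (\<lambda>b a. a \<otimes> b)\<rparr>"
  have AAab: "abelian_group AA"
  proof (rule abelian_groupI)
    fix a assume "a \<in> carrier AA"
    then show "\<exists>b\<in>carrier AA. b \<oplus>\<^bsub>AA\<^esub> a = \<zero>\<^bsub>AA\<^esub>"
      by (intro bexI[of _ "\<ominus> a"]) (auto simp: AA_def A.l_neg)
  qed (auto simp: AA_def A.a_ac)
  interpret AA: abelian_group AA by fact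
  interpret AA: right_mod A AA
    by unfold_locales (auto simp: AA_def A.l_distr A.r_distr A.m_assoc)
  have \<xi>C: "\<xi> a \<in> carrier C" "\<xi> a \<in> carrier A" if "a \<in> I" for a
    using dense_orthogonal_idem[OF \<xi> that] Z_closed by auto
  have xE: "x a \<in> carrier E" if "a \<in> I" for a using x that by auto
  have uniq: "u = v" if "u \<in> carrier E" "v \<in> carrier E" "\<And>a. a \<in> I \<Longrightarrow> \<xi> a \<cdot> u = \<xi> a \<cdot> v" for u v
    using dense_eqI[of "\<xi> ` I"] \<xi> that by (auto simp: dense_orthogonal_iff)
  define glue where "glue = (\<lambda>s v. v \<in> carrier E \<and> (\<forall>a\<in>I. \<xi> a \<cdot> v = s \<cdot> (\<xi> a \<cdot> x a)))"
  define J where "J = {s \<in> carrier A. \<exists>v. glue s v}"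
  define h where "h = (\<lambda>s. THE v. glue s v)"
  have h: "h s = v" if "glue s v" for s v
    unfolding h_def
  proof (rule the_equality)
    fix w assume w: "glue s w"
    show "w = v" by (rule uniq) (use w that in \<open>simp_all add: glue_def\<close>)
  qed (fact that)
  have hJ: "glue s (h s)" if "s \<in> J" for s using that h by (auto simp: J_def)
  have glue_add: "glue (s \<oplus> t) (v \<oplus>\<^sub>E w)" if "glue s v" "glue t w" "s \<in> carrier A" "t \<in> carrier A" for s t v w
    using that \<xi>C xE by (auto simp: glue_def C_act_add_right act_add_left)
  have glue_act: "glue (s \<otimes> b) (b \<cdot> v)" if "glue s v" "s \<in> carrier A" "b \<in> carrier A" for s b v
    using that \<xi>C xE by (auto simp: glue_def C_act_commute act_assoc)
  have glue_zero: "glue \<zero> \<zero>\<^sub>E" using \<xi>C xE by (auto simp: glue_def)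
  have JI: "s \<in> J" if "glue s v" "s \<in> carrier A" for s v using that unfolding J_def by blast
  have JA: "s \<in> carrier A" if "s \<in> J" for s using that by (simp add: J_def)
  have J: "submodule J A AA"
  proof (rule AA.SubI)
    show "\<zero>\<^bsub>AA\<^esub> \<in> J" using JI[OF glue_zero] by (simp add: AA_def)
    show "s \<oplus>\<^bsub>AA\<^esub> t \<in> J" if "s \<in> J" "t \<in> J" for s t
      using JI[OF glue_add[OF hJ hJ JA JA]] JA that by (simp add: AA_def)
    show "b \<odot>\<^bsub>AA\<^esub> s \<in> J" if "b \<in> carrier A" "s \<in> J" for b s
      using JI[OF glue_act[OF hJ JA]] JA that by (simp add: AA_def)
  qed (auto simp: J_def AA_def)
  have "h \<in> mod_hom A (AA\<lparr>carrier := J\<rparr>) E"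
  proof -
    have "h s \<in> carrier E" if "s \<in> J" for s using hJ[OF that] by (simp add: glue_def)
    moreover have "h (s \<oplus> t) = h s \<oplus>\<^sub>E h t" if "s \<in> J" "t \<in> J" for s t
      using h[OF glue_add] hJ JA that by blast
    moreover have "h (s \<otimes> b) = b \<cdot> h s" if "s \<in> J" "b \<in> carrier A" for s b
      using h[OF glue_act] hJ JA that by blast
    ultimately show ?thesis by (auto simp: mod_hom_def AA_def)
  qed
  then obtain g where g: "g \<in> mod_hom A AA E" "\<forall>s\<in>J. g s = h s"
    using injective_module_extend[OF injective AA.right_module_axioms J] by blast
  have g1: "g \<one> \<in> carrier E" using g(1) by (auto simp: mod_hom_def AA_def)
  have "\<xi> b \<cdot> g \<one> = \<xi> b \<cdot> x b" if b: "b \<in> I" for b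
  proof -
    have "glue (\<xi> b) (\<xi> b \<cdot> x b)"
      unfolding glue_def
    proof (intro conjI ballI)
      fix a assume a: "a \<in> I"
      show "\<xi> a \<cdot> (\<xi> b \<cdot> x b) = \<xi> b \<cdot> (\<xi> a \<cdot> x a)"
      proof (cases "a = b")
        case False
        then have "\<xi> a \<otimes>\<^sub>C \<xi> b = \<zero>\<^sub>C" "\<xi> b \<otimes>\<^sub>C \<xi> a = \<zero>\<^sub>C" using \<xi> a b by (auto simp: dense_orthogonal_iff)
        then show ?thesis
          using C_act_mult[OF \<xi>C(1)[OF a] \<xi>C(1)[OF b] xE[OF b]] C_act_mult[OF \<xi>C(1)[OF b] \<xi>C(1)[OF a] xE[OF a]] xE a b
          by simp
      qed simp
    qed (use \<xi>C xE b in auto)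
    then have "\<xi> b \<in> J" "h (\<xi> b) = \<xi> b \<cdot> x b" using h \<xi>C b by (auto simp: J_def)
    moreover have "g (\<xi> b) = \<xi> b \<cdot> g \<one>"
    proof -
      have "\<forall>a\<in>carrier A. \<forall>s\<in>carrier A. g (s \<otimes> a) = a \<cdot> g s" using g(1) by (simp add: mod_hom_def AA_def)
      from this[rule_format, of "\<xi> b" \<one>] show ?thesis using \<xi>C[OF b] by simp
    qed
    ultimately show ?thesis using g(2) by simp
  qed
  then show ?thesis using g1 by blast
qed

lemma orth_sum_eqI:
  assumes "dense_orthogonal C I \<xi>" "u \<in> carrier E" "\<And>a. a \<in> I \<Longrightarrow> \<xi> a \<cdot> u = \<xi> a \<cdot> x a"
  shows "orth_sum E I \<xi> x = u"
  unfolding orth_sum_def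
proof (rule the_equality)
  fix v assume v: "v \<in> carrier E \<and> (\<forall>a\<in>I. \<xi> a \<cdot> v = \<xi> a \<cdot> x a)"
  have "dense (\<xi> ` I)" using assms(1) by (simp add: dense_orthogonal_iff)
  then show "v = u" by (rule dense_eqI) (use v assms in auto)
qed (use assms in auto)

lemma orth_sum:
  assumes "dense_orthogonal C I \<xi>" "x \<in> I \<rightarrow> carrier E"
  shows "orth_sum E I \<xi> x \<in> carrier E" "a \<in> I \<Longrightarrow> \<xi> a \<cdot> orth_sum E I \<xi> x = \<xi> a \<cdot> x a"
  using orth_sum_exists[OF assms] orth_sum_eqI[OF assms(1)] by metis+

end

section \<open>Orthogonal completions\<close>

lemma orth_sum_cong: "(\<And>a. a \<in> I \<Longrightarrow> x a = y a) \<Longrightarrow> orth_sum E I \<xi> x = orth_sum E I \<xi> y"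
  by (simp add: orth_sum_def)

context closed_hull
begin

text \<open>Zorn's lemma yields a maximal orthogonal subset \<open>T\<close> of \<open>B\<close>. An
  idempotent \<open>\<beta>\<close> orthogonal to \<open>T\<close>, but not to some
  \<open>\<epsilon>\<close> in \<open>B\<close>, would give a nonzero
  \<open>\<beta> \<epsilon>\<close> in \<open>B\<close> that is orthogonal to \<open>T\<close>; by
  maximality it lies in \<open>T\<close> and so squares to zero.\<close>

lemma dense_orth_refine:
  assumes B: "dense B" and down: "\<And>\<beta> \<epsilon>. \<lbrakk>\<beta> \<in> idem; \<epsilon> \<in> B\<rbrakk> \<Longrightarrow> \<beta> \<otimes>\<^sub>C \<epsilon> \<in> B"
  shows "\<exists>T\<subseteq>B. dense_orthogonal C T (\<lambda>t. t)"
proof -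
  have BI: "\<epsilon> \<in> idem" "\<epsilon> \<in> carrier C" if "\<epsilon> \<in> B" for \<epsilon> using that B by (auto simp: dense_def)
  define X where "X = {T. T \<subseteq> B \<and> (\<forall>s\<in>T. \<forall>t\<in>T. s \<noteq> t \<longrightarrow> s \<otimes>\<^sub>C t = \<zero>\<^sub>C)}"
  have "\<exists>T\<in>X. \<forall>U\<in>X. T \<subseteq> U \<longrightarrow> U = T"
  proof (rule subset_Zorn_nonempty)
    show "X \<noteq> {}" by (auto simp: X_def)
    fix \<C> assume ne: "\<C> \<noteq> {}" and ch: "subset.chain X \<C>"
    have sub: "\<C> \<subseteq> X" and tot: "\<And>G H. G \<in> \<C> \<Longrightarrow> H \<in> \<C> \<Longrightarrow> G \<subseteq> H \<or> H \<subseteq> G"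
      using ch by (auto simp: subset_chain_def)
    have "s \<otimes>\<^sub>C t = \<zero>\<^sub>C" if st: "s \<in> \<Union>\<C>" "t \<in> \<Union>\<C>" "s \<noteq> t" for s t
    proof -
      obtain G where "G \<in> \<C>" "s \<in> G" "t \<in> G" using st tot by blast
      then show ?thesis using sub st(3) unfolding X_def by blast
    qed
    then show "\<Union>\<C> \<in> X" using sub unfolding X_def by blast
  qed
  then obtain T where T: "T \<in> X" and max: "\<And>U. U \<in> X \<Longrightarrow> T \<subseteq> U \<Longrightarrow> U = T" by blast
  have TB: "T \<subseteq> B" and orth: "\<And>s t. \<lbrakk>s \<in> T; t \<in> T; s \<noteq> t\<rbrakk> \<Longrightarrow> s \<otimes>\<^sub>C t = \<zero>\<^sub>C"
    using T unfolding X_def by blast+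
  have "\<beta> = \<zero>\<^sub>C" if \<beta>: "\<beta> \<in> idem" "\<And>t. t \<in> T \<Longrightarrow> \<beta> \<otimes>\<^sub>C t = \<zero>\<^sub>C" for \<beta>
  proof (rule ccontr)
    assume "\<beta> \<noteq> \<zero>\<^sub>C"
    then obtain \<epsilon> where \<epsilon>: "\<epsilon> \<in> B" "\<beta> \<otimes>\<^sub>C \<epsilon> \<noteq> \<zero>\<^sub>C" using B \<beta>(1) by (auto simp: dense_def)
    let ?\<eta> = "\<beta> \<otimes>\<^sub>C \<epsilon>"
    have \<eta>B: "?\<eta> \<in> B" using down \<beta>(1) \<epsilon>(1) .
    have c: "\<beta> \<in> carrier C" "\<epsilon> \<in> carrier C" using \<beta> BI \<epsilon> by auto
    have \<eta>T: "?\<eta> \<otimes>\<^sub>C t = \<zero>\<^sub>C" "t \<otimes>\<^sub>C ?\<eta> = \<zero>\<^sub>C" if "t \<in> T" for t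
    proof -
      have t: "t \<in> carrier C" using TB that BI by blast
      have "?\<eta> \<otimes>\<^sub>C t = \<epsilon> \<otimes>\<^sub>C (\<beta> \<otimes>\<^sub>C t)" using c t by (simp add: C.m_ac)
      then show "?\<eta> \<otimes>\<^sub>C t = \<zero>\<^sub>C" using \<beta>(2)[OF that] c by simp
      then show "t \<otimes>\<^sub>C ?\<eta> = \<zero>\<^sub>C" using c t C.m_comm[of t ?\<eta>] by simp
    qed
    have "insert ?\<eta> T \<in> X"
      unfolding X_def using TB \<eta>B \<eta>T orth by auto
    then have "?\<eta> \<in> T" using max[of "insert ?\<eta> T"] by blast
    then have "?\<eta> \<otimes>\<^sub>C ?\<eta> = \<zero>\<^sub>C" using \<eta>T by blast
    then show False using idemD(2)[OF BI(1)[OF \<eta>B]] \<epsilon>(2) by simp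
  qed
  then have "dense T" using TB BI unfolding dense_def by blast
  then have "dense_orthogonal C T (\<lambda>t. t)" using orth by (simp add: dense_orthogonal_iff)
  then show ?thesis using TB by blast
qed

text \<open>The idempotents on which \<open>u\<close> coincides with an element of \<open>S\<close>. Orthogonal sums of elements of \<open>S\<close>
  are recognised by the density of this set, which avoids the manipulation of index sets.\<close>

definition agree :: "'c set \<Rightarrow> 'c \<Rightarrow> 'b set" where
  "agree S u = {\<epsilon> \<in> idem. \<exists>s\<in>S. \<epsilon> \<cdot> u = \<epsilon> \<cdot> s}"

definition completion :: "'c set \<Rightarrow> 'c set" where
  "completion S = {u \<in> carrier E. dense (agree S u)}"

lemma agree_down:
  assumes "S \<subseteq> carrier E" "u \<in> carrier E" "\<beta> \<in> idem" "\<epsilon> \<in> agree S u" shows "\<beta> \<otimes>\<^sub>C \<epsilon> \<in> agree S u"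
proof -
  obtain s where s: "\<epsilon> \<in> idem" "s \<in> S" "\<epsilon> \<cdot> u = \<epsilon> \<cdot> s" using assms(4) by (auto simp: agree_def)
  then have "(\<beta> \<otimes>\<^sub>C \<epsilon>) \<cdot> u = (\<beta> \<otimes>\<^sub>C \<epsilon>) \<cdot> s"
    using assms by (simp add: C_act_mult subset_iff)
  then show ?thesis unfolding agree_def using s assms(3) idem_mult by blast
qed

lemma completion_carrier: "u \<in> completion S \<Longrightarrow> u \<in> carrier E"
  by (simp add: completion_def)

lemma completion_incl: assumes "S \<subseteq> carrier E" shows "S \<subseteq> completion S"
proof
  fix s assume s: "s \<in> S"
  then have "agree S s = idem" by (auto simp: agree_def)
  then show "s \<in> completion S" using s assms dense_idem by (auto simp: completion_def)
qed

lemma completion_mono: assumes "S \<subseteq> S'" shows "completion S \<subseteq> completion S'"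
proof
  fix u assume u: "u \<in> completion S"
  have "agree S u \<subseteq> agree S' u" using assms by (auto simp: agree_def)
  then show "u \<in> completion S'" using u dense_mono[of "agree S u"] by (auto simp: completion_def agree_def)
qed

text \<open>The elements of a dense orthogonal subset of \<open>agree S u\<close> serve as their own
  indices. Closure of \<open>agree S u\<close> under multiplication by idempotents provides such a
  subset, and uniqueness identifies the sum with \<open>u\<close>.\<close>

lemma completion_repr:
  assumes "S \<subseteq> carrier E" "u \<in> completion S"
  shows "\<exists>T x. dense_orthogonal C T (\<lambda>t. t) \<and> x \<in> T \<rightarrow> S \<and> u = orth_sum E T (\<lambda>t. t) x"
proof -
  have u: "u \<in> carrier E" "dense (agree S u)" using assms by (auto simp: completion_def)
  obtain T where T: "T \<subseteq> agree S u" "dense_orthogonal C T (\<lambda>t. t)"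
    using dense_orth_refine[OF u(2) agree_down[OF assms(1) u(1)]] by blast
  then have "\<forall>t\<in>T. \<exists>s. s \<in> S \<and> t \<cdot> u = t \<cdot> s" by (auto simp: agree_def)
  then obtain x where x: "\<forall>t\<in>T. x t \<in> S \<and> t \<cdot> u = t \<cdot> x t" by metis
  then have "u = orth_sum E T (\<lambda>t. t) x" using orth_sum_eqI[OF T(2) u(1)] by simp
  then show ?thesis using T(2) x by blast
qed

text \<open>Orthogonal sums are nested without double indexing: if \<open>\<epsilon>\<close> belongs
  to \<open>agree S (x a)\<close>, then \<open>\<xi> a \<epsilon>\<close> belongs to
  \<open>agree S u\<close>. By density of \<open>agree S (x a)\<close>, an idempotent orthogonal to
  \<open>agree S u\<close> is orthogonal to each \<open>\<xi> a\<close>, hence zero.\<close>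

lemma completion_glue:
  assumes S: "S \<subseteq> carrier E" and \<xi>: "dense_orthogonal C I \<xi>" and u: "u \<in> carrier E"
    and x: "\<And>a. a \<in> I \<Longrightarrow> x a \<in> completion S" "\<And>a. a \<in> I \<Longrightarrow> \<xi> a \<cdot> u = \<xi> a \<cdot> x a"
  shows "u \<in> completion S"
proof -
  have "dense (agree S u)"
    unfolding dense_def
  proof (intro conjI ballI impI)
    show "agree S u \<subseteq> idem" by (auto simp: agree_def)
    fix \<beta> assume \<beta>: "\<beta> \<in> idem" "\<forall>\<alpha>\<in>agree S u. \<beta> \<otimes>\<^sub>C \<alpha> = \<zero>\<^sub>C"
    have "\<beta> \<otimes>\<^sub>C \<xi> a = \<zero>\<^sub>C" if a: "a \<in> I" for a
    proof -
      have \<xi>a: "\<xi> a \<in> idem" using dense_orthogonal_idem[OF \<xi> a] .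
      have xa: "x a \<in> carrier E" "dense (agree S (x a))" using x(1)[OF a] by (auto simp: completion_def)
      have "(\<beta> \<otimes>\<^sub>C \<xi> a) \<otimes>\<^sub>C \<epsilon> = \<zero>\<^sub>C" if "\<epsilon> \<in> agree S (x a)" for \<epsilon>
      proof -
        obtain s where s: "\<epsilon> \<in> idem" "s \<in> S" "\<epsilon> \<cdot> x a = \<epsilon> \<cdot> s" using \<open>\<epsilon> \<in> agree S (x a)\<close> by (auto simp: agree_def)
        note c = idemD(1)[OF \<xi>a] idemD(1)[OF s(1)] idemD(1)[OF \<beta>(1)]
        have sE: "s \<in> carrier E" using s S by blast
        have "(\<xi> a \<otimes>\<^sub>C \<epsilon>) \<cdot> u = (\<epsilon> \<otimes>\<^sub>C \<xi> a) \<cdot> u" using c by (simp add: C.m_comm)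
        also have "\<dots> = (\<epsilon> \<otimes>\<^sub>C \<xi> a) \<cdot> x a" using c u xa x(2)[OF a] by (simp add: C_act_mult)
        also have "\<dots> = (\<xi> a \<otimes>\<^sub>C \<epsilon>) \<cdot> x a" using c by (simp add: C.m_comm)
        also have "\<dots> = (\<xi> a \<otimes>\<^sub>C \<epsilon>) \<cdot> s" using c xa sE s(3) by (simp add: C_act_mult)
        finally have "\<xi> a \<otimes>\<^sub>C \<epsilon> \<in> agree S u" unfolding agree_def using s(2) idem_mult[OF \<xi>a s(1)] by blast
        then show ?thesis using \<beta>(2) c by (simp add: C.m_assoc)
      qed
      moreover have "\<beta> \<otimes>\<^sub>C \<xi> a \<in> idem" using \<beta>(1) \<xi>a by simp
      ultimately show ?thesis using xa(2) by (simp add: dense_def)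
    qed
    then show "\<beta> = \<zero>\<^sub>C" using \<xi> \<beta>(1) by (simp add: dense_orthogonal_iff dense_def)
  qed
  then show ?thesis using u by (simp add: completion_def)
qed

lemma orth_sum_completion:
  assumes "S \<subseteq> carrier E" "dense_orthogonal C I \<xi>" "x \<in> I \<rightarrow> S"
  shows "orth_sum E I \<xi> x \<in> completion S"
proof -
  have x: "x \<in> I \<rightarrow> carrier E" using assms by blast
  show ?thesis
    by (rule completion_glue[OF assms(1,2) orth_sum(1)[OF assms(2) x], of x])
      (use orth_sum(2)[OF assms(2) x] assms completion_incl[OF assms(1)] in auto)
qed

lemma orth_complete_completion: assumes "S \<subseteq> carrier E" shows "orth_complete C E (completion S)"
  unfolding orth_complete_def
proof (intro conjI allI impI)
  show "completion S \<subseteq> carrier E" using completion_carrier by blast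
  fix I :: "'b set" and \<xi> x assume *: "dense_orthogonal C I \<xi> \<and> x \<in> I \<rightarrow> completion S"
  then have "x \<in> I \<rightarrow> carrier E" using completion_carrier by blast
  then obtain u where u: "u \<in> carrier E" "\<forall>a\<in>I. \<xi> a \<cdot> u = \<xi> a \<cdot> x a" using orth_sum_exists * by blast
  have "u \<in> completion S" by (rule completion_glue[OF assms _ u(1), of I \<xi> x]) (use * u in auto)
  then show "\<exists>u\<in>completion S. \<forall>a\<in>I. \<xi> a \<cdot> u = \<xi> a \<cdot> x a" using u by blast
qed

lemma orth_completion_eq: assumes "S \<subseteq> carrier E" shows "orth_completion C E S = completion S"
proof
  show "orth_completion C E S \<subseteq> completion S"
    unfolding orth_completion_def using orth_complete_completion[OF assms] completion_incl[OF assms] by blast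
  show "completion S \<subseteq> orth_completion C E S"
    unfolding orth_completion_def
  proof (intro subsetI InterI)
    fix u T assume u: "u \<in> completion S" and "T \<in> {T. orth_complete C E T \<and> S \<subseteq> T}"
    then have T: "orth_complete C E T" "S \<subseteq> T" by auto
    \<comment> \<open>Indexing by idempotents yields an index set of the type over which
      \<open>orth_complete\<close> quantifies.\<close>
    obtain I x where I: "dense_orthogonal C I (\<lambda>t. t)" "x \<in> I \<rightarrow> S" "u = orth_sum E I (\<lambda>t. t) x"
      using completion_repr[OF assms u] by blast
    then have "x \<in> I \<rightarrow> T" using T(2) by blast
    then obtain v where v: "v \<in> T" "\<forall>t\<in>I. t \<cdot> v = t \<cdot> x t"
      using T(1) I(1) unfolding orth_complete_def by blast
    moreover have "v \<in> carrier E" using T(1) v(1) by (auto simp: orth_complete_def)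
    ultimately show "u \<in> T" using orth_sum_eqI[OF I(1), of v x] I(3) by simp
  qed
qed

lemma completion_idem: assumes "S \<subseteq> carrier E" shows "completion (completion S) = completion S"
proof -
  have "completion S \<subseteq> carrier E" using completion_carrier by blast
  then have "orth_completion C E (completion S) = completion (completion S)" "completion S \<subseteq> completion (completion S)"
    using orth_completion_eq completion_incl by blast+
  moreover have "orth_completion C E (completion S) \<subseteq> completion S"
    unfolding orth_completion_def using orth_complete_completion[OF assms] by blast
  ultimately show ?thesis by blast
qed

lemma completion_carrier_eq: "completion (carrier E) = carrier E"
  using completion_incl[of "carrier E"] completion_carrier by blast

lemma completion_eq_orth_sums:
  assumes "S \<subseteq> carrier E"
  shows "completion S = {orth_sum E I \<xi> x | (I :: 'b set) \<xi> x. dense_orthogonal C I \<xi> \<and> x \<in> I \<rightarrow> S}"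
proof
  show "completion S \<subseteq> {orth_sum E I \<xi> x | (I :: 'b set) \<xi> x. dense_orthogonal C I \<xi> \<and> x \<in> I \<rightarrow> S}"
    using completion_repr[OF assms] by blast
  show "{orth_sum E I \<xi> x | (I :: 'b set) \<xi> x. dense_orthogonal C I \<xi> \<and> x \<in> I \<rightarrow> S} \<subseteq> completion S"
    using orth_sum_completion[OF assms] by blast
qed

text \<open>Both sets are closed under multiplication by idempotents, so their intersection contains
  all products of their elements, and these are dense.\<close>

lemma dense_agree_Int:
  assumes "u \<in> completion S" "S \<subseteq> carrier E" and B: "dense B" "\<And>\<beta> \<epsilon>. \<lbrakk>\<beta> \<in> idem; \<epsilon> \<in> B\<rbrakk> \<Longrightarrow> \<beta> \<otimes>\<^sub>C \<epsilon> \<in> B"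
  shows "dense (agree S u \<inter> B)"
proof (rule dense_mono)
  have u: "u \<in> carrier E" "dense (agree S u)" using assms by (auto simp: completion_def)
  show "dense {\<epsilon> \<otimes>\<^sub>C \<epsilon>' | \<epsilon> \<epsilon>'. \<epsilon> \<in> agree S u \<and> \<epsilon>' \<in> B}" by (rule dense_products[OF u(2) B(1)])
  show "{\<epsilon> \<otimes>\<^sub>C \<epsilon>' | \<epsilon> \<epsilon>'. \<epsilon> \<in> agree S u \<and> \<epsilon>' \<in> B} \<subseteq> agree S u \<inter> B"
  proof
    fix \<eta> assume "\<eta> \<in> {\<epsilon> \<otimes>\<^sub>C \<epsilon>' | \<epsilon> \<epsilon>'. \<epsilon> \<in> agree S u \<and> \<epsilon>' \<in> B}"
    then obtain \<epsilon> \<epsilon>' where e: "\<eta> = \<epsilon> \<otimes>\<^sub>C \<epsilon>'" "\<epsilon> \<in> agree S u" "\<epsilon>' \<in> B" by blast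
    then have i: "\<epsilon> \<in> idem" "\<epsilon>' \<in> idem" using B(1) by (auto simp: agree_def dense_def)
    then show "\<eta> \<in> agree S u \<inter> B"
      using agree_down[OF assms(2) u(1) i(2) e(2)] B(2)[OF i(1) e(3)] e(1) C.m_comm[of \<epsilon> \<epsilon>'] by simp
  qed
qed (auto simp: agree_def)

lemma dense_agree2:
  assumes "u \<in> completion S" "v \<in> completion T" "S \<subseteq> carrier E" "T \<subseteq> carrier E"
  shows "dense (agree S u \<inter> agree T v)"
  by (rule dense_agree_Int) (use assms agree_down in \<open>auto simp: completion_def\<close>)

text \<open>Identities between elements of the completion need only be checked where all of them agree with
  elements of \<open>S\<close>.\<close>

lemma completion_eqI2:
  assumes u: "u \<in> completion S" "v \<in> completion T" and ST: "S \<subseteq> carrier E" "T \<subseteq> carrier E"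
    and ab: "a \<in> carrier E" "b \<in> carrier E"
    and eq: "\<And>\<epsilon> x y. \<lbrakk>\<epsilon> \<in> idem; x \<in> S; y \<in> T; \<epsilon> \<cdot> u = \<epsilon> \<cdot> x; \<epsilon> \<cdot> v = \<epsilon> \<cdot> y\<rbrakk> \<Longrightarrow> \<epsilon> \<cdot> a = \<epsilon> \<cdot> b"
  shows "a = b"
  by (rule dense_eqI[OF dense_agree2[OF u ST] ab]) (use eq in \<open>auto simp: agree_def\<close>)

lemma completion_eqI1:
  assumes u: "u \<in> completion S" and ST: "S \<subseteq> carrier E" and ab: "a \<in> carrier E" "b \<in> carrier E"
    and eq: "\<And>\<epsilon> x. \<lbrakk>\<epsilon> \<in> idem; x \<in> S; \<epsilon> \<cdot> u = \<epsilon> \<cdot> x\<rbrakk> \<Longrightarrow> \<epsilon> \<cdot> a = \<epsilon> \<cdot> b"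
  shows "a = b"
  by (rule completion_eqI2[OF u u ST ST ab]) (rule eq)

lemma completion_eqI3:
  assumes u: "u \<in> completion S" "v \<in> completion S" "w \<in> completion S" and S: "S \<subseteq> carrier E"
    and ab: "a \<in> carrier E" "b \<in> carrier E"
    and eq: "\<And>\<epsilon> x y z. \<lbrakk>\<epsilon> \<in> idem; x \<in> S; y \<in> S; z \<in> S; \<epsilon> \<cdot> u = \<epsilon> \<cdot> x; \<epsilon> \<cdot> v = \<epsilon> \<cdot> y; \<epsilon> \<cdot> w = \<epsilon> \<cdot> z\<rbrakk>
      \<Longrightarrow> \<epsilon> \<cdot> a = \<epsilon> \<cdot> b"
  shows "a = b"
proof (rule dense_eqI[OF _ ab])
  show "dense (agree S u \<inter> (agree S v \<inter> agree S w))"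
    by (rule dense_agree_Int[OF u(1) S dense_agree2[OF u(2,3) S S]]) (use agree_down[OF S] u completion_carrier in blast)
qed (use eq in \<open>auto simp: agree_def\<close>)

text \<open>Membership is local as well: it suffices to find elements of \<open>V\<close> wherever
  both arguments agree with elements of \<open>S\<close> and \<open>T\<close>. Closure under an
  operation thus passes to completions.\<close>

lemma completion_memI2:
  assumes u: "u \<in> completion S" "v \<in> completion T" and ST: "S \<subseteq> carrier E" "T \<subseteq> carrier E" and w: "w \<in> carrier E"
    and eq: "\<And>\<epsilon> x y. \<lbrakk>\<epsilon> \<in> idem; x \<in> S; y \<in> T; \<epsilon> \<cdot> u = \<epsilon> \<cdot> x; \<epsilon> \<cdot> v = \<epsilon> \<cdot> y\<rbrakk> \<Longrightarrow> \<exists>z\<in>V. \<epsilon> \<cdot> w = \<epsilon> \<cdot> z"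
  shows "w \<in> completion V"
proof -
  have "agree S u \<inter> agree T v \<subseteq> agree V w" using eq by (auto simp: agree_def)
  with dense_agree2[OF u ST] have "dense (agree V w)" by (rule dense_mono) (auto simp: agree_def)
  then show ?thesis using w by (simp add: completion_def)
qed

lemma completion_add:
  assumes S: "S \<subseteq> carrier E" "\<And>x y. \<lbrakk>x \<in> S; y \<in> S\<rbrakk> \<Longrightarrow> x \<oplus>\<^sub>E y \<in> S" and u: "u \<in> completion S" "v \<in> completion S"
  shows "u \<oplus>\<^sub>E v \<in> completion S"
proof (rule completion_memI2[OF u S(1) S(1)])
  fix \<epsilon> x y assume *: "\<epsilon> \<in> idem" "x \<in> S" "y \<in> S" "\<epsilon> \<cdot> u = \<epsilon> \<cdot> x" "\<epsilon> \<cdot> v = \<epsilon> \<cdot> y"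
  moreover have "u \<in> carrier E" "v \<in> carrier E" "x \<in> carrier E" "y \<in> carrier E" using * u completion_carrier S by auto
  ultimately have "\<epsilon> \<cdot> (u \<oplus>\<^sub>E v) = \<epsilon> \<cdot> (x \<oplus>\<^sub>E y)" by (simp add: C_act_add_right)
  then show "\<exists>z\<in>S. \<epsilon> \<cdot> (u \<oplus>\<^sub>E v) = \<epsilon> \<cdot> z" using S(2)[OF *(2,3)] by blast
qed (use u completion_carrier in auto)

lemma completion_act:
  assumes S: "S \<subseteq> carrier E" "\<And>x. x \<in> S \<Longrightarrow> a \<cdot> x \<in> S" and a: "a \<in> carrier A" and u: "u \<in> completion S"
  shows "a \<cdot> u \<in> completion S"
proof (rule completion_memI2[OF u u S(1) S(1)])
  fix \<epsilon> x y assume *: "\<epsilon> \<in> idem" "x \<in> S" "\<epsilon> \<cdot> u = \<epsilon> \<cdot> x"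
  moreover have "u \<in> carrier E" "x \<in> carrier E" using * u completion_carrier S by auto
  ultimately have "\<epsilon> \<cdot> (a \<cdot> u) = \<epsilon> \<cdot> (a \<cdot> x)" using a C_act_commute[of \<epsilon> a] by simp
  then show "\<exists>z\<in>S. \<epsilon> \<cdot> (a \<cdot> u) = \<epsilon> \<cdot> z" using S(2)[OF *(2)] by blast
qed (use u completion_carrier a in auto)

section \<open>The completion of \<open>P\<close> as a module\<close>

abbreviation OP :: "'c set" where "OP \<equiv> completion P"

lemma P_sub: "P \<subseteq> carrier E" using R_carrier by blast

lemma P_OP: "x \<in> P \<Longrightarrow> x \<in> OP" using completion_incl[OF P_sub] by blast

lemma Sub_OP: "Sub OP"
proof (rule SubI)
  show "OP \<subseteq> carrier E" using completion_carrier by blast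
  show "\<zero>\<^sub>E \<in> OP" using P_OP SubD(3)[OF Sub_R] by blast
  show "\<And>x y. x \<in> OP \<Longrightarrow> y \<in> OP \<Longrightarrow> x \<oplus>\<^sub>E y \<in> OP" using completion_add[OF P_sub] SubD(4)[OF Sub_R] by blast
  show "\<And>a x. a \<in> carrier A \<Longrightarrow> x \<in> OP \<Longrightarrow> a \<cdot> x \<in> OP" using completion_act[OF P_sub] P_act by blast
qed

lemma OP_smult: "\<lbrakk>c \<in> carrier C; u \<in> OP\<rbrakk> \<Longrightarrow> c \<cdot> u \<in> OP"
  using SubD(6)[OF Sub_OP] Z_closed by blast

text \<open>On \<open>P\<close> the map is multiplication by some \<open>c\<close>, and where
  \<open>\<epsilon> u = \<epsilon> x\<close> with \<open>x\<close> in \<open>P\<close>, linearity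
  gives \<open>\<epsilon> f(u) = f(\<epsilon> x) = \<epsilon> c u\<close>. Since the values of
  \<open>f\<close> are only assumed to lie in \<open>E\<close>, complete invariance of
  \<open>OP\<close> is a consequence.\<close>

lemma Hom_OP:
  assumes f: "f \<in> Hom OP" shows "\<exists>c\<in>carrier C. \<forall>u\<in>OP. f u = c \<cdot> u"
proof -
  have "f \<in> Hom P" using Hom_restrict[OF f] P_OP by blast
  then obtain c where c: "c \<in> carrier C" "\<And>x. x \<in> P \<Longrightarrow> f x = c \<cdot> x" using Hom_P by blast
  have "f u = c \<cdot> u" if u: "u \<in> OP" for u
  proof (rule completion_eqI1[OF u P_sub])
    fix \<epsilon> x assume *: "\<epsilon> \<in> idem" "x \<in> P" "\<epsilon> \<cdot> u = \<epsilon> \<cdot> x"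
    note \<epsilon> = idemD(1)[OF *(1)]
    have "\<epsilon> \<cdot> f u = f (\<epsilon> \<cdot> x)" using HomD(3)[OF f Z_closed[OF \<epsilon>] u] *(3) by simp
    also have "\<dots> = c \<cdot> (\<epsilon> \<cdot> x)" using c(2) P_smult[OF \<epsilon> *(2)] by simp
    also have "\<dots> = \<epsilon> \<cdot> (c \<cdot> u)"
      using C_act_commute[OF c(1) Z_closed[OF \<epsilon>]] R_carrier[OF *(2)] completion_carrier[OF u] *(3) by metis
    finally show "\<epsilon> \<cdot> f u = \<epsilon> \<cdot> (c \<cdot> u)" .
  qed (use u completion_carrier c HomD(1)[OF f] in auto)
  then show ?thesis using c(1) by blast
qed

section \<open>The product of the completion\<close>

definition prodrel :: "'c \<Rightarrow> 'c \<Rightarrow> 'c \<Rightarrow> bool" where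
  "prodrel u v w \<longleftrightarrow> w \<in> carrier E \<and> (\<forall>\<epsilon>\<in>idem. \<forall>x\<in>P. \<forall>y\<in>P. \<epsilon> \<cdot> u = \<epsilon> \<cdot> x \<longrightarrow> \<epsilon> \<cdot> v = \<epsilon> \<cdot> y \<longrightarrow>
     \<epsilon> \<cdot> w = \<epsilon> \<cdot> pr x y)"

lemma prodrel_unique:
  assumes "u \<in> OP" "v \<in> OP" "prodrel u v w" "prodrel u v w'" shows "w = w'"
  by (rule completion_eqI2[OF assms(1,2) P_sub P_sub]) (use assms(3,4) in \<open>auto simp: prodrel_def\<close>)

lemma dense_orthogonal_prod:
  assumes "dense_orthogonal C I \<xi>" "dense_orthogonal C J \<chi>"
  shows "dense_orthogonal C (I \<times> J) (\<lambda>(a, b). \<xi> a \<otimes>\<^sub>C \<chi> b)"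
proof -
  have eq: "(\<lambda>(a, b). \<xi> a \<otimes>\<^sub>C \<chi> b) ` (I \<times> J) = {\<epsilon> \<otimes>\<^sub>C \<epsilon>' | \<epsilon> \<epsilon>'. \<epsilon> \<in> \<xi> ` I \<and> \<epsilon>' \<in> \<chi> ` J}" by auto
  have orth: "(\<xi> a \<otimes>\<^sub>C \<chi> b) \<otimes>\<^sub>C (\<xi> a' \<otimes>\<^sub>C \<chi> b') = \<zero>\<^sub>C" if "a \<in> I" "b \<in> J" "a' \<in> I" "b' \<in> J" "(a, b) \<noteq> (a', b')" for a b a' b'
  proof -
    note c = idemD(1)[OF dense_orthogonal_idem[OF assms(1) that(1)]] idemD(1)[OF dense_orthogonal_idem[OF assms(1) that(3)]]
      idemD(1)[OF dense_orthogonal_idem[OF assms(2) that(2)]] idemD(1)[OF dense_orthogonal_idem[OF assms(2) that(4)]]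
    have "(\<xi> a \<otimes>\<^sub>C \<chi> b) \<otimes>\<^sub>C (\<xi> a' \<otimes>\<^sub>C \<chi> b') = (\<xi> a \<otimes>\<^sub>C \<xi> a') \<otimes>\<^sub>C (\<chi> b \<otimes>\<^sub>C \<chi> b')"
      using c by (simp add: C.m_ac)
    also have "\<dots> = \<zero>\<^sub>C"
    proof (cases "a = a'")
      case True
      then have "\<chi> b \<otimes>\<^sub>C \<chi> b' = \<zero>\<^sub>C" using assms(2) that by (auto simp: dense_orthogonal_iff)
      then show ?thesis using c by simp
    next
      case False
      then have "\<xi> a \<otimes>\<^sub>C \<xi> a' = \<zero>\<^sub>C" using assms(1) that by (auto simp: dense_orthogonal_iff)
      then show ?thesis using c by simp
    qed
    finally show ?thesis .
  qed
  have "dense ((\<lambda>(a, b). \<xi> a \<otimes>\<^sub>C \<chi> b) ` (I \<times> J))"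
    unfolding eq using dense_products assms by (simp add: dense_orthogonal_iff)
  then show ?thesis unfolding dense_orthogonal_iff using orth by auto
qed

lemma C_swap: "\<lbrakk>c \<in> carrier C; d \<in> carrier C; u \<in> carrier E\<rbrakk> \<Longrightarrow> c \<cdot> (d \<cdot> u) = d \<cdot> (c \<cdot> u)"
  using C_act_commute Z_closed by blast

lemma pr_local:
  assumes d: "d \<in> carrier C" and P: "x \<in> P" "y \<in> P" "p \<in> P" "q \<in> P"
    and eq: "d \<cdot> x = d \<cdot> p" "d \<cdot> y = d \<cdot> q"
  shows "d \<cdot> pr x y = d \<cdot> pr p q"
proof -
  have "d \<cdot> pr x y = pr (d \<cdot> p) y" using d P by (simp add: pr_smult_left flip: eq(1))
  also have "\<dots> = pr p (d \<cdot> q)" using d P by (simp add: pr_smult_left pr_smult_right flip: eq(2))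
  also have "\<dots> = d \<cdot> pr p q" using d P by (simp add: pr_smult_right)
  finally show ?thesis .
qed

text \<open>\<open>prodrel\<close> describes a product without reference to families representing
  the factors, so independence of the families reduces to this check. On
  \<open>\<eta> = \<xi> a \<chi> b\<close> the factors agree with \<open>x a\<close> and
  \<open>y b\<close>, on \<open>\<epsilon>\<close> with \<open>p\<close> and \<open>q\<close>; hence
  \<open>pr (x a) (y b)\<close> and \<open>pr p q\<close> coincide on
  \<open>\<eta> \<epsilon>\<close>.\<close>

lemma prodrel_orth_sum:
  assumes \<xi>: "dense_orthogonal C I \<xi>" "x \<in> I \<rightarrow> P" and \<chi>: "dense_orthogonal C J \<chi>" "y \<in> J \<rightarrow> P"
  shows "prodrel (orth_sum E I \<xi> x) (orth_sum E J \<chi> y)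
    (orth_sum E (I \<times> J) (\<lambda>(a, b). \<xi> a \<otimes>\<^sub>C \<chi> b) (\<lambda>(a, b). pr (x a) (y b)))" (is "prodrel ?u ?v ?w")
proof -
  have xE: "x \<in> I \<rightarrow> carrier E" and yE: "y \<in> J \<rightarrow> carrier E" using \<xi> \<chi> P_sub by auto
  note u = orth_sum[OF \<xi>(1) xE] and v = orth_sum[OF \<chi>(1) yE]
  have pE: "(\<lambda>(a, b). pr (x a) (y b)) \<in> I \<times> J \<rightarrow> carrier E" using \<xi> \<chi> pr_closed P_sub by fastforce
  note D = dense_orthogonal_prod[OF \<xi>(1) \<chi>(1)]
  note w = orth_sum[OF D pE]
  have "\<epsilon> \<cdot> ?w = \<epsilon> \<cdot> pr p q" if \<epsilon>: "\<epsilon> \<in> idem" and pq: "p \<in> P" "q \<in> P"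
    and up: "\<epsilon> \<cdot> ?u = \<epsilon> \<cdot> p" and vq: "\<epsilon> \<cdot> ?v = \<epsilon> \<cdot> q" for \<epsilon> p q
  proof (rule dense_eqI)
    show "dense ((\<lambda>(a, b). \<xi> a \<otimes>\<^sub>C \<chi> b) ` (I \<times> J))" using D by (simp add: dense_orthogonal_iff)
    fix \<eta> assume "\<eta> \<in> (\<lambda>(a, b). \<xi> a \<otimes>\<^sub>C \<chi> b) ` (I \<times> J)"
    then obtain a b where ab: "a \<in> I" "b \<in> J" "\<eta> = \<xi> a \<otimes>\<^sub>C \<chi> b" by auto
    have xy: "x a \<in> P" "y b \<in> P" using ab \<xi> \<chi> by auto
    note c = idemD(1)[OF dense_orthogonal_idem[OF \<xi>(1) ab(1)]] idemD(1)[OF dense_orthogonal_idem[OF \<chi>(1) ab(2)]] idemD(1)[OF \<epsilon>]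
    note E = R_carrier[OF pq(1)] R_carrier[OF pq(2)] R_carrier[OF xy(1)] R_carrier[OF xy(2)]
    have \<eta>: "\<eta> \<in> carrier C" using ab c by simp
    let ?\<delta> = "\<eta> \<otimes>\<^sub>C \<epsilon>"
    have \<delta>: "?\<delta> \<in> carrier C" "?\<delta> = \<epsilon> \<otimes>\<^sub>C \<eta>" using \<eta> c C.m_comm by auto
    have "\<eta> \<cdot> ?u = \<eta> \<cdot> x a" "\<eta> \<cdot> ?v = \<eta> \<cdot> y b"
      using c E u(1) v(1) u(2)[OF ab(1)] v(2)[OF ab(2)] C_swap[OF c(1,2)] ab(3) by (simp_all add: C_act_mult)
    then have "?\<delta> \<cdot> x a = ?\<delta> \<cdot> p" "?\<delta> \<cdot> y b = ?\<delta> \<cdot> q"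
      using \<eta> c E u(1) v(1) up vq C_swap[OF c(3) \<eta>] by (metis C_act_mult)+
    then have "?\<delta> \<cdot> pr (x a) (y b) = ?\<delta> \<cdot> pr p q" by (rule pr_local[OF \<delta>(1) xy pq])
    moreover have "?\<delta> \<cdot> ?w = ?\<delta> \<cdot> pr (x a) (y b)"
      using w(2)[of "(a, b)"] ab \<eta> c(3) w(1) R_carrier[OF pr_closed[OF xy]] unfolding \<delta>(2) by (simp add: C_act_mult)
    ultimately show "\<eta> \<cdot> (\<epsilon> \<cdot> ?w) = \<eta> \<cdot> (\<epsilon> \<cdot> pr p q)"
      using \<eta> c(3) w(1) R_carrier[OF pr_closed[OF pq]] by (simp add: C_act_mult)
  qed (use \<epsilon> w(1) R_carrier[OF pr_closed[OF pq]] in auto)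
  then show ?thesis unfolding prodrel_def using w(1) by blast
qed

definition omul :: "'c \<Rightarrow> 'c \<Rightarrow> 'c" where "omul u v = (THE w. prodrel u v w)"

lemma omul_eqI: "\<lbrakk>u \<in> OP; v \<in> OP; prodrel u v w\<rbrakk> \<Longrightarrow> omul u v = w"
  unfolding omul_def using prodrel_unique by blast

lemma omul_orth_sum:
  assumes "dense_orthogonal C I \<xi>" "x \<in> I \<rightarrow> P" "dense_orthogonal C J \<chi>" "y \<in> J \<rightarrow> P"
  shows "omul (orth_sum E I \<xi> x) (orth_sum E J \<chi> y) =
    orth_sum E (I \<times> J) (\<lambda>(a, b). \<xi> a \<otimes>\<^sub>C \<chi> b) (\<lambda>(a, b). pr (x a) (y b))"
  using omul_eqI[OF orth_sum_completion[OF P_sub assms(1,2)] orth_sum_completion[OF P_sub assms(3,4)] prodrel_orth_sum[OF assms]] .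

lemma prodrel_omul: assumes "u \<in> OP" "v \<in> OP" shows "prodrel u v (omul u v)"
proof -
  obtain I x J y where "dense_orthogonal C I (\<lambda>t. t)" "x \<in> I \<rightarrow> P" "u = orth_sum E I (\<lambda>t. t) x"
    "dense_orthogonal C J (\<lambda>t. t)" "y \<in> J \<rightarrow> P" "v = orth_sum E J (\<lambda>t. t) y"
    using completion_repr[OF P_sub assms(1)] completion_repr[OF P_sub assms(2)] by metis
  then show ?thesis using prodrel_orth_sum omul_eqI[OF assms] by metis
qed

lemma omul_carrier: "\<lbrakk>u \<in> OP; v \<in> OP\<rbrakk> \<Longrightarrow> omul u v \<in> carrier E"
  using prodrel_omul by (simp add: prodrel_def)

lemma omul_local:
  "\<lbrakk>u \<in> OP; v \<in> OP; \<epsilon> \<in> idem; x \<in> P; y \<in> P; \<epsilon> \<cdot> u = \<epsilon> \<cdot> x; \<epsilon> \<cdot> v = \<epsilon> \<cdot> y\<rbrakk> \<Longrightarrow>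
    \<epsilon> \<cdot> omul u v = \<epsilon> \<cdot> pr x y"
  using prodrel_omul by (simp add: prodrel_def)

text \<open>Stated for subsets of \<open>P\<close> closed under products, since both
  \<open>P\<close> and the original algebra inside it are completed.\<close>

lemma completion_omul:
  assumes S: "S \<subseteq> P" "\<And>x y. \<lbrakk>x \<in> S; y \<in> S\<rbrakk> \<Longrightarrow> pr x y \<in> S" and u: "u \<in> completion S" "v \<in> completion S"
  shows "omul u v \<in> completion S"
proof -
  have SE: "S \<subseteq> carrier E" using S P_sub by blast
  have O: "u \<in> OP" "v \<in> OP" using completion_mono[OF S(1)] u by auto
  show ?thesis
    by (rule completion_memI2[OF u SE SE omul_carrier[OF O]]) (use omul_local[OF O] S in blast)
qed

lemma omul_closed: "\<lbrakk>u \<in> OP; v \<in> OP\<rbrakk> \<Longrightarrow> omul u v \<in> OP"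
  using completion_omul[of P] pr_closed by blast

lemma omul_add_left:
  assumes "u \<in> OP" "v \<in> OP" "w \<in> OP" shows "omul (u \<oplus>\<^sub>E v) w = omul u w \<oplus>\<^sub>E omul v w"
proof (rule completion_eqI3[OF assms P_sub])
  have uv: "u \<oplus>\<^sub>E v \<in> OP" using SubD(4)[OF Sub_OP] assms by blast
  show "omul (u \<oplus>\<^sub>E v) w \<in> carrier E" "omul u w \<oplus>\<^sub>E omul v w \<in> carrier E" using assms uv omul_carrier by auto
  fix \<epsilon> x y z assume *: "\<epsilon> \<in> idem" "x \<in> P" "y \<in> P" "z \<in> P" "\<epsilon> \<cdot> u = \<epsilon> \<cdot> x" "\<epsilon> \<cdot> v = \<epsilon> \<cdot> y" "\<epsilon> \<cdot> w = \<epsilon> \<cdot> z"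
  have xy: "x \<oplus>\<^sub>E y \<in> P" using SubD(4)[OF Sub_R] * by blast
  have "\<epsilon> \<cdot> (u \<oplus>\<^sub>E v) = \<epsilon> \<cdot> (x \<oplus>\<^sub>E y)"
    using * assms completion_carrier R_carrier by (simp add: C_act_add_right)
  from omul_local[OF uv assms(3) *(1) xy *(4) this *(7)]
  show "\<epsilon> \<cdot> omul (u \<oplus>\<^sub>E v) w = \<epsilon> \<cdot> (omul u w \<oplus>\<^sub>E omul v w)"
    using * assms omul_carrier R_carrier pr_closed omul_local[OF assms(1,3) *(1,2,4,5,7)] omul_local[OF assms(2,3) *(1,3,4,6,7)]
    by (simp add: C_act_add_right pr_add_left)
qed

lemma omul_add_right:
  assumes "u \<in> OP" "v \<in> OP" "w \<in> OP" shows "omul u (v \<oplus>\<^sub>E w) = omul u v \<oplus>\<^sub>E omul u w"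
proof (rule completion_eqI3[OF assms P_sub])
  have vw: "v \<oplus>\<^sub>E w \<in> OP" using SubD(4)[OF Sub_OP] assms by blast
  show "omul u (v \<oplus>\<^sub>E w) \<in> carrier E" "omul u v \<oplus>\<^sub>E omul u w \<in> carrier E" using assms vw omul_carrier by auto
  fix \<epsilon> x y z assume *: "\<epsilon> \<in> idem" "x \<in> P" "y \<in> P" "z \<in> P" "\<epsilon> \<cdot> u = \<epsilon> \<cdot> x" "\<epsilon> \<cdot> v = \<epsilon> \<cdot> y" "\<epsilon> \<cdot> w = \<epsilon> \<cdot> z"
  have yz: "y \<oplus>\<^sub>E z \<in> P" using SubD(4)[OF Sub_R] * by blast
  have "\<epsilon> \<cdot> (v \<oplus>\<^sub>E w) = \<epsilon> \<cdot> (y \<oplus>\<^sub>E z)"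
    using * assms completion_carrier R_carrier by (simp add: C_act_add_right)
  from omul_local[OF assms(1) vw *(1,2) yz *(5) this]
  show "\<epsilon> \<cdot> omul u (v \<oplus>\<^sub>E w) = \<epsilon> \<cdot> (omul u v \<oplus>\<^sub>E omul u w)"
    using * assms omul_carrier R_carrier pr_closed omul_local[OF assms(1,2) *(1,2,3,5,6)] omul_local[OF assms(1,3) *(1,2,4,5,7)]
    by (simp add: C_act_add_right pr_add_right)
qed

lemma omul_smult:
  assumes c: "c \<in> carrier C" and uv: "u \<in> OP" "v \<in> OP"
  shows "omul (c \<cdot> u) v = c \<cdot> omul u v" "omul u (c \<cdot> v) = c \<cdot> omul u v"
proof -
  have cu: "c \<cdot> u \<in> OP" "c \<cdot> v \<in> OP" using OP_smult c uv by auto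
  have E: "u \<in> carrier E" "v \<in> carrier E" "omul u v \<in> carrier E" using uv completion_carrier omul_carrier by auto
  show "omul (c \<cdot> u) v = c \<cdot> omul u v"
  proof (rule completion_eqI2[OF uv P_sub P_sub])
    fix \<epsilon> x y assume *: "\<epsilon> \<in> idem" "x \<in> P" "y \<in> P" "\<epsilon> \<cdot> u = \<epsilon> \<cdot> x" "\<epsilon> \<cdot> v = \<epsilon> \<cdot> y"
    note \<epsilon> = idemD(1)[OF *(1)]
    have "\<epsilon> \<cdot> (c \<cdot> u) = \<epsilon> \<cdot> (c \<cdot> x)"
      using C_swap[OF \<epsilon> c] E R_carrier[OF *(2)] *(4) by simp
    from omul_local[OF cu(1) uv(2) *(1) P_smult[OF c *(2)] *(3) this *(5)]
    show "\<epsilon> \<cdot> omul (c \<cdot> u) v = \<epsilon> \<cdot> (c \<cdot> omul u v)"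
      using C_swap[OF \<epsilon> c] E omul_local[OF uv *] R_carrier[OF pr_closed[OF *(2,3)]] c * by (simp add: pr_smult_left)
  qed (use c E omul_carrier[OF cu(1) uv(2)] in auto)
  show "omul u (c \<cdot> v) = c \<cdot> omul u v"
  proof (rule completion_eqI2[OF uv P_sub P_sub])
    fix \<epsilon> x y assume *: "\<epsilon> \<in> idem" "x \<in> P" "y \<in> P" "\<epsilon> \<cdot> u = \<epsilon> \<cdot> x" "\<epsilon> \<cdot> v = \<epsilon> \<cdot> y"
    note \<epsilon> = idemD(1)[OF *(1)]
    have "\<epsilon> \<cdot> (c \<cdot> v) = \<epsilon> \<cdot> (c \<cdot> y)"
      using C_swap[OF \<epsilon> c] E R_carrier[OF *(3)] *(5) by simp
    from omul_local[OF uv(1) cu(2) *(1,2) P_smult[OF c *(3)] *(4) this]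
    show "\<epsilon> \<cdot> omul u (c \<cdot> v) = \<epsilon> \<cdot> (c \<cdot> omul u v)"
      using C_swap[OF \<epsilon> c] E omul_local[OF uv *] R_carrier[OF pr_closed[OF *(2,3)]] c * by (simp add: pr_smult_right)
  qed (use c E omul_carrier[OF uv(1) cu(2)] in auto)
qed

text \<open>Multiplication by an element of \<open>P\<close> is the action of an operator from
  \<open>A\<close>, even on the completion. This is why ideals of \<open>OP\<close> are submodules
  of \<open>E\<close> and why the two endomorphism rings of \<open>OP\<close> can be
  compared.\<close>

lemma omul_P:
  assumes x: "x \<in> P" and u: "u \<in> OP"
  shows "omul x u = l x \<cdot> u" "omul u x = r x \<cdot> u"
proof -
  note xO = P_OP[OF x] and uE = completion_carrier[OF u]
  show "omul x u = l x \<cdot> u"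
  proof (rule completion_eqI1[OF u P_sub omul_carrier[OF xO u]])
    fix \<epsilon> y assume *: "\<epsilon> \<in> idem" "y \<in> P" "\<epsilon> \<cdot> u = \<epsilon> \<cdot> y"
    have "\<epsilon> \<cdot> (l x \<cdot> u) = \<epsilon> \<cdot> (l x \<cdot> y)" using C_act_commute[of \<epsilon> "l x"] * x uE R_carrier by simp
    then show "\<epsilon> \<cdot> omul x u = \<epsilon> \<cdot> (l x \<cdot> u)"
      using omul_local[OF xO u *(1) x *(2) refl *(3)] l_act[OF x *(2)] by simp
  qed (use x uE in auto)
  show "omul u x = r x \<cdot> u"
  proof (rule completion_eqI1[OF u P_sub omul_carrier[OF u xO]])
    fix \<epsilon> y assume *: "\<epsilon> \<in> idem" "y \<in> P" "\<epsilon> \<cdot> u = \<epsilon> \<cdot> y"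
    have "\<epsilon> \<cdot> (r x \<cdot> u) = \<epsilon> \<cdot> (r x \<cdot> y)" using C_act_commute[of \<epsilon> "r x"] * x uE R_carrier by simp
    then show "\<epsilon> \<cdot> omul u x = \<epsilon> \<cdot> (r x \<cdot> u)"
      using omul_local[OF u xO *(1,2) x *(3) refl] r_act[OF *(2) x] by simp
  qed (use x uE in auto)
qed

lemma omul_pr: "\<lbrakk>x \<in> P; y \<in> P\<rbrakk> \<Longrightarrow> omul x y = pr x y"
  using omul_P(1) P_OP l_act by simp

text \<open>The algebra enters as a record \<open>Q\<close>, because the locale knows only its set
  and its product. By \<open>omul_orth_sum\<close> every admissible pair of families gives the same
  value, as the definite description requires.\<close>

lemma orth_completion_mult_eq:
  assumes "carrier Q = P" "\<And>x y. \<lbrakk>x \<in> P; y \<in> P\<rbrakk> \<Longrightarrow> x \<otimes>\<^bsub>Q\<^esub> y = pr x y" "u \<in> OP" "v \<in> OP"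
  shows "orth_completion_mult C Q E u v = omul u v"
proof -
  have eq: "orth_sum E (I \<times> J) \<zeta> (\<lambda>(a, b). x a \<otimes>\<^bsub>Q\<^esub> y b) = orth_sum E (I \<times> J) \<zeta> (\<lambda>(a, b). pr (x a) (y b))"
    if "x \<in> I \<rightarrow> P" "y \<in> J \<rightarrow> P" for I J :: "'b set" and x y \<zeta>
    by (rule orth_sum_cong) (use that assms(2) in auto)
  show ?thesis
    unfolding orth_completion_mult_def
  proof (rule the_equality, goal_cases)
    case 1
    obtain I x J y where *: "dense_orthogonal C I (\<lambda>t. t)" "x \<in> I \<rightarrow> P" "u = orth_sum E I (\<lambda>t. t) x"
      "dense_orthogonal C J (\<lambda>t. t)" "y \<in> J \<rightarrow> P" "v = orth_sum E J (\<lambda>t. t) y"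
      using completion_repr[OF P_sub assms(3)] completion_repr[OF P_sub assms(4)] by metis
    show ?case
      by (intro exI[of _ I] exI[of _ "\<lambda>t. t"] exI[of _ x] exI[of _ J] exI[of _ y])
        (use * assms(1) eq[OF *(2,5)] omul_orth_sum[OF *(1,2,4,5)] in simp)
  next
    case (2 w)
    then obtain I :: "'b set" and \<xi> x and J :: "'b set" and \<chi> y where *: "dense_orthogonal C I \<xi>" "x \<in> I \<rightarrow> P"
      "dense_orthogonal C J \<chi>" "y \<in> J \<rightarrow> P" "u = orth_sum E I \<xi> x" "v = orth_sum E J \<chi> y"
      "w = orth_sum E (I \<times> J) (\<lambda>(a, b). \<xi> a \<otimes>\<^sub>C \<chi> b) (\<lambda>(a, b). x a \<otimes>\<^bsub>Q\<^esub> y b)"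
      unfolding assms(1) by (elim exE conjE) (rule that)
    then show ?case using eq[OF *(2,4)] omul_orth_sum[OF *(1-4)] by simp
  qed
qed

end

context right_mod
begin

lemma generate_induct_neg:
  assumes "x \<in> generate (add_monoid E) H" and H: "\<And>h. h \<in> H \<Longrightarrow> \<ominus>\<^sub>E h \<in> H"
    and 0: "Q \<zero>\<^sub>E" and incl: "\<And>h. h \<in> H \<Longrightarrow> Q h"
    and add: "\<And>x y. \<lbrakk>x \<in> generate (add_monoid E) H; y \<in> generate (add_monoid E) H; Q x; Q y\<rbrakk> \<Longrightarrow> Q (x \<oplus>\<^sub>E y)"
  shows "Q x"
  using assms(1)
proof (induction rule: generate.induct)
  case (inv h) then show ?case using incl[OF H] by (simp add: a_inv_def)
qed (use 0 incl add in simp_all)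

lemma generate_addI:
  "\<zero>\<^sub>E \<in> generate (add_monoid E) H"
  "h \<in> H \<Longrightarrow> h \<in> generate (add_monoid E) H"
  "\<lbrakk>x \<in> generate (add_monoid E) H; y \<in> generate (add_monoid E) H\<rbrakk> \<Longrightarrow> x \<oplus>\<^sub>E y \<in> generate (add_monoid E) H"
  using generate.one[of "add_monoid E" H] generate.incl[of h H "add_monoid E"] generate.eng[of x "add_monoid E" H y] by simp_all

end

context closed_hull
begin

text \<open>Of all products with \<open>OP\<close> only those with \<open>P\<close> enter, because
  \<open>A\<close> is generated by the multiplications by \<open>P\<close> and by
  \<open>C\<close>.\<close>

lemma OP_ideal_Sub:
  assumes K: "K \<subseteq> carrier E" "\<zero>\<^sub>E \<in> K" "\<And>x y. \<lbrakk>x \<in> K; y \<in> K\<rbrakk> \<Longrightarrow> x \<oplus>\<^sub>E y \<in> K"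
    "\<And>c x. \<lbrakk>c \<in> carrier C; x \<in> K\<rbrakk> \<Longrightarrow> c \<cdot> x \<in> K"
    "\<And>p x. \<lbrakk>p \<in> P; x \<in> K\<rbrakk> \<Longrightarrow> l p \<cdot> x \<in> K" "\<And>p x. \<lbrakk>p \<in> P; x \<in> K\<rbrakk> \<Longrightarrow> r p \<cdot> x \<in> K"
  shows "Sub K"
proof (rule SubI)
  fix a x assume "a \<in> carrier A" "x \<in> K"
  have "\<forall>x\<in>K. a \<cdot> x \<in> K"
    using \<open>a \<in> carrier A\<close>
    by (rule A_induct) (use K in \<open>auto simp: act_add_left act_assoc subset_iff\<close>)
  then show "a \<cdot> x \<in> K" using \<open>x \<in> K\<close> by blast
qed (use K in auto)

lemma OP_semiprime:
  assumes "Sub K" "K \<noteq> {\<zero>\<^sub>E}" shows "\<exists>x\<in>K \<inter> P. \<exists>y\<in>K \<inter> P. omul x y \<noteq> \<zero>\<^sub>E"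
  using semiprime[OF Sub_Int[OF assms(1) Sub_R] _ meets_R[OF assms]]
  by (metis IntD2 Int_lower2 omul_pr)

lemma omul_zero: "u \<in> OP \<Longrightarrow> omul \<zero>\<^sub>E u = \<zero>\<^sub>E" "u \<in> OP \<Longrightarrow> omul u \<zero>\<^sub>E = \<zero>\<^sub>E"
proof -
  assume u: "u \<in> OP"
  note z = P_OP[OF SubD(3)[OF Sub_R]]
  show "omul \<zero>\<^sub>E u = \<zero>\<^sub>E"
    using omul_smult(1)[OF C.zero_closed z u] omul_carrier[OF z u] by simp
  show "omul u \<zero>\<^sub>E = \<zero>\<^sub>E"
    using omul_smult(2)[OF C.zero_closed u z] omul_carrier[OF u z] by simp
qed

text \<open>If all products of elements of \<open>I\<close> vanish, so do those of its \<open>C\<close>-span, which is a submodule of \<open>E\<close>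
  although \<open>I\<close> need not be.\<close>

lemma span_semiprime:
  assumes span: "\<And>S. \<lbrakk>\<zero>\<^sub>E \<in> S; \<And>c a. \<lbrakk>c \<in> carrier C; a \<in> G\<rbrakk> \<Longrightarrow> c \<cdot> a \<in> S;
      \<And>x y. \<lbrakk>x \<in> P; y \<in> P; x \<in> S; y \<in> S\<rbrakk> \<Longrightarrow> x \<oplus>\<^sub>E y \<in> S\<rbrakk> \<Longrightarrow> P \<subseteq> S"
    and G: "G \<subseteq> P" and I: "I \<subseteq> OP" "\<zero>\<^sub>E \<in> I" "I \<noteq> {\<zero>\<^sub>E}"
    and mult: "\<And>a u. \<lbrakk>a \<in> G; u \<in> I\<rbrakk> \<Longrightarrow> omul a u \<in> I" "\<And>a u. \<lbrakk>a \<in> G; u \<in> I\<rbrakk> \<Longrightarrow> omul u a \<in> I"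
  shows "\<exists>x\<in>I. \<exists>y\<in>I. omul x y \<noteq> \<zero>\<^sub>E"
proof (rule ccontr)
  assume "\<not> ?thesis"
  then have II: "omul x y = \<zero>\<^sub>E" if "x \<in> I" "y \<in> I" for x y using that by blast
  define H where "H = {c \<cdot> u | c u. c \<in> carrier C \<and> u \<in> I}"
  define J where "J = generate (add_monoid E) H"
  have IE: "u \<in> carrier E" "u \<in> OP" if "u \<in> I" for u using that I completion_carrier by auto
  have neg: "\<ominus>\<^sub>E h \<in> H" if h: "h \<in> H" for h
  proof -
    obtain c u where "c \<in> carrier C" "u \<in> I" "h = c \<cdot> u" using h by (auto simp: H_def)
    then have "\<ominus>\<^sub>E h = (\<ominus>\<^bsub>C\<^esub> c) \<cdot> u" "\<ominus>\<^bsub>C\<^esub> c \<in> carrier C" using IE C_act_neg by simp_all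
    then show ?thesis using \<open>u \<in> I\<close> unfolding H_def by blast
  qed
  note J_simps = generate_addI[where H = H, folded J_def]
  have J_induct: "Q x" if "x \<in> J" "Q \<zero>\<^sub>E" "\<And>c u. \<lbrakk>c \<in> carrier C; u \<in> I\<rbrakk> \<Longrightarrow> Q (c \<cdot> u)"
    "\<And>x y. \<lbrakk>x \<in> J; y \<in> J; Q x; Q y\<rbrakk> \<Longrightarrow> Q (x \<oplus>\<^sub>E y)" for Q x
    using that(1)[unfolded J_def] neg that(2)
    by (rule generate_induct_neg) (use that(3,4) in \<open>auto simp: J_def H_def\<close>)
  have JH: "c \<cdot> u \<in> J" if "c \<in> carrier C" "u \<in> I" for c u
    using that by (intro J_simps(2)) (auto simp: H_def)
  have JOP: "x \<in> OP" if "x \<in> J" for x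
    using that by (rule J_induct) (use IE OP_smult SubD[OF Sub_OP] in auto)
  have JE: "x \<in> carrier E" if "x \<in> J" for x using JOP[OF that] completion_carrier by blast
  have JC: "c \<cdot> x \<in> J" if c: "c \<in> carrier C" and "x \<in> J" for c x
    using that(2)
  proof (rule J_induct)
    show "c \<cdot> (d \<cdot> u) \<in> J" if "d \<in> carrier C" "u \<in> I" for d u
      using JH[of "c \<otimes>\<^sub>C d" u] that c IE by (simp add: C_act_mult)
  qed (use c JE J_simps in \<open>auto simp: C_act_add_right\<close>)
  \<comment> \<open>\<open>I\<close> is closed under products with \<open>G\<close> only. Since the
    \<open>C\<close>-multiples of \<open>G\<close> span \<open>P\<close> additively, products with
    \<open>P\<close> may leave \<open>I\<close> but stay in \<open>J\<close>.\<close>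
  have mem: "omul p u \<in> J \<and> omul u p \<in> J" if "p \<in> P" "u \<in> I" for p u
  proof -
    note u = IE[OF that(2)]
    have "P \<subseteq> {p. omul p u \<in> J \<and> omul u p \<in> J}"
    proof (rule span; unfold mem_Collect_eq)
      show "omul \<zero>\<^sub>E u \<in> J \<and> omul u \<zero>\<^sub>E \<in> J" using u J_simps(1) by (simp add: omul_zero)
      show "omul (c \<cdot> a) u \<in> J \<and> omul u (c \<cdot> a) \<in> J" if c: "c \<in> carrier C" and a: "a \<in> G" for c a
      proof -
        have aO: "a \<in> OP" using a G P_OP by blast
        have "omul (c \<cdot> a) u = c \<cdot> omul a u" "omul u (c \<cdot> a) = c \<cdot> omul u a"
          using omul_smult(1)[OF c aO u(2)] omul_smult(2)[OF c u(2) aO] .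
        then show ?thesis using JH[OF c] mult a \<open>u \<in> I\<close> by simp
      qed
      show "omul (x \<oplus>\<^sub>E y) u \<in> J \<and> omul u (x \<oplus>\<^sub>E y) \<in> J"
        if "x \<in> P" "y \<in> P" "omul x u \<in> J \<and> omul u x \<in> J" "omul y u \<in> J \<and> omul u y \<in> J" for x y
        using that u J_simps(3) P_OP by (simp add: omul_add_left omul_add_right)
    qed
    then show ?thesis using that(1) by blast
  qed
  have memJ: "omul p x \<in> J \<and> omul x p \<in> J" if p: "p \<in> P" and "x \<in> J" for p x
    using that(2)
  proof (rule J_induct)
    note pO = P_OP[OF p]
    show "omul p \<zero>\<^sub>E \<in> J \<and> omul \<zero>\<^sub>E p \<in> J" using pO J_simps(1) by (simp add: omul_zero)
    show "omul p (c \<cdot> u) \<in> J \<and> omul (c \<cdot> u) p \<in> J" if "c \<in> carrier C" "u \<in> I" for c u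
      using mem[OF p that(2)] JC that pO IE by (simp add: omul_smult)
    show "omul p (x \<oplus>\<^sub>E y) \<in> J \<and> omul (x \<oplus>\<^sub>E y) p \<in> J"
      if "x \<in> J" "y \<in> J" "omul p x \<in> J \<and> omul x p \<in> J" "omul p y \<in> J \<and> omul y p \<in> J" for x y
      using that J_simps(3) pO JOP by (simp add: omul_add_left omul_add_right)
  qed
  have "Sub J"
  proof (rule OP_ideal_Sub)
    show "\<And>p x. \<lbrakk>p \<in> P; x \<in> J\<rbrakk> \<Longrightarrow> l p \<cdot> x \<in> J" "\<And>p x. \<lbrakk>p \<in> P; x \<in> J\<rbrakk> \<Longrightarrow> r p \<cdot> x \<in> J"
      using memJ omul_P JOP by metis+
  qed (use JE J_simps JC in auto)
  moreover have "J \<noteq> {\<zero>\<^sub>E}"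
  proof -
    obtain u where "u \<in> I" "u \<noteq> \<zero>\<^sub>E" using I by blast
    then show ?thesis using JH[of "\<one>\<^bsub>C\<^esub>" u] IE by auto
  qed
  ultimately obtain x y where xy: "x \<in> J" "y \<in> J" "omul x y \<noteq> \<zero>\<^sub>E" using OP_semiprime by blast
  \<comment> \<open>Bilinearity carries the vanishing of products from \<open>I\<close> to its span,
    one factor at a time.\<close>
  have IJ: "omul u y = \<zero>\<^sub>E" if u: "u \<in> I" for u
    using xy(2)
  proof (rule J_induct)
    show "omul u (c \<cdot> v) = \<zero>\<^sub>E" if "c \<in> carrier C" "v \<in> I" for c v
      using that u IE II by (simp add: omul_smult)
    show "omul u (x \<oplus>\<^sub>E y) = \<zero>\<^sub>E" if "x \<in> J" "y \<in> J" "omul u x = \<zero>\<^sub>E" "omul u y = \<zero>\<^sub>E" for x y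
      using that u IE JOP by (simp add: omul_add_right)
  qed (use u IE in \<open>simp add: omul_zero\<close>)
  have "omul x y = \<zero>\<^sub>E"
    using xy(1)
  proof (rule J_induct)
    note y = JOP[OF xy(2)]
    show "omul \<zero>\<^sub>E y = \<zero>\<^sub>E" using y by (simp add: omul_zero)
    show "omul (c \<cdot> u) y = \<zero>\<^sub>E" if "c \<in> carrier C" "u \<in> I" for c u
      using that y IE IJ by (simp add: omul_smult)
    show "omul (u \<oplus>\<^sub>E v) y = \<zero>\<^sub>E" if "u \<in> J" "v \<in> J" "omul u y = \<zero>\<^sub>E" "omul v y = \<zero>\<^sub>E" for u v
      using that y JOP by (simp add: omul_add_left)
  qed
  then show False using xy(3) by simp
qed

text \<open>The map that sends \<open>p\<close> to the orthogonal sum of the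
  \<open>\<phi> a \<cdot> p\<close> is a homomorphism from \<open>P\<close> to \<open>E\<close>,
  hence multiplication by an element of \<open>C\<close>. So coefficients can be glued as well as
  elements.\<close>

lemma C_orth_complete:
  assumes \<xi>: "dense_orthogonal C I \<xi>" and \<phi>: "\<phi> \<in> I \<rightarrow> carrier C"
  shows "\<exists>c\<in>carrier C. \<forall>a\<in>I. \<xi> a \<otimes>\<^sub>C c = \<xi> a \<otimes>\<^sub>C \<phi> a"
proof -
  have \<phi>C: "\<phi> a \<in> carrier C" if "a \<in> I" for a using \<phi> that by auto
  have \<xi>C: "\<xi> a \<in> carrier C" if "a \<in> I" for a using dense_orthogonal_idem[OF \<xi> that] by simp
  define f where "f p = orth_sum E I \<xi> (\<lambda>a. \<phi> a \<cdot> p)" for p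
  have fp: "f p \<in> carrier E" "\<And>a. a \<in> I \<Longrightarrow> \<xi> a \<cdot> f p = \<xi> a \<cdot> (\<phi> a \<cdot> p)" if "p \<in> P" for p
    unfolding f_def using orth_sum[OF \<xi>, of "\<lambda>a. \<phi> a \<cdot> p"] \<phi>C R_carrier[OF that] by simp_all
  have "f \<in> Hom P"
  proof (rule HomI)
    show "f (x \<oplus>\<^sub>E y) = f x \<oplus>\<^sub>E f y" if "x \<in> P" "y \<in> P" for x y
      unfolding f_def[of "x \<oplus>\<^sub>E y"] by (rule orth_sum_eqI[OF \<xi>])
        (use that fp \<phi>C \<xi>C R_carrier in \<open>simp_all add: C_act_add_right\<close>)
    show "f (b \<cdot> x) = b \<cdot> f x" if b: "b \<in> carrier A" and x: "x \<in> P" for b x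
      unfolding f_def[of "b \<cdot> x"]
    proof (rule orth_sum_eqI[OF \<xi>])
      fix a assume a: "a \<in> I"
      show "\<xi> a \<cdot> (b \<cdot> f x) = \<xi> a \<cdot> (\<phi> a \<cdot> (b \<cdot> x))"
        using C_act_commute[OF \<xi>C[OF a] b] C_act_commute[OF \<phi>C[OF a] b] fp[OF x] \<phi>C[OF a] R_carrier[OF x] a by simp
    qed (use fp[OF x] b in simp)
  qed (use fp in auto)
  then obtain c where c: "c \<in> carrier C" "\<And>p. p \<in> P \<Longrightarrow> f p = c \<cdot> p" using Hom_P by blast
  have "\<xi> a \<otimes>\<^sub>C c = \<xi> a \<otimes>\<^sub>C \<phi> a" if a: "a \<in> I" for a
    by (rule C_eqI) (use fp(2)[OF _ a] c \<xi>C[OF a] \<phi>C[OF a] R_carrier in \<open>simp_all add: C_act_mult\<close>)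
  then show ?thesis using c(1) by blast
qed

text \<open>If each component \<open>x t\<close> of \<open>u\<close> is a sum of \<open>n\<close>
  terms \<open>\<phi> t i \<cdot> a t i\<close>, then for every \<open>i < n\<close> the
  coefficients are glued to some \<open>c i\<close> in \<open>C\<close> and the elements to some
  \<open>b i\<close> in the completion of \<open>G\<close>, and
  \<open>u = \<Sum> c i \<cdot> b i\<close>. The bound \<open>n\<close>, independent of
  \<open>t\<close>, keeps this sum finite.\<close>

lemma OP_eq_span:
  assumes G: "G \<subseteq> P"
    and gen: "\<And>p. p \<in> P \<Longrightarrow> \<exists>\<phi> a. \<phi> \<in> {..<n} \<rightarrow> carrier C \<and> a \<in> {..<n} \<rightarrow> G \<and> p = (\<Oplus>\<^bsub>E\<^esub> i \<in> {..<n::nat}. \<phi> i \<cdot> a i)"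
  shows "OP = generate (add_monoid E) {c \<cdot> x | c x. c \<in> carrier C \<and> x \<in> completion G}"
proof
  let ?H = "{c \<cdot> x | c x. c \<in> carrier C \<and> x \<in> completion G}"
  note DG = completion_mono[OF G]
  have GE: "G \<subseteq> carrier E" using G P_sub by blast
  show "generate (add_monoid E) ?H \<subseteq> OP"
  proof
    fix x assume "x \<in> generate (add_monoid E) ?H"
    then show "x \<in> OP"
    proof (rule generate_induct_neg)
      show "\<ominus>\<^sub>E h \<in> ?H" if h: "h \<in> ?H" for h
      proof -
        obtain c u where "c \<in> carrier C" "u \<in> completion G" "h = c \<cdot> u" using h by auto
        then have "\<ominus>\<^sub>E h = (\<ominus>\<^bsub>C\<^esub> c) \<cdot> u" "\<ominus>\<^bsub>C\<^esub> c \<in> carrier C" using completion_carrier C_act_neg by simp_all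
        then show ?thesis using \<open>u \<in> completion G\<close> by blast
      qed
    qed (use OP_smult DG SubD[OF Sub_OP] in auto)
  qed
  show "OP \<subseteq> generate (add_monoid E) ?H"
  proof
    fix u assume u: "u \<in> OP"
    obtain T x where T: "dense_orthogonal C T (\<lambda>t. t)" and x: "x \<in> T \<rightarrow> P" "u = orth_sum E T (\<lambda>t. t) x"
      using completion_repr[OF P_sub u] by blast
    have xE: "x \<in> T \<rightarrow> carrier E" using x P_sub by blast
    have "\<forall>t\<in>T. \<exists>\<phi> a. \<phi> \<in> {..<n} \<rightarrow> carrier C \<and> a \<in> {..<n} \<rightarrow> G \<and> x t = (\<Oplus>\<^bsub>E\<^esub> i \<in> {..<n}. \<phi> i \<cdot> a i)"
      using gen x(1) by blast
    from bchoice[OF this] obtain \<phi> where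
      "\<forall>t\<in>T. \<exists>a. \<phi> t \<in> {..<n} \<rightarrow> carrier C \<and> a \<in> {..<n} \<rightarrow> G \<and> x t = (\<Oplus>\<^bsub>E\<^esub> i \<in> {..<n}. \<phi> t i \<cdot> a i)" ..
    from bchoice[OF this] obtain a where "\<forall>t\<in>T. \<phi> t \<in> {..<n} \<rightarrow> carrier C \<and> a t \<in> {..<n} \<rightarrow> G \<and>
      x t = (\<Oplus>\<^bsub>E\<^esub> i \<in> {..<n}. \<phi> t i \<cdot> a t i)" ..
    then have \<phi>a: "\<phi> t \<in> {..<n} \<rightarrow> carrier C" "a t \<in> {..<n} \<rightarrow> G"
      "x t = (\<Oplus>\<^bsub>E\<^esub> i \<in> {..<n}. \<phi> t i \<cdot> a t i)" if "t \<in> T" for t using that by blast+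
    have tC: "t \<in> carrier C" if "t \<in> T" for t using dense_orthogonal_idem[OF T that] by simp
    have "\<exists>c. c \<in> carrier C \<and> (\<forall>t\<in>T. t \<otimes>\<^sub>C c = t \<otimes>\<^sub>C \<phi> t i)" if "i < n" for i
      using C_orth_complete[OF T, of "\<lambda>t. \<phi> t i"] \<phi>a(1) that by auto
    then obtain c where c: "\<And>i. i < n \<Longrightarrow> c i \<in> carrier C" "\<And>i t. \<lbrakk>i < n; t \<in> T\<rbrakk> \<Longrightarrow> t \<otimes>\<^sub>C c i = t \<otimes>\<^sub>C \<phi> t i" by metis
    define b where "b = (\<lambda>i. orth_sum E T (\<lambda>t. t) (\<lambda>t. a t i))"
    have b: "b i \<in> completion G" "b i \<in> carrier E" "\<And>t. t \<in> T \<Longrightarrow> t \<cdot> b i = t \<cdot> a t i" if "i < n" for i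
    proof -
      have aG: "(\<lambda>t. a t i) \<in> T \<rightarrow> G" using \<phi>a(2) that by auto
      then have aE: "(\<lambda>t. a t i) \<in> T \<rightarrow> carrier E" using GE by blast
      show "b i \<in> completion G" unfolding b_def using orth_sum_completion[OF GE T aG] .
      show "b i \<in> carrier E" "\<And>t. t \<in> T \<Longrightarrow> t \<cdot> b i = t \<cdot> a t i"
        unfolding b_def using orth_sum[OF T aE] by auto
    qed
    let ?v = "\<Oplus>\<^bsub>E\<^esub> i \<in> {..<n}. c i \<cdot> b i"
    have cb: "(\<lambda>i. c i \<cdot> b i) \<in> {..<n} \<rightarrow> carrier E" using b c by auto
    have gE: "generate (add_monoid E) ?H \<subseteq> carrier E"
    proof -
      have "?H \<subseteq> carrier E" using completion_carrier by auto
      then show ?thesis using M.add.generate_incl by simp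
    qed
    have v: "?v \<in> generate (add_monoid E) ?H"
      using additive_finsum[of "generate (add_monoid E) ?H" "\<lambda>x. x" "{..<n}" "\<lambda>i. c i \<cdot> b i"]
        generate_addI[where H = ?H] gE b c by (fastforce simp: Pi_def)
    have "u = ?v"
      unfolding x(2)
    proof (rule orth_sum_eqI[OF T])
      show "?v \<in> carrier E" using v gE by blast
      fix t assume t: "t \<in> T"
      have \<phi>': "\<phi> t i \<in> carrier C" "a t i \<in> carrier E" if "i < n" for i using \<phi>a(1,2)[OF t] that GE by auto
      have "t \<cdot> ?v = (\<Oplus>\<^bsub>E\<^esub> i \<in> {..<n}. t \<cdot> (c i \<cdot> b i))"
        using additive_finsum[of "carrier E" "\<lambda>x. t \<cdot> x" "{..<n}" "\<lambda>i. c i \<cdot> b i"] cb tC[OF t]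
        by (simp add: C_act_add_right)
      also have "\<dots> = (\<Oplus>\<^bsub>E\<^esub> i \<in> {..<n}. t \<cdot> (\<phi> t i \<cdot> a t i))"
      proof (rule M.finsum_cong')
        show "(\<lambda>i. t \<cdot> (\<phi> t i \<cdot> a t i)) \<in> {..<n} \<rightarrow> carrier E" using tC[OF t] \<phi>' by auto
        fix i assume "i \<in> {..<n}"
        then have i: "i < n" by simp
        have "t \<cdot> (c i \<cdot> b i) = (t \<otimes>\<^sub>C c i) \<cdot> b i" using C_act_mult[OF tC[OF t] c(1)[OF i] b(2)[OF i]] by simp
        also have "\<dots> = \<phi> t i \<cdot> (t \<cdot> b i)"
          using C_act_mult[OF tC[OF t] \<phi>'(1)[OF i] b(2)[OF i]] C_swap[OF tC[OF t] \<phi>'(1)[OF i] b(2)[OF i]] c(2)[OF i t] by simp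
        also have "\<dots> = t \<cdot> (\<phi> t i \<cdot> a t i)"
          using b(3)[OF i t] C_swap[OF tC[OF t] \<phi>'(1,2)[OF i]] by simp
        finally show "t \<cdot> (c i \<cdot> b i) = t \<cdot> (\<phi> t i \<cdot> a t i)" .
      qed simp
      also have "\<dots> = t \<cdot> x t"
      proof -
        have "(\<lambda>i. \<phi> t i \<cdot> a t i) \<in> {..<n} \<rightarrow> carrier E" using \<phi>' by auto
        then show ?thesis
          using additive_finsum[of "carrier E" "\<lambda>x. t \<cdot> x" "{..<n}" "\<lambda>i. \<phi> t i \<cdot> a t i"] tC[OF t] \<phi>a(3)[OF t]
          by (simp add: C_act_add_right)
      qed
      finally show "t \<cdot> ?v = t \<cdot> x t" .
    qed
    then show "u \<in> generate (add_monoid E) ?H" using v by simp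
  qed
qed

text \<open>Glue elements \<open>x\<close> of \<open>S\<close> along idempotents on which the annihilator of \<open>x\<close> is trivial; by maximality
  the remaining idempotents annihilate \<open>S\<close>.\<close>

lemma annihilator_attained:
  assumes S: "S \<subseteq> carrier E" "S = completion S" "S \<noteq> {}"
  shows "\<exists>x\<in>S. scalar_annihilator C E S = scalar_annihilator C E {x}"
proof -
  \<comment> \<open>The first alternative says that some \<open>x\<close> in \<open>S\<close> has no
    nonzero annihilator below \<open>\<xi>\<close>. The second collects the idempotents that kill
    \<open>S\<close>, without which \<open>B\<close> need not be dense; on these an arbitrary
    element of \<open>S\<close> is glued in.\<close>
  define B where "B = {\<xi> \<in> idem. (\<exists>x\<in>S. \<forall>c\<in>carrier C. (c \<otimes>\<^sub>C \<xi>) \<cdot> x = \<zero>\<^sub>E \<longrightarrow> c \<otimes>\<^sub>C \<xi> = \<zero>\<^sub>C) \<or> (\<forall>x\<in>S. \<xi> \<cdot> x = \<zero>\<^sub>E)}"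
  have SE: "x \<in> carrier E" if "x \<in> S" for x using that S(1) by blast
  have down: "\<beta> \<otimes>\<^sub>C \<xi> \<in> B" if \<beta>: "\<beta> \<in> idem" and \<xi>: "\<xi> \<in> B" for \<beta> \<xi>
  proof -
    have \<xi>i: "\<xi> \<in> idem" using \<xi> by (simp add: B_def)
    note c = idemD(1)[OF \<beta>] idemD(1)[OF \<xi>i]
    consider x where "x \<in> S" "\<And>c. \<lbrakk>c \<in> carrier C; (c \<otimes>\<^sub>C \<xi>) \<cdot> x = \<zero>\<^sub>E\<rbrakk> \<Longrightarrow> c \<otimes>\<^sub>C \<xi> = \<zero>\<^sub>C" | "\<forall>x\<in>S. \<xi> \<cdot> x = \<zero>\<^sub>E"
      using \<xi> by (auto simp: B_def)
    then show ?thesis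
    proof cases
      case (1 x)
      have "d \<otimes>\<^sub>C (\<beta> \<otimes>\<^sub>C \<xi>) = \<zero>\<^sub>C" if "d \<in> carrier C" "(d \<otimes>\<^sub>C (\<beta> \<otimes>\<^sub>C \<xi>)) \<cdot> x = \<zero>\<^sub>E" for d
        using 1(2)[of "d \<otimes>\<^sub>C \<beta>"] that c by (simp add: C.m_assoc)
      then show ?thesis using 1(1) idem_mult[OF \<beta> \<xi>i] unfolding B_def by blast
    next
      case 2
      then have "\<forall>x\<in>S. (\<beta> \<otimes>\<^sub>C \<xi>) \<cdot> x = \<zero>\<^sub>E" using c SE by (simp add: C_act_mult)
      then show ?thesis using idem_mult[OF \<beta> \<xi>i] unfolding B_def by blast
    qed
  qed
  have "dense B"
    unfolding dense_def
  proof (intro conjI ballI impI)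
    show "B \<subseteq> idem" by (auto simp: B_def)
    fix \<beta> assume \<beta>: "\<beta> \<in> idem" "\<forall>\<alpha>\<in>B. \<beta> \<otimes>\<^sub>C \<alpha> = \<zero>\<^sub>C"
    have \<beta>C: "\<beta> \<in> carrier C" using \<beta> by simp
    have "\<beta> \<cdot> x = \<zero>\<^sub>E" if x: "x \<in> S" for x
    proof -
      have \<beta>x: "\<beta> \<cdot> x \<in> carrier E" using \<beta>C SE[OF x] by simp
      \<comment> \<open>The support of \<open>\<beta> x\<close> lies in \<open>B\<close>, with
        \<open>x\<close> itself as witness: if \<open>c e\<close> kills \<open>x\<close>, then
        \<open>c\<close> kills \<open>\<beta> x = e \<beta> x\<close>, so that
        \<open>c e = 0\<close>.\<close>
      obtain e where e: "e \<in> idem" "e \<cdot> (\<beta> \<cdot> x) = \<beta> \<cdot> x"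
        "\<And>c. \<lbrakk>c \<in> carrier C; c \<cdot> (\<beta> \<cdot> x) = \<zero>\<^sub>E\<rbrakk> \<Longrightarrow> c \<otimes>\<^sub>C e = \<zero>\<^sub>C"
        using support[OF \<beta>x] by blast
      have eC: "e \<in> carrier C" using e by simp
      have "c \<otimes>\<^sub>C e = \<zero>\<^sub>C" if c: "c \<in> carrier C" "(c \<otimes>\<^sub>C e) \<cdot> x = \<zero>\<^sub>E" for c
      proof (rule e(3)[OF c(1)])
        have "c \<cdot> (\<beta> \<cdot> x) = (c \<otimes>\<^sub>C e) \<cdot> (\<beta> \<cdot> x)" using c eC \<beta>x e(2) by (simp add: C_act_mult)
        also have "\<dots> = \<beta> \<cdot> ((c \<otimes>\<^sub>C e) \<cdot> x)" using C_swap[of "c \<otimes>\<^sub>C e" \<beta> x] c eC \<beta>C SE[OF x] by simp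
        finally show "c \<cdot> (\<beta> \<cdot> x) = \<zero>\<^sub>E" using c(2) \<beta>C by simp
      qed
      then have "e \<in> B" using e(1) x unfolding B_def by blast
      then have "\<beta> \<otimes>\<^sub>C e = \<zero>\<^sub>C" using \<beta>(2) by blast
      then have "e \<otimes>\<^sub>C \<beta> = \<zero>\<^sub>C" using C.m_comm[OF eC \<beta>C] by simp
      then have "e \<cdot> (\<beta> \<cdot> x) = \<zero>\<^sub>E" using C_act_mult[OF eC \<beta>C SE[OF x]] SE[OF x] by simp
      then show ?thesis using e(2) by simp
    qed
    \<comment> \<open>\<open>\<beta>\<close> kills \<open>S\<close> and so belongs to
      \<open>B\<close> by the second alternative; being orthogonal to \<open>B\<close>, it satisfies
      \<open>\<beta> = \<beta> \<beta> = 0\<close>.\<close>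
    then have "\<beta> \<in> B" using \<beta>(1) by (simp add: B_def)
    then show "\<beta> = \<zero>\<^sub>C" using \<beta> idemD(2)[OF \<beta>(1)] by auto
  qed
  then obtain T where T: "T \<subseteq> B" "dense_orthogonal C T (\<lambda>t. t)" using dense_orth_refine down by blast
  have "\<forall>t\<in>T. \<exists>x\<in>S. (\<forall>c\<in>carrier C. (c \<otimes>\<^sub>C t) \<cdot> x = \<zero>\<^sub>E \<longrightarrow> c \<otimes>\<^sub>C t = \<zero>\<^sub>C) \<or> (\<forall>s\<in>S. t \<cdot> s = \<zero>\<^sub>E)"
    using T(1) S(3) unfolding B_def by blast
  then obtain x where x: "\<And>t. t \<in> T \<Longrightarrow> x t \<in> S"
    "\<And>t. t \<in> T \<Longrightarrow> (\<forall>c\<in>carrier C. (c \<otimes>\<^sub>C t) \<cdot> x t = \<zero>\<^sub>E \<longrightarrow> c \<otimes>\<^sub>C t = \<zero>\<^sub>C) \<or> (\<forall>s\<in>S. t \<cdot> s = \<zero>\<^sub>E)"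
    by metis
  have xS: "x \<in> T \<rightarrow> S" "x \<in> T \<rightarrow> carrier E" using x(1) SE by auto
  define u where "u = orth_sum E T (\<lambda>t. t) x"
  have u: "u \<in> carrier E" "\<And>t. t \<in> T \<Longrightarrow> t \<cdot> u = t \<cdot> x t" unfolding u_def using orth_sum[OF T(2) xS(2)] by auto
  have uS: "u \<in> S" using orth_sum_completion[OF S(1) T(2) xS(1)] S(2) by (simp add: u_def)
  have "c \<cdot> s = \<zero>\<^sub>E" if c: "c \<in> carrier C" "c \<cdot> u = \<zero>\<^sub>E" and s: "s \<in> S" for c s
  proof (rule dense_eqI)
    show "dense T" using T(2) by (simp add: dense_orthogonal_iff)
    fix t assume t: "t \<in> T"
    have tC: "t \<in> carrier C" using dense_orthogonal_idem[OF T(2) t] by simp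
    have sE: "s \<in> carrier E" and xt: "x t \<in> carrier E" using s SE x(1)[OF t] by auto
    have "(c \<otimes>\<^sub>C t) \<cdot> x t = t \<cdot> (c \<cdot> u)"
      using C_act_mult[OF c(1) tC xt] u(2)[OF t] C_swap[OF c(1) tC u(1)] by simp
    then have "(c \<otimes>\<^sub>C t) \<cdot> x t = \<zero>\<^sub>E" using c(2) tC by simp
    then have "c \<otimes>\<^sub>C t = \<zero>\<^sub>C \<or> t \<cdot> s = \<zero>\<^sub>E" using x(2)[OF t] c(1) s by blast
    then have "c \<cdot> (t \<cdot> s) = \<zero>\<^sub>E" using C_act_mult[OF c(1) tC sE] sE c(1) by auto
    then show "t \<cdot> (c \<cdot> s) = t \<cdot> \<zero>\<^sub>E" using C_swap[OF c(1) tC sE] tC by simp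
  qed (use c s SE in auto)
  then show ?thesis using uS by (intro bexI[of _ u]) (auto simp: scalar_annihilator_def)
qed

end

section \<open>Multiplication rings of algebras\<close>

lemma (in closed_hull) orth_sum_add:
  assumes \<xi>: "dense_orthogonal C I \<xi>" "x \<in> I \<rightarrow> carrier E" and \<chi>: "dense_orthogonal C J \<chi>" "y \<in> J \<rightarrow> carrier E"
  shows "orth_sum E I \<xi> x \<oplus>\<^sub>E orth_sum E J \<chi> y =
    orth_sum E (I \<times> J) (\<lambda>(a, b). \<xi> a \<otimes>\<^sub>C \<chi> b) (\<lambda>(a, b). x a \<oplus>\<^sub>E y b)"
proof (rule orth_sum_eqI[OF dense_orthogonal_prod[OF \<xi>(1) \<chi>(1)], symmetric])
  note u = orth_sum[OF \<xi>] and v = orth_sum[OF \<chi>]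
  show "orth_sum E I \<xi> x \<oplus>\<^sub>E orth_sum E J \<chi> y \<in> carrier E" using u v by simp
  fix p assume "p \<in> I \<times> J"
  then obtain a b where p: "p = (a, b)" "a \<in> I" "b \<in> J" by auto
  note c = idemD(1)[OF dense_orthogonal_idem[OF \<xi>(1) p(2)]] idemD(1)[OF dense_orthogonal_idem[OF \<chi>(1) p(3)]]
  have xy: "x a \<in> carrier E" "y b \<in> carrier E" using \<xi> \<chi> p by auto
  have "(\<xi> a \<otimes>\<^sub>C \<chi> b) \<cdot> orth_sum E I \<xi> x = (\<xi> a \<otimes>\<^sub>C \<chi> b) \<cdot> x a"
    using c xy u(1) u(2)[OF p(2)] C_swap[OF c(1,2)] by (simp add: C_act_mult)
  moreover have "(\<xi> a \<otimes>\<^sub>C \<chi> b) \<cdot> orth_sum E J \<chi> y = (\<xi> a \<otimes>\<^sub>C \<chi> b) \<cdot> y b"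
    using c xy v(1) v(2)[OF p(3)] by (simp add: C_act_mult)
  ultimately show "(case p of (a, b) \<Rightarrow> \<xi> a \<otimes>\<^sub>C \<chi> b) \<cdot> (orth_sum E I \<xi> x \<oplus>\<^sub>E orth_sum E J \<chi> y) =
    (case p of (a, b) \<Rightarrow> \<xi> a \<otimes>\<^sub>C \<chi> b) \<cdot> (case p of (a, b) \<Rightarrow> x a \<oplus>\<^sub>E y b)"
    using c xy u(1) v(1) p by (simp add: C_act_add_right)
qed

text \<open>Over a commutative ring the order of the factors in a right action is immaterial, which
  makes the lemmas on right modules available for algebras.\<close>

lemma right_mod_module: assumes "module F R" shows "right_mod F R"
proof -
  interpret module F R by fact
  show ?thesis
    by unfold_locales (simp_all add: smult_l_distr smult_r_distr smult_assoc1[symmetric] R.m_comm)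
qed

lemma linear_operators_simps [simp]:
  "f \<otimes>\<^bsub>linear_operators F R\<^esub> g = (\<lambda>x\<in>carrier R. g (f x))"
  "f \<oplus>\<^bsub>linear_operators F R\<^esub> g = (\<lambda>x\<in>carrier R. f x \<oplus>\<^bsub>R\<^esub> g x)"
  "\<one>\<^bsub>linear_operators F R\<^esub> = (\<lambda>x\<in>carrier R. x)"
  "\<zero>\<^bsub>linear_operators F R\<^esub> = (\<lambda>x\<in>carrier R. \<zero>\<^bsub>R\<^esub>)"
  "c \<odot>\<^bsub>linear_operators F R\<^esub> f = (\<lambda>x\<in>carrier R. c \<odot>\<^bsub>R\<^esub> f x)"
  by (simp_all add: linear_operators_def)

lemma linear_operators_iff:
  "f \<in> carrier (linear_operators F R) \<longleftrightarrow> (\<forall>x\<in>carrier R. f x \<in> carrier R) \<and> f \<in> extensional (carrier R) \<and>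
     (\<forall>x\<in>carrier R. \<forall>y\<in>carrier R. f (x \<oplus>\<^bsub>R\<^esub> y) = f x \<oplus>\<^bsub>R\<^esub> f y) \<and>
     (\<forall>a\<in>carrier F. \<forall>x\<in>carrier R. f (a \<odot>\<^bsub>R\<^esub> x) = a \<odot>\<^bsub>R\<^esub> f x)"
  by (auto simp: linear_operators_def mod_hom_def)

locale plain_algebra = nonassoc_algebra F R for F :: "('f, 'm) ring_scheme" and R :: "('f, 'a) module"
begin

lemma mult_zero [simp]:
  "x \<in> carrier R \<Longrightarrow> \<zero>\<^bsub>R\<^esub> \<otimes>\<^bsub>R\<^esub> x = \<zero>\<^bsub>R\<^esub>" "x \<in> carrier R \<Longrightarrow> x \<otimes>\<^bsub>R\<^esub> \<zero>\<^bsub>R\<^esub> = \<zero>\<^bsub>R\<^esub>"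
  using mult_add_left[of "\<zero>\<^bsub>R\<^esub>" "\<zero>\<^bsub>R\<^esub>" x] mult_add_right[of x "\<zero>\<^bsub>R\<^esub>" "\<zero>\<^bsub>R\<^esub>"]
    mult_closed[of "\<zero>\<^bsub>R\<^esub>" x] mult_closed[of x "\<zero>\<^bsub>R\<^esub>"] by (simp_all add: M.add.l_cancel_one)

text \<open>\<open>submodule\<close> asks for inverses in the additive monoid of
  \<open>linear_operators\<close>. They are computed in \<open>mod_End\<close>, which has the same
  carrier, sum and zero and is known to be a ring; there the inverse of \<open>f\<close> is its
  multiple by -1.\<close>

lemma subalgebra_operatorsI:
  assumes "S \<subseteq> carrier (linear_operators F R)" "(\<lambda>x\<in>carrier R. \<zero>\<^bsub>R\<^esub>) \<in> S"
    "\<And>f g. \<lbrakk>f \<in> S; g \<in> S\<rbrakk> \<Longrightarrow> (\<lambda>x\<in>carrier R. f x \<oplus>\<^bsub>R\<^esub> g x) \<in> S"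
    "\<And>c f. \<lbrakk>c \<in> carrier F; f \<in> S\<rbrakk> \<Longrightarrow> (\<lambda>x\<in>carrier R. c \<odot>\<^bsub>R\<^esub> f x) \<in> S"
    "\<And>f g. \<lbrakk>f \<in> S; g \<in> S\<rbrakk> \<Longrightarrow> (\<lambda>x\<in>carrier R. g (f x)) \<in> S"
  shows "nonassoc_subalgebra S F (linear_operators F R)"
proof -
  let ?L = "linear_operators F R"
  interpret RM: right_mod F R using right_mod_module[OF module_axioms] .
  interpret E: ring "mod_End F R" using mod_End_ring[OF RM.right_module_axioms] .
  have L: "inv\<^bsub>add_monoid ?L\<^esub> f = \<ominus>\<^bsub>mod_End F R\<^esub> f" for f
    by (simp add: a_inv_def m_inv_def linear_operators_def mod_End_def)
  have "inv\<^bsub>add_monoid ?L\<^esub> f \<in> S" if f: "f \<in> S" for f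
  proof -
    let ?g = "\<lambda>x\<in>carrier R. (\<ominus>\<^bsub>F\<^esub> \<one>\<^bsub>F\<^esub>) \<odot>\<^bsub>R\<^esub> f x"
    have g: "?g \<in> S" using assms(4)[OF _ f] by simp
    have C: "carrier ?L = carrier (mod_End F R)" by (simp add: linear_operators_def mod_End_def)
    have fR: "f x \<in> carrier R" if "x \<in> carrier R" for x
      using assms(1) f that by (auto simp: linear_operators_iff)
    have "?g \<oplus>\<^bsub>mod_End F R\<^esub> f = \<zero>\<^bsub>mod_End F R\<^esub>"
      unfolding mod_End_simps by (rule restrict_ext) (use fR in \<open>simp add: RM.act_neg_left M.l_neg\<close>)
    then have "\<ominus>\<^bsub>mod_End F R\<^esub> f = ?g" using E.minus_equality assms(1) f g C by blast
    then show ?thesis using g by (simp only: L)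
  qed
  then have "submodule S F ?L"
    by (intro submodule.intro subgroup.intro submodule_axioms.intro) (use assms in auto)
  then show ?thesis using assms(5) by (simp add: nonassoc_subalgebra_def)
qed

section \<open>Operators generated by multiplications and scalars\<close>

lemma left_op_linear: "x \<in> carrier R \<Longrightarrow> left_op R x \<in> carrier (linear_operators F R)"
  and right_op_linear: "x \<in> carrier R \<Longrightarrow> right_op R x \<in> carrier (linear_operators F R)"
  and scalar_op_linear: "c \<in> carrier F \<Longrightarrow> scalar_op R c \<in> carrier (linear_operators F R)"
  by (auto simp: linear_operators_iff left_op_def right_op_def scalar_op_def mult_closed mult_add_left mult_add_right
      mult_smult_left mult_smult_right smult_r_distr smult_assoc1[symmetric] R.m_comm)

lemma operators_closed:
  "(\<lambda>x\<in>carrier R. \<zero>\<^bsub>R\<^esub>) \<in> carrier (linear_operators F R)"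
  "\<lbrakk>f \<in> carrier (linear_operators F R); g \<in> carrier (linear_operators F R)\<rbrakk> \<Longrightarrow>
    (\<lambda>x\<in>carrier R. f x \<oplus>\<^bsub>R\<^esub> g x) \<in> carrier (linear_operators F R)"
  "\<lbrakk>f \<in> carrier (linear_operators F R); g \<in> carrier (linear_operators F R)\<rbrakk> \<Longrightarrow>
    (\<lambda>x\<in>carrier R. g (f x)) \<in> carrier (linear_operators F R)"
  "\<lbrakk>c \<in> carrier F; f \<in> carrier (linear_operators F R)\<rbrakk> \<Longrightarrow>
    (\<lambda>x\<in>carrier R. c \<odot>\<^bsub>R\<^esub> f x) \<in> carrier (linear_operators F R)"
  by (auto simp: linear_operators_iff M.a_ac smult_r_distr smult_assoc1[symmetric] R.m_comm)

lemma mult_algebra_linear: "mult_algebra F R \<subseteq> carrier (linear_operators F R)"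
proof -
  have "nonassoc_subalgebra (carrier (linear_operators F R)) F (linear_operators F R)"
    by (rule subalgebra_operatorsI) (use operators_closed in auto)
  then show ?thesis unfolding mult_algebra_def using left_op_linear right_op_linear by blast
qed

lemma mult_algebra_zero: "(\<lambda>x\<in>carrier R. \<zero>\<^bsub>R\<^esub>) \<in> mult_algebra F R"
proof -
  have "(\<lambda>x\<in>carrier R. \<zero>\<^bsub>R\<^esub>) = left_op R \<zero>\<^bsub>R\<^esub>" by (auto simp: left_op_def)
  then show ?thesis by (auto simp: mult_algebra_def)
qed

lemma unital_mult_ring_simps [simp]:
  "f \<otimes>\<^bsub>unital_mult_ring F R\<^esub> g = (\<lambda>x\<in>carrier R. g (f x))"
  "f \<oplus>\<^bsub>unital_mult_ring F R\<^esub> g = (\<lambda>x\<in>carrier R. f x \<oplus>\<^bsub>R\<^esub> g x)"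
  "\<one>\<^bsub>unital_mult_ring F R\<^esub> = (\<lambda>x\<in>carrier R. x)"
  "\<zero>\<^bsub>unital_mult_ring F R\<^esub> = (\<lambda>x\<in>carrier R. \<zero>\<^bsub>R\<^esub>)"
  by (simp_all add: unital_mult_ring_def Let_def)

lemma unital_mult_ring_carrier:
  "carrier (unital_mult_ring F R) = {(\<lambda>x\<in>carrier R. scalar_op R c x \<oplus>\<^bsub>R\<^esub> f x) | c f. c \<in> carrier F \<and> f \<in> mult_algebra F R}"
  by (simp add: unital_mult_ring_def Let_def)

lemma unital_mult_ring_linear: "f \<in> carrier (unital_mult_ring F R) \<Longrightarrow> f \<in> carrier (linear_operators F R)"
  using operators_closed(2)[OF scalar_op_linear] mult_algebra_linear by (auto simp: unital_mult_ring_carrier)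

lemma mult_algebra_unital: "f \<in> mult_algebra F R \<Longrightarrow> f \<in> carrier (unital_mult_ring F R)"
proof -
  assume f: "f \<in> mult_algebra F R"
  then have "f \<in> carrier (linear_operators F R)" using mult_algebra_linear by blast
  then have "f = (\<lambda>x\<in>carrier R. scalar_op R \<zero>\<^bsub>F\<^esub> x \<oplus>\<^bsub>R\<^esub> f x)"
    by (auto simp: linear_operators_iff scalar_op_def extensional_def fun_eq_iff)
  then show ?thesis unfolding unital_mult_ring_carrier using f by blast
qed

lemma left_op_unital: "x \<in> carrier R \<Longrightarrow> left_op R x \<in> carrier (unital_mult_ring F R)"
  and right_op_unital: "x \<in> carrier R \<Longrightarrow> right_op R x \<in> carrier (unital_mult_ring F R)"
  by (intro mult_algebra_unital; auto simp: mult_algebra_def)+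

lemma scalar_op_unital: "c \<in> carrier F \<Longrightarrow> scalar_op R c \<in> carrier (unital_mult_ring F R)"
proof -
  assume c: "c \<in> carrier F"
  have "scalar_op R c = (\<lambda>x\<in>carrier R. scalar_op R c x \<oplus>\<^bsub>R\<^esub> (\<lambda>x\<in>carrier R. \<zero>\<^bsub>R\<^esub>) x)"
    using c by (auto simp: scalar_op_def fun_eq_iff)
  then show ?thesis unfolding unital_mult_ring_carrier using mult_algebra_zero c by blast
qed

text \<open>The operators with property \<open>Q\<close> form a subalgebra that contains the
  multiplications, hence M(R); multiples by scalars are products with \<open>scalar_op\<close>. The
  ring property of M(R)' is part of the notion of an injective hull and is taken from there.\<close>

lemma unital_mult_ring_induct:
  assumes A: "ring (unital_mult_ring F R)" and f: "f \<in> carrier (unital_mult_ring F R)"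
    and left: "\<And>x. x \<in> carrier R \<Longrightarrow> Q (left_op R x)" and right: "\<And>x. x \<in> carrier R \<Longrightarrow> Q (right_op R x)"
    and scalar: "\<And>c. c \<in> carrier F \<Longrightarrow> Q (scalar_op R c)"
    and add: "\<And>f g. \<lbrakk>f \<in> carrier (unital_mult_ring F R); g \<in> carrier (unital_mult_ring F R); Q f; Q g\<rbrakk> \<Longrightarrow>
      Q (f \<oplus>\<^bsub>unital_mult_ring F R\<^esub> g)"
    and mult: "\<And>f g. \<lbrakk>f \<in> carrier (unital_mult_ring F R); g \<in> carrier (unital_mult_ring F R); Q f; Q g\<rbrakk> \<Longrightarrow>
      Q (f \<otimes>\<^bsub>unital_mult_ring F R\<^esub> g)"
  shows "Q f"
proof -
  let ?A = "unital_mult_ring F R"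
  interpret A: ring ?A by fact
  let ?S = "{f \<in> carrier ?A. Q f}"
  have "nonassoc_subalgebra ?S F (linear_operators F R)"
  proof (rule subalgebra_operatorsI)
    show "?S \<subseteq> carrier (linear_operators F R)" using unital_mult_ring_linear by blast
    have "(\<lambda>x\<in>carrier R. \<zero>\<^bsub>R\<^esub>) = left_op R \<zero>\<^bsub>R\<^esub>" by (auto simp: left_op_def)
    then show "(\<lambda>x\<in>carrier R. \<zero>\<^bsub>R\<^esub>) \<in> ?S" using left left_op_unital by simp
    show "(\<lambda>x\<in>carrier R. f x \<oplus>\<^bsub>R\<^esub> g x) \<in> ?S" if "f \<in> ?S" "g \<in> ?S" for f g
      using that add[of f g] A.a_closed[of f g] by simp
    show mem: "(\<lambda>x\<in>carrier R. g (f x)) \<in> ?S" if "f \<in> ?S" "g \<in> ?S" for f g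
      using that mult[of f g] A.m_closed[of f g] by simp
    show "(\<lambda>x\<in>carrier R. c \<odot>\<^bsub>R\<^esub> f x) \<in> ?S" if c: "c \<in> carrier F" and f: "f \<in> ?S" for c f
    proof -
      have fR: "f x \<in> carrier R" if "x \<in> carrier R" for x
        using f that unital_mult_ring_linear by (auto simp: linear_operators_iff)
      have sc: "scalar_op R c \<in> ?S" using scalar[OF c] scalar_op_unital[OF c] by blast
      have "(\<lambda>x\<in>carrier R. scalar_op R c (f x)) \<in> ?S" by (rule mem[OF f sc])
      moreover have "(\<lambda>x\<in>carrier R. scalar_op R c (f x)) = (\<lambda>x\<in>carrier R. c \<odot>\<^bsub>R\<^esub> f x)"
        by (rule restrict_ext) (simp add: scalar_op_def fR)
      ultimately show ?thesis by simp
    qed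
  qed
  then have *: "mult_algebra F R \<subseteq> ?S"
    unfolding mult_algebra_def using left right left_op_unital right_op_unital by blast
  obtain c g where cg: "c \<in> carrier F" "g \<in> mult_algebra F R" "f = scalar_op R c \<oplus>\<^bsub>?A\<^esub> g"
    using f unfolding unital_mult_ring_carrier by auto
  then show ?thesis using add[of "scalar_op R c" g] * scalar scalar_op_unital by auto
qed

section \<open>Ideals, semiprimeness and subalgebras\<close>

lemma ideal_square_zero_iff:
  assumes "I \<subseteq> carrier R"
  shows "ideal_square R I \<noteq> {\<zero>\<^bsub>R\<^esub>} \<longleftrightarrow> (\<exists>x\<in>I. \<exists>y\<in>I. x \<otimes>\<^bsub>R\<^esub> y \<noteq> \<zero>\<^bsub>R\<^esub>)"
proof
  let ?H = "{x \<otimes>\<^bsub>R\<^esub> y | x y. x \<in> I \<and> y \<in> I}"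
  have zero: "\<zero>\<^bsub>R\<^esub> \<in> ideal_square R I" using generate.one[of "add_monoid R"] by (simp add: ideal_square_def)
  assume "ideal_square R I \<noteq> {\<zero>\<^bsub>R\<^esub>}"
  then obtain z where z: "z \<in> ideal_square R I" "z \<noteq> \<zero>\<^bsub>R\<^esub>" using zero by blast
  show "\<exists>x\<in>I. \<exists>y\<in>I. x \<otimes>\<^bsub>R\<^esub> y \<noteq> \<zero>\<^bsub>R\<^esub>"
  proof (rule ccontr)
    assume "\<not> ?thesis"
    then have H: "h = \<zero>\<^bsub>R\<^esub>" if "h \<in> ?H" for h using that by blast
    have "z \<in> generate (add_monoid R) ?H" using z(1) by (simp add: ideal_square_def)
    then have "z = \<zero>\<^bsub>R\<^esub>"
    proof (induction rule: generate.induct)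
      case (inv h) then show ?case using H[of h] M.minus_equality[of "\<zero>\<^bsub>R\<^esub>" "\<zero>\<^bsub>R\<^esub>"] by (simp add: a_inv_def)
    qed (use H in auto)
    then show False using z(2) by simp
  qed
next
  assume "\<exists>x\<in>I. \<exists>y\<in>I. x \<otimes>\<^bsub>R\<^esub> y \<noteq> \<zero>\<^bsub>R\<^esub>"
  then obtain x y where "x \<in> I" "y \<in> I" "x \<otimes>\<^bsub>R\<^esub> y \<noteq> \<zero>\<^bsub>R\<^esub>" by blast
  moreover from this have "x \<otimes>\<^bsub>R\<^esub> y \<in> ideal_square R I" unfolding ideal_square_def by (intro generate.incl) blast
  ultimately show "ideal_square R I \<noteq> {\<zero>\<^bsub>R\<^esub>}" by blast
qed

lemma algebra_idealD:
  assumes "algebra_ideal I F R"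
  shows "I \<subseteq> carrier R" "\<zero>\<^bsub>R\<^esub> \<in> I" "\<lbrakk>x \<in> I; y \<in> I\<rbrakk> \<Longrightarrow> x \<oplus>\<^bsub>R\<^esub> y \<in> I" "\<lbrakk>c \<in> carrier F; x \<in> I\<rbrakk> \<Longrightarrow> c \<odot>\<^bsub>R\<^esub> x \<in> I"
    "\<lbrakk>x \<in> I; y \<in> carrier R\<rbrakk> \<Longrightarrow> x \<otimes>\<^bsub>R\<^esub> y \<in> I" "\<lbrakk>x \<in> I; y \<in> carrier R\<rbrakk> \<Longrightarrow> y \<otimes>\<^bsub>R\<^esub> x \<in> I"
proof -
  interpret RM: right_mod F R using right_mod_module[OF module_axioms] .
  have I: "submodule I F R" using assms by (simp add: algebra_ideal_def)
  show "I \<subseteq> carrier R" "\<zero>\<^bsub>R\<^esub> \<in> I" "\<lbrakk>x \<in> I; y \<in> I\<rbrakk> \<Longrightarrow> x \<oplus>\<^bsub>R\<^esub> y \<in> I" "\<lbrakk>c \<in> carrier F; x \<in> I\<rbrakk> \<Longrightarrow> c \<odot>\<^bsub>R\<^esub> x \<in> I"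
    using RM.SubD(2,3)[OF I] RM.SubD(4)[OF I, of x y] RM.SubD(6)[OF I, of c x] by simp_all
  show "\<lbrakk>x \<in> I; y \<in> carrier R\<rbrakk> \<Longrightarrow> x \<otimes>\<^bsub>R\<^esub> y \<in> I" "\<lbrakk>x \<in> I; y \<in> carrier R\<rbrakk> \<Longrightarrow> y \<otimes>\<^bsub>R\<^esub> x \<in> I"
    using assms by (auto simp: algebra_ideal_def)
qed

lemma semiprime_algebra_iff:
  "semiprime_algebra F R \<longleftrightarrow> (\<forall>I. algebra_ideal I F R \<and> I \<noteq> {\<zero>\<^bsub>R\<^esub>} \<longrightarrow> (\<exists>x\<in>I. \<exists>y\<in>I. x \<otimes>\<^bsub>R\<^esub> y \<noteq> \<zero>\<^bsub>R\<^esub>))"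
  using nonassoc_algebra_axioms algebra_idealD(1) ideal_square_zero_iff by (auto simp: semiprime_algebra_def)

lemma subalgebra_nonassoc_algebra:
  assumes "nonassoc_subalgebra S F R" shows "nonassoc_algebra F (R\<lparr>carrier := S\<rparr>)"
proof -
  interpret RM: right_mod F R using right_mod_module[OF module_axioms] .
  have S: "submodule S F R" and m: "\<And>x y. \<lbrakk>x \<in> S; y \<in> S\<rbrakk> \<Longrightarrow> x \<otimes>\<^bsub>R\<^esub> y \<in> S" using assms
    by (auto simp: nonassoc_subalgebra_def)
  note D = RM.SubD[OF S]
  have ab: "abelian_group (R\<lparr>carrier := S\<rparr>)" by (rule RM.Sub_abelian_group[OF S]) simp_all
  show ?thesis
    by (intro nonassoc_algebra.intro moduleI nonassoc_algebra_axioms.intro R.is_cring ab)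
      (use D m in \<open>auto simp: smult_l_distr smult_r_distr smult_assoc1 mult_add_left mult_add_right mult_smult_left mult_smult_right\<close>)
qed

end

section \<open>Injective hulls of multiplication modules\<close>

lemma injective_hullD:
  assumes "injective_hull A M E"
  shows "right_mod A E" "submodule (carrier M) A E" "injective_module A E"
    "\<lbrakk>x \<in> carrier M; y \<in> carrier M\<rbrakk> \<Longrightarrow> x \<oplus>\<^bsub>E\<^esub> y = x \<oplus>\<^bsub>M\<^esub> y" "\<zero>\<^bsub>M\<^esub> = \<zero>\<^bsub>E\<^esub>"
    "\<lbrakk>a \<in> carrier A; x \<in> carrier M\<rbrakk> \<Longrightarrow> a \<odot>\<^bsub>E\<^esub> x = a \<odot>\<^bsub>M\<^esub> x"
    "\<lbrakk>submodule K A E; K \<noteq> {\<zero>\<^bsub>E\<^esub>}\<rbrakk> \<Longrightarrow> K \<inter> carrier M \<noteq> {\<zero>\<^bsub>E\<^esub>}" "ring A"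
proof -
  have M: "right_module A M" and E: "injective_module A E" and S: "submodule (carrier M) A E"
    and add: "\<And>x y. \<lbrakk>x \<in> carrier M; y \<in> carrier M\<rbrakk> \<Longrightarrow> x \<oplus>\<^bsub>E\<^esub> y = x \<oplus>\<^bsub>M\<^esub> y"
    using assms by (auto simp: injective_hull_def)
  interpret M: right_module A M by fact
  interpret E: right_mod A E using injective_module_right_mod[OF E] .
  show "right_mod A E" "submodule (carrier M) A E" "injective_module A E" "ring A"
    by (fact E.right_mod_axioms S E M.A.ring_axioms)+
  show "\<lbrakk>x \<in> carrier M; y \<in> carrier M\<rbrakk> \<Longrightarrow> x \<oplus>\<^bsub>E\<^esub> y = x \<oplus>\<^bsub>M\<^esub> y" by (rule add)
  have z: "\<zero>\<^bsub>M\<^esub> \<in> carrier E" using E.SubD(1)[OF S] by simp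
  have "\<zero>\<^bsub>M\<^esub> \<oplus>\<^bsub>E\<^esub> \<zero>\<^bsub>M\<^esub> = \<zero>\<^bsub>M\<^esub>" using add[of "\<zero>\<^bsub>M\<^esub>" "\<zero>\<^bsub>M\<^esub>"] by simp
  then show "\<zero>\<^bsub>M\<^esub> = \<zero>\<^bsub>E\<^esub>" using z by (simp add: E.M.add.l_cancel_one)
  show "\<lbrakk>a \<in> carrier A; x \<in> carrier M\<rbrakk> \<Longrightarrow> a \<odot>\<^bsub>E\<^esub> x = a \<odot>\<^bsub>M\<^esub> x"
    "\<lbrakk>submodule K A E; K \<noteq> {\<zero>\<^bsub>E\<^esub>}\<rbrakk> \<Longrightarrow> K \<inter> carrier M \<noteq> {\<zero>\<^bsub>E\<^esub>}"
    using assms by (auto simp: injective_hull_def)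
qed

lemma mult_module_simps [simp]:
  "carrier (mult_module R) = carrier R" "x \<oplus>\<^bsub>mult_module R\<^esub> y = x \<oplus>\<^bsub>R\<^esub> y" "\<zero>\<^bsub>mult_module R\<^esub> = \<zero>\<^bsub>R\<^esub>"
  "f \<odot>\<^bsub>mult_module R\<^esub> x = f x"
  by (simp_all add: mult_module_def)

text \<open>Applied both to \<open>R\<close> over \<open>F\<close> and to the central closure over
  its centroid. Multiplications and scalars belong to M(R)', so a submodule of the hull inside
  \<open>R\<close> is an ideal, and semiprimeness of the algebra becomes a statement on products in
  submodules.\<close>

lemma semiprime_hull_of_algebra:
  fixes F :: "('f, 'm) ring_scheme" and R :: "('f, 'a) module"
  assumes R: "semiprime_algebra F R" and E: "injective_hull (unital_mult_ring F R) (mult_module R) E"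
  shows "semiprime_hull (unital_mult_ring F R) E (carrier R) (mult R) (left_op R) (right_op R) (scalar_op R ` carrier F)"
proof -
  let ?A = "unital_mult_ring F R"
  interpret R: plain_algebra F R using R by (simp add: semiprime_algebra_def plain_algebra_def)
  interpret RM: right_mod F R using right_mod_module[OF R.module_axioms] .
  note D = injective_hullD[OF E, simplified]
  interpret E: right_mod ?A E using D(1) .
  show ?thesis
  proof (intro semiprime_hull.intro semiprime_hull_axioms.intro D(1-3))
    fix K assume K: "submodule K ?A E" "K \<subseteq> carrier R" "K \<noteq> {\<zero>\<^bsub>E\<^esub>}"
    note KD = E.SubD[OF K(1)]
    have "submodule K F R"
    proof (rule RM.SubI)
      fix c x assume "c \<in> carrier F" "x \<in> K"
      then show "c \<odot>\<^bsub>R\<^esub> x \<in> K" using KD(6)[of "scalar_op R c" x] K(2) R.scalar_op_unital D(6)[of "scalar_op R c" x]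
        by (auto simp: scalar_op_def)
    next
      fix x y assume "x \<in> K" "y \<in> K"
      then show "x \<oplus>\<^bsub>R\<^esub> y \<in> K" using KD(4)[of x y] D(4)[of x y] K(2) by (simp add: subset_iff)
    qed (use K(2) KD(3) D(5) in auto)
    moreover have "x \<otimes>\<^bsub>R\<^esub> y \<in> K \<and> y \<otimes>\<^bsub>R\<^esub> x \<in> K" if "x \<in> K" "y \<in> carrier R" for x y
      using KD(6)[OF R.left_op_unital[OF that(2)] that(1)] KD(6)[OF R.right_op_unital[OF that(2)] that(1)]
        D(6)[OF R.left_op_unital[OF that(2)], of x] D(6)[OF R.right_op_unital[OF that(2)], of x] that K(2)
      by (auto simp: left_op_def right_op_def)
    ultimately have ideal: "algebra_ideal K F R" by (simp add: algebra_ideal_def)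
    have "algebra_ideal K F R \<and> K \<noteq> {\<zero>\<^bsub>R\<^esub>} \<longrightarrow> (\<exists>x\<in>K. \<exists>y\<in>K. x \<otimes>\<^bsub>R\<^esub> y \<noteq> \<zero>\<^bsub>R\<^esub>)"
      using R unfolding R.semiprime_algebra_iff by (rule spec)
    then show "\<exists>x\<in>K. \<exists>y\<in>K. x \<otimes>\<^bsub>R\<^esub> y \<noteq> \<zero>\<^bsub>E\<^esub>" using ideal K(3) by (simp only: D(5) simp_thms)
  next
    fix S
    assume *: "left_op R ` carrier R \<subseteq> S" "right_op R ` carrier R \<subseteq> S" "scalar_op R ` carrier F \<subseteq> S"
      "\<And>a b. \<lbrakk>a \<in> carrier ?A; b \<in> carrier ?A; a \<in> S; b \<in> S\<rbrakk> \<Longrightarrow> a \<oplus>\<^bsub>?A\<^esub> b \<in> S"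
      "\<And>a b. \<lbrakk>a \<in> carrier ?A; b \<in> carrier ?A; a \<in> S; b \<in> S\<rbrakk> \<Longrightarrow> a \<otimes>\<^bsub>?A\<^esub> b \<in> S"
    show "carrier ?A \<subseteq> S"
    proof
      fix a assume "a \<in> carrier ?A"
      then show "a \<in> S"
      proof (rule R.unital_mult_ring_induct[where Q = "\<lambda>a. a \<in> S", OF D(8)])
        fix f g assume fg: "f \<in> carrier ?A" "g \<in> carrier ?A" "f \<in> S" "g \<in> S"
        show "f \<oplus>\<^bsub>?A\<^esub> g \<in> S" using *(4)[OF fg] .
        show "f \<otimes>\<^bsub>?A\<^esub> g \<in> S" using *(5)[OF fg] .
      qed (use *(1-3) in blast)+
    qed
  next
    fix z a assume z: "z \<in> scalar_op R ` carrier F" and "a \<in> carrier ?A"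
    then have "a \<in> carrier (linear_operators F R)" using R.unital_mult_ring_linear by blast
    then show "z \<otimes>\<^bsub>?A\<^esub> a = a \<otimes>\<^bsub>?A\<^esub> z" using z unfolding R.unital_mult_ring_simps
      by (intro restrict_ext) (auto simp: linear_operators_iff scalar_op_def)
  next
    show "left_op R x \<odot>\<^bsub>E\<^esub> y = x \<otimes>\<^bsub>R\<^esub> y" "right_op R y \<odot>\<^bsub>E\<^esub> x = x \<otimes>\<^bsub>R\<^esub> y" if "x \<in> carrier R" "y \<in> carrier R" for x y
      using that R.left_op_unital R.right_op_unital by (simp_all add: D(6)) (simp_all add: left_op_def right_op_def)
  qed (use D(7) R.left_op_unital R.right_op_unital R.scalar_op_unital in auto)
qed

text \<open>Finite sums are taken relative to a record, and the central closure and its hull are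
  different records with the same addition on the smaller carrier.\<close>

lemma finsum_eq_of_subset:
  assumes "abelian_group P" "abelian_group E" "carrier P \<subseteq> carrier E" "\<zero>\<^bsub>P\<^esub> = \<zero>\<^bsub>E\<^esub>"
    "\<And>x y. \<lbrakk>x \<in> carrier P; y \<in> carrier P\<rbrakk> \<Longrightarrow> x \<oplus>\<^bsub>E\<^esub> y = x \<oplus>\<^bsub>P\<^esub> y" "finite S" "f \<in> S \<rightarrow> carrier P"
  shows "finsum P f S = finsum E f S"
proof -
  interpret P: abelian_group P by fact
  interpret E: abelian_group E by fact
  show ?thesis using assms(6,7)
  proof (induction S)
    case (insert i S)
    then have "f \<in> S \<rightarrow> carrier P" "f i \<in> carrier P" by auto
    moreover from this have "f \<in> S \<rightarrow> carrier E" "f i \<in> carrier E" using assms(3) by auto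
    moreover have "f i \<oplus>\<^bsub>E\<^esub> finsum P f S = f i \<oplus>\<^bsub>P\<^esub> finsum P f S"
      using assms(5) calculation(1,2) by (simp add: P.finsum_closed)
    ultimately show ?case using insert by simp
  qed (use assms(4) in simp)
qed

section \<open>The central closure of an algebra and its orthogonal completion\<close>

locale central_closure_setting =
  fixes F :: "'f ring" and R :: "('f, 'a) module" and IR :: "('a \<Rightarrow> 'a, 'a) module"
  assumes semiprime_R: "semiprime_algebra F R"
    and hull_R: "injective_hull (unital_mult_ring F R) (mult_module R) IR"
begin

sublocale R: plain_algebra F R
  using semiprime_R by (simp add: semiprime_algebra_def plain_algebra_def)

sublocale S: semiprime_hull "unital_mult_ring F R" IR "carrier R" "mult R" "left_op R" "right_op R" "scalar_op R ` carrier F"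
  by (rule semiprime_hull_of_algebra[OF semiprime_R hull_R])

abbreviation P :: "('a \<Rightarrow> 'a, 'a) module" where "P \<equiv> central_closure F R IR"

abbreviation CM :: "('a \<Rightarrow> 'a) ring" where "CM \<equiv> martindale_centroid F R IR"

lemma CM_eq: "CM = S.centroid"
  by (simp add: martindale_centroid_def quasi_injective_hull_def S.centroid_def S.qhull_def)

lemmas CM_simps = S.centroid_simps[folded CM_eq]

lemma hull_carrier: "carrier (quasi_injective_hull F R IR) = S.qhull"
  by (simp add: quasi_injective_hull_def S.qhull_def)

lemma P_simps [simp]:
  "carrier P = S.qhull" "x \<otimes>\<^bsub>P\<^esub> y = S.cmul x y" "x \<oplus>\<^bsub>P\<^esub> y = x \<oplus>\<^bsub>IR\<^esub> y" "\<zero>\<^bsub>P\<^esub> = \<zero>\<^bsub>IR\<^esub>" "\<phi> \<odot>\<^bsub>P\<^esub> x = \<phi> x"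
  by (simp_all add: central_closure_def hull_carrier central_closure_mult_def S.cmul_def Let_def CM_eq)

lemma P_algebra: "nonassoc_algebra CM P"
proof -
  have ab: "abelian_group P" by (rule S.Sub_abelian_group[OF S.Sub_qhull]) simp_all
  show ?thesis
    unfolding CM_eq
    by (intro nonassoc_algebra.intro moduleI nonassoc_algebra_axioms.intro S.centroid_cring ab)
      (auto simp: S.centroid_simps S.centroid_D S.cmul_closed S.cmul_add_left S.cmul_add_right S.cmul_smult_left S.cmul_smult_right)
qed

sublocale PA: plain_algebra CM P
  by (simp add: plain_algebra_def P_algebra)

lemma R_P: "x \<in> carrier R \<Longrightarrow> x \<in> S.qhull"
  by (rule S.R_qhull)

lemma P_ideal_Sub:
  assumes K: "K \<subseteq> S.qhull" "\<zero>\<^bsub>IR\<^esub> \<in> K" "\<And>x y. \<lbrakk>x \<in> K; y \<in> K\<rbrakk> \<Longrightarrow> x \<oplus>\<^bsub>IR\<^esub> y \<in> K"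
    "\<And>c x. \<lbrakk>c \<in> carrier CM; x \<in> K\<rbrakk> \<Longrightarrow> c x \<in> K" "\<And>p x. \<lbrakk>p \<in> S.qhull; x \<in> K\<rbrakk> \<Longrightarrow> S.cmul p x \<in> K \<and> S.cmul x p \<in> K"
  shows "S.Sub K"
  by (rule S.qhull_ideal_Sub) (use K R_P in \<open>auto simp: CM_eq\<close>)

lemma P_semiprime: "semiprime_algebra CM P"
  unfolding PA.semiprime_algebra_iff
proof (intro allI impI)
  fix I assume "algebra_ideal I CM P \<and> I \<noteq> {\<zero>\<^bsub>P\<^esub>}"
  then have I: "algebra_ideal I CM P" "I \<noteq> {\<zero>\<^bsub>IR\<^esub>}" by auto
  note D = PA.algebra_idealD[OF I(1), simplified]
  have "S.Sub I" by (rule P_ideal_Sub) (use D in auto)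
  then show "\<exists>x\<in>I. \<exists>y\<in>I. x \<otimes>\<^bsub>P\<^esub> y \<noteq> \<zero>\<^bsub>P\<^esub>" using S.qhull_semiprime[of I] D(1) I(2) by simp
qed

lemma scalar_op_P: "c \<in> carrier CM \<Longrightarrow> scalar_op P c = c"
  by (auto simp: CM_eq S.centroid_iff scalar_op_def extensional_def fun_eq_iff)

lemma base_scalar_eq: "base_scalar F R IR c = (\<lambda>x\<in>S.qhull. scalar_op R c \<odot>\<^bsub>IR\<^esub> x)"
  by (simp add: base_scalar_def hull_carrier)

lemma base_scalar_closed: "c \<in> carrier F \<Longrightarrow> base_scalar F R IR c \<in> carrier CM"
  unfolding base_scalar_eq CM_eq by (rule S.Z_centroid) simp

lemma base_scalar_R: "\<lbrakk>c \<in> carrier F; x \<in> carrier R\<rbrakk> \<Longrightarrow> base_scalar F R IR c x = c \<odot>\<^bsub>R\<^esub> x"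
  using injective_hullD(6)[OF hull_R, of "scalar_op R c" x] R.scalar_op_unital R_P
  by (simp add: base_scalar_eq) (simp add: scalar_op_def)

lemma base_scalar_hom:
  assumes c: "c \<in> carrier F" and d: "d \<in> carrier F"
  shows "base_scalar F R IR (c \<oplus>\<^bsub>F\<^esub> d) = base_scalar F R IR c \<oplus>\<^bsub>CM\<^esub> base_scalar F R IR d"
    "base_scalar F R IR (c \<otimes>\<^bsub>F\<^esub> d) = base_scalar F R IR c \<otimes>\<^bsub>CM\<^esub> base_scalar F R IR d"
    "base_scalar F R IR \<one>\<^bsub>F\<^esub> = \<one>\<^bsub>CM\<^esub>"
proof -
  let ?A = "unital_mult_ring F R"
  note s = R.scalar_op_unital[OF c] R.scalar_op_unital[OF d]
  have add: "scalar_op R (c \<oplus>\<^bsub>F\<^esub> d) = scalar_op R c \<oplus>\<^bsub>?A\<^esub> scalar_op R d"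
    unfolding R.unital_mult_ring_simps unfolding scalar_op_def
    by (rule restrict_ext) (use c d in \<open>simp add: R.smult_l_distr\<close>)
  \<comment> \<open>The factors are exchanged because the product of operators applies the left
    factor first, whereas the product in \<open>CM\<close> applies the right one first.\<close>
  have mult: "scalar_op R (c \<otimes>\<^bsub>F\<^esub> d) = scalar_op R d \<otimes>\<^bsub>?A\<^esub> scalar_op R c"
    unfolding R.unital_mult_ring_simps unfolding scalar_op_def
    by (rule restrict_ext) (use c d in \<open>simp add: R.smult_assoc1\<close>)
  have one: "scalar_op R \<one>\<^bsub>F\<^esub> = \<one>\<^bsub>?A\<^esub>"
    unfolding R.unital_mult_ring_simps unfolding scalar_op_def
    by (rule restrict_ext) simp
  show "base_scalar F R IR (c \<oplus>\<^bsub>F\<^esub> d) = base_scalar F R IR c \<oplus>\<^bsub>CM\<^esub> base_scalar F R IR d"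
    unfolding CM_eq S.centroid_simps base_scalar_eq
    by (rule restrict_ext) (use s S.act_add_left[OF s] S.qhull_carrier in \<open>simp add: add del: R.unital_mult_ring_simps\<close>)
  show "base_scalar F R IR (c \<otimes>\<^bsub>F\<^esub> d) = base_scalar F R IR c \<otimes>\<^bsub>CM\<^esub> base_scalar F R IR d"
    unfolding CM_eq S.centroid_simps base_scalar_eq
    by (rule restrict_ext) (use s S.act_assoc[OF s(2,1)] S.qhull_carrier S.qhull_act in \<open>simp add: mult del: R.unital_mult_ring_simps\<close>)
  show "base_scalar F R IR \<one>\<^bsub>F\<^esub> = \<one>\<^bsub>CM\<^esub>"
    unfolding CM_eq S.centroid_simps base_scalar_eq
    by (rule restrict_ext) (use S.act_one S.qhull_carrier in \<open>simp add: one del: R.unital_mult_ring_simps\<close>)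
qed

end

section \<open>The hull of the central closure over its own multiplication ring\<close>

locale orth_completion_setting = central_closure_setting F R IR
  for F :: "'f ring" and R :: "('f, 'a) module" and IR :: "('a \<Rightarrow> 'a, 'a) module" +
  fixes IP :: "('a \<Rightarrow> 'a, 'a) module"
  assumes hull_P: "injective_hull (unital_mult_ring CM P) (mult_module P) IP"
begin

abbreviation MP :: "('a \<Rightarrow> 'a) ring" where "MP \<equiv> unital_mult_ring CM P"

lemmas hull_PD = injective_hullD[OF hull_P, unfolded mult_module_simps P_simps]

lemma hull_P_smult: "\<lbrakk>c \<in> carrier CM; x \<in> S.qhull\<rbrakk> \<Longrightarrow> c \<odot>\<^bsub>IP\<^esub> x = c x"
  using hull_PD(6)[of c x] PA.scalar_op_unital[of c] by (simp add: scalar_op_P)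

lemma semiprime_hull_P:
  "semiprime_hull MP IP (carrier P) (mult P) (left_op P) (right_op P) (carrier CM)"
proof -
  have "scalar_op P ` carrier CM = carrier CM" using scalar_op_P by simp
  then show ?thesis using semiprime_hull_of_algebra[OF P_semiprime hull_P] by simp
qed

text \<open>\<open>Hom_C\<close> links the two hulls. A homomorphism over \<open>MP\<close> from
  \<open>N\<close> to \<open>P\<close> commutes with \<open>CM\<close> and with multiplications by
  \<open>R\<close>, so it is one over the multiplication ring of \<open>R\<close>, extends to
  \<open>IR\<close>, and comes from an element of the centroid.\<close>

sublocale T: closed_hull MP IP "carrier P" "mult P" "left_op P" "right_op P" CM
proof (intro closed_hull.intro semiprime_hull_P closed_hull_axioms.intro)
  interpret T0: semiprime_hull MP IP "carrier P" "mult P" "left_op P" "right_op P" "carrier CM"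
    by (rule semiprime_hull_P)
  show "cring CM" using S.centroid_cring by (simp add: CM_eq)
  fix c d assume c: "c \<in> carrier CM" and d: "d \<in> carrier CM"
  show "c \<oplus>\<^bsub>CM\<^esub> d = c \<oplus>\<^bsub>MP\<^esub> d" unfolding CM_simps PA.unital_mult_ring_simps by simp
  \<comment> \<open>The two sides compose in opposite orders; commutativity of the centroid
    reconciles them.\<close>
  show "c \<otimes>\<^bsub>CM\<^esub> d = c \<otimes>\<^bsub>MP\<^esub> d" unfolding CM_simps PA.unital_mult_ring_simps P_simps
    by (rule restrict_ext) (use S.centroid_commute c d in \<open>simp add: CM_eq\<close>)
next
  show "\<zero>\<^bsub>CM\<^esub> = \<zero>\<^bsub>MP\<^esub>" "\<one>\<^bsub>CM\<^esub> = \<one>\<^bsub>MP\<^esub>"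
    unfolding CM_simps PA.unital_mult_ring_simps by simp_all
next
  interpret T0: semiprime_hull MP IP "carrier P" "mult P" "left_op P" "right_op P" "carrier CM"
    by (rule semiprime_hull_P)
  fix N f assume N: "T0.Sub N" "N \<subseteq> carrier P" and f: "f \<in> T0.Hom N" "\<And>x. x \<in> N \<Longrightarrow> f x \<in> carrier P"
  have NP: "x \<in> S.qhull" if "x \<in> N" for x using N(2) that by auto
  have fP: "f x \<in> S.qhull" if "x \<in> N" for x using f(2) that by simp
  have cN: "c \<odot>\<^bsub>IP\<^esub> x \<in> N" "c \<odot>\<^bsub>IP\<^esub> x = c x" "f (c \<odot>\<^bsub>IP\<^esub> x) = c \<odot>\<^bsub>IP\<^esub> f x" "c \<odot>\<^bsub>IP\<^esub> f x = c (f x)"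
    if "c \<in> carrier CM" "x \<in> N" for c x
    using T0.SubD(6)[OF N(1) T0.Z_closed[OF that(1)] that(2)] T0.HomD(3)[OF f(1) T0.Z_closed[OF that(1)] that(2)]
      hull_P_smult[OF that(1) NP[OF that(2)]] hull_P_smult[OF that(1) fP[OF that(2)]] by simp_all
  have lN: "left_op P p \<odot>\<^bsub>IP\<^esub> x \<in> N" "left_op P p \<odot>\<^bsub>IP\<^esub> x = S.cmul p x" "f (left_op P p \<odot>\<^bsub>IP\<^esub> x) = left_op P p \<odot>\<^bsub>IP\<^esub> f x"
      "left_op P p \<odot>\<^bsub>IP\<^esub> f x = S.cmul p (f x)"
      "right_op P p \<odot>\<^bsub>IP\<^esub> x \<in> N" "right_op P p \<odot>\<^bsub>IP\<^esub> x = S.cmul x p" "f (right_op P p \<odot>\<^bsub>IP\<^esub> x) = right_op P p \<odot>\<^bsub>IP\<^esub> f x"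
      "right_op P p \<odot>\<^bsub>IP\<^esub> f x = S.cmul (f x) p"
    if "p \<in> S.qhull" "x \<in> N" for p x
  proof -
    have p: "p \<in> carrier P" and x: "x \<in> carrier P" "f x \<in> carrier P" using that NP fP by simp_all
    note op = T0.l_closed[OF p] T0.r_closed[OF p]
    show "left_op P p \<odot>\<^bsub>IP\<^esub> x \<in> N" "right_op P p \<odot>\<^bsub>IP\<^esub> x \<in> N"
      using T0.SubD(6)[OF N(1) op(1) that(2)] T0.SubD(6)[OF N(1) op(2) that(2)] .
    show "f (left_op P p \<odot>\<^bsub>IP\<^esub> x) = left_op P p \<odot>\<^bsub>IP\<^esub> f x" "f (right_op P p \<odot>\<^bsub>IP\<^esub> x) = right_op P p \<odot>\<^bsub>IP\<^esub> f x"
      using T0.HomD(3)[OF f(1) op(1) that(2)] T0.HomD(3)[OF f(1) op(2) that(2)] .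
    show "left_op P p \<odot>\<^bsub>IP\<^esub> x = S.cmul p x" "left_op P p \<odot>\<^bsub>IP\<^esub> f x = S.cmul p (f x)"
      "right_op P p \<odot>\<^bsub>IP\<^esub> x = S.cmul x p" "right_op P p \<odot>\<^bsub>IP\<^esub> f x = S.cmul (f x) p"
      using T0.l_act[OF p x(1)] T0.l_act[OF p x(2)] T0.r_act[OF x(1) p] T0.r_act[OF x(2) p] unfolding P_simps .
  qed
  have aN: "x \<oplus>\<^bsub>IP\<^esub> y = x \<oplus>\<^bsub>IR\<^esub> y" if "x \<in> S.qhull" "y \<in> S.qhull" for x y using hull_PD(4) that by blast
  \<comment> \<open>\<open>N\<close> is given as a submodule of \<open>IP\<close>. The operators of
    \<open>MP\<close> act on it by the operations of the central closure, which makes it a submodule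
    of \<open>IR\<close> too.\<close>
  have N': "S.Sub N"
  proof (rule P_ideal_Sub)
    show "N \<subseteq> S.qhull" using NP by blast
    show "\<zero>\<^bsub>IR\<^esub> \<in> N" using T0.SubD(3)[OF N(1)] hull_PD(5) by simp
    show "x \<oplus>\<^bsub>IR\<^esub> y \<in> N" if "x \<in> N" "y \<in> N" for x y using T0.SubD(4)[OF N(1) that] aN NP that by simp
    show "c x \<in> N" if "c \<in> carrier CM" "x \<in> N" for c x using cN(1,2)[OF that] by simp
    show "S.cmul p x \<in> N \<and> S.cmul x p \<in> N" if "p \<in> S.qhull" "x \<in> N" for p x using lN(1,2,5,6)[OF that] by simp
  qed
  have "f \<in> S.Hom N"
  proof (rule S.qhull_Hom[OF N'])
    show "f (x \<oplus>\<^bsub>IR\<^esub> y) = f x \<oplus>\<^bsub>IR\<^esub> f y" if "x \<in> N" "y \<in> N" for x y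
      using T0.HomD(2)[OF f(1) that] aN NP fP that by simp
    show "f (c x) = c (f x)" if "c \<in> carrier S.centroid" "x \<in> N" for c x
      using cN(2-4)[of c x] that by (simp add: CM_eq)
    show "f (S.cmul a x) = S.cmul a (f x)" "f (S.cmul x a) = S.cmul (f x) a" if "a \<in> carrier R" "x \<in> N" for a x
      using lN(2-4,6-8)[OF R_P[OF that(1)] that(2)] by simp_all
  qed (use NP fP in auto)
  then obtain c where c: "c \<in> carrier S.centroid" "\<forall>x\<in>N. c x = f x" using S.Hom_centroid[OF N' _ , of f] NP by blast
  then have "\<forall>x\<in>N. f x = c \<odot>\<^bsub>IP\<^esub> x" using cN(2)[of c] by (simp add: CM_eq)
  then show "\<exists>c\<in>carrier CM. \<forall>x\<in>N. f x = c \<odot>\<^bsub>IP\<^esub> x" using c(1) by (auto simp: CM_eq)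
next
  fix c assume c: "c \<in> carrier CM" "\<And>x. x \<in> carrier P \<Longrightarrow> c \<odot>\<^bsub>IP\<^esub> x = \<zero>\<^bsub>IP\<^esub>"
  then have "c x = \<zero>\<^bsub>IR\<^esub>" if "x \<in> S.qhull" for x using hull_P_smult[OF c(1) that] that hull_PD(5) by simp
  moreover have "c \<in> extensional S.qhull" using c(1) by (simp add: CM_eq S.centroid_iff)
  ultimately show "c = \<zero>\<^bsub>CM\<^esub>" unfolding CM_simps by (auto simp: extensional_def fun_eq_iff)
qed

end

context orth_completion_setting
begin

declare P_simps(1) [simp del]

lemmas carrier_P = P_simps(1)

section \<open>The completion of the central closure as an algebra over \<open>CM\<close>\<close>

abbreviation OPA :: "('a \<Rightarrow> 'a, 'a) module" where "OPA \<equiv> orth_completion_algebra CM P IP"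

lemma OPA_simps [simp]:
  "carrier OPA = T.OP" "x \<oplus>\<^bsub>OPA\<^esub> y = x \<oplus>\<^bsub>IP\<^esub> y" "\<zero>\<^bsub>OPA\<^esub> = \<zero>\<^bsub>IP\<^esub>" "c \<odot>\<^bsub>OPA\<^esub> x = c \<odot>\<^bsub>IP\<^esub> x"
  using T.orth_completion_eq[OF T.P_sub] by (simp_all add: orth_completion_algebra_def)

lemma OPA_mult: "\<lbrakk>u \<in> T.OP; v \<in> T.OP\<rbrakk> \<Longrightarrow> u \<otimes>\<^bsub>OPA\<^esub> v = T.omul u v"
  using T.orth_completion_mult_eq[of P] by (simp add: orth_completion_algebra_def)

lemma OPA_algebra: "nonassoc_algebra CM OPA"
proof -
  note D = T.SubD[OF T.Sub_OP]
  have ab: "abelian_group OPA" by (rule T.Sub_abelian_group[OF T.Sub_OP]) simp_all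
  show ?thesis
    by (intro nonassoc_algebra.intro moduleI nonassoc_algebra_axioms.intro T.C_cring ab)
      (use D T.OP_smult in \<open>simp_all add: OPA_mult T.omul_closed T.omul_add_left T.omul_add_right T.omul_smult
        T.C_act_add T.C_act_add_right T.C_act_mult\<close>)
qed

sublocale OA: plain_algebra CM OPA
  by (simp add: plain_algebra_def OPA_algebra)

text \<open>Products with elements of \<open>P\<close> already make an ideal a submodule of
  \<open>IP\<close>; a nonzero one therefore meets \<open>P\<close>, where semiprimeness is
  known.\<close>

lemma OPA_semiprime: "semiprime_algebra CM OPA"
  unfolding OA.semiprime_algebra_iff
proof (intro allI impI)
  fix I assume "algebra_ideal I CM OPA \<and> I \<noteq> {\<zero>\<^bsub>OPA\<^esub>}"
  then have I: "algebra_ideal I CM OPA" "I \<noteq> {\<zero>\<^bsub>IP\<^esub>}" by auto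
  note D = OA.algebra_idealD[OF I(1), unfolded OPA_simps]
  have IO: "x \<in> T.OP" if "x \<in> I" for x using D(1) that by blast
  have "T.Sub I"
  proof (rule T.OP_ideal_Sub)
    fix p x assume p: "p \<in> carrier P" and x: "x \<in> I"
    have pO: "p \<in> T.OP" using T.P_OP[OF p] .
    show "left_op P p \<odot>\<^bsub>IP\<^esub> x \<in> I"
      using D(6)[OF x pO] OPA_mult[OF pO IO[OF x]] T.omul_P(1)[OF p IO[OF x]] by simp
    show "right_op P p \<odot>\<^bsub>IP\<^esub> x \<in> I"
      using D(5)[OF x pO] OPA_mult[OF IO[OF x] pO] T.omul_P(2)[OF p IO[OF x]] by simp
  next
    show "I \<subseteq> carrier IP" using T.completion_carrier[OF IO] by blast
  qed (use D in auto)
  from T.OP_semiprime[OF this I(2)] obtain x y where xy: "x \<in> I" "y \<in> I" "T.omul x y \<noteq> \<zero>\<^bsub>IP\<^esub>" by blast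
  then have "x \<otimes>\<^bsub>OPA\<^esub> y \<noteq> \<zero>\<^bsub>OPA\<^esub>" using OPA_mult[OF IO IO] by simp
  then show "\<exists>x\<in>I. \<exists>y\<in>I. x \<otimes>\<^bsub>OPA\<^esub> y \<noteq> \<zero>\<^bsub>OPA\<^esub>" using xy by blast
qed

lemma OPA_orth_sums:
  assumes \<xi>: "dense_orthogonal CM I \<xi>" "x \<in> I \<rightarrow> carrier P" and \<chi>: "dense_orthogonal CM J \<chi>" "y \<in> J \<rightarrow> carrier P"
  shows "orth_sum IP I \<xi> x \<oplus>\<^bsub>OPA\<^esub> orth_sum IP J \<chi> y =
      orth_sum IP (I \<times> J) (\<lambda>(a, b). \<xi> a \<otimes>\<^bsub>CM\<^esub> \<chi> b) (\<lambda>(a, b). x a \<oplus>\<^bsub>P\<^esub> y b)" (is ?add)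
    and "orth_sum IP I \<xi> x \<otimes>\<^bsub>OPA\<^esub> orth_sum IP J \<chi> y =
      orth_sum IP (I \<times> J) (\<lambda>(a, b). \<xi> a \<otimes>\<^bsub>CM\<^esub> \<chi> b) (\<lambda>(a, b). x a \<otimes>\<^bsub>P\<^esub> y b)" (is ?mult)
proof -
  have xE: "x \<in> I \<rightarrow> carrier IP" and yE: "y \<in> J \<rightarrow> carrier IP" using \<xi> \<chi> T.P_sub by blast+
  have "orth_sum IP I \<xi> x \<oplus>\<^bsub>IP\<^esub> orth_sum IP J \<chi> y =
      orth_sum IP (I \<times> J) (\<lambda>(a, b). \<xi> a \<otimes>\<^bsub>CM\<^esub> \<chi> b) (\<lambda>(a, b). x a \<oplus>\<^bsub>IP\<^esub> y b)"
    using T.orth_sum_add[OF \<xi>(1) xE \<chi>(1) yE] .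
  also have "\<dots> = orth_sum IP (I \<times> J) (\<lambda>(a, b). \<xi> a \<otimes>\<^bsub>CM\<^esub> \<chi> b) (\<lambda>(a, b). x a \<oplus>\<^bsub>P\<^esub> y b)"
  proof (rule orth_sum_cong)
    fix p assume "p \<in> I \<times> J"
    then have "x (fst p) \<in> S.qhull" "y (snd p) \<in> S.qhull" using \<xi>(2) \<chi>(2) by (auto simp: carrier_P)
    then show "(case p of (a, b) \<Rightarrow> x a \<oplus>\<^bsub>IP\<^esub> y b) = (case p of (a, b) \<Rightarrow> x a \<oplus>\<^bsub>P\<^esub> y b)"
      using hull_PD(4) by (simp add: case_prod_unfold)
  qed
  finally show ?add by simp
  show ?mult
    using T.omul_orth_sum[OF \<xi> \<chi>] OPA_mult[OF T.orth_sum_completion[OF T.P_sub \<xi>] T.orth_sum_completion[OF T.P_sub \<chi>]] by simp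
qed

section \<open>Complete invariance and endomorphisms of the completion\<close>

lemma OP_invariant: "f \<in> T.Hom (carrier IP) \<Longrightarrow> u \<in> T.OP \<Longrightarrow> f u \<in> T.OP"
proof -
  assume f: "f \<in> T.Hom (carrier IP)" and u: "u \<in> T.OP"
  have "f \<in> T.Hom T.OP" by (rule T.Hom_restrict[OF f]) (use T.completion_carrier in blast)
  then show "f u \<in> T.OP" using T.Hom_OP[of f] T.OP_smult u by auto
qed

lemma End_MP_subset: "carrier (mod_End MP (IP\<lparr>carrier := T.OP\<rparr>)) \<subseteq> {scalar_op OPA \<phi> | \<phi>. \<phi> \<in> carrier CM}"
proof
  fix f assume f: "f \<in> carrier (mod_End MP (IP\<lparr>carrier := T.OP\<rparr>))"
  then have ext: "f \<in> extensional T.OP" by (simp add: mod_End_iff)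
  have "f \<in> T.Hom T.OP" by (rule T.HomI) (use f T.completion_carrier in \<open>auto simp: mod_End_iff\<close>)
  then obtain c where c: "c \<in> carrier CM" "\<forall>u\<in>T.OP. f u = c \<odot>\<^bsub>IP\<^esub> u" using T.Hom_OP by blast
  then have "f = scalar_op OPA c" using ext by (auto simp: scalar_op_def extensional_def fun_eq_iff)
  then show "f \<in> {scalar_op OPA \<phi> | \<phi>. \<phi> \<in> carrier CM}" using c(1) by blast
qed

lemma scalar_op_End_MOP:
  assumes \<phi>: "\<phi> \<in> carrier CM"
  shows "scalar_op OPA \<phi> \<in> carrier (mod_End (unital_mult_ring CM OPA) (mult_module OPA))"
proof -
  have l: "r x \<in> T.OP" "r (\<phi> \<odot>\<^bsub>IP\<^esub> x) = \<phi> \<odot>\<^bsub>IP\<^esub> r x" if "r \<in> carrier (unital_mult_ring CM OPA)" "x \<in> T.OP" for r x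
    using OA.unital_mult_ring_linear[OF that(1)] that(2) \<phi> by (auto simp: linear_operators_iff)
  show ?thesis
    unfolding mod_End_iff mult_module_simps OPA_simps
  proof (intro conjI ballI)
    show "scalar_op OPA \<phi> \<in> extensional T.OP" by (simp add: scalar_op_def)
    show "scalar_op OPA \<phi> x \<in> T.OP" if "x \<in> T.OP" for x using that T.OP_smult[OF \<phi>] by (simp add: scalar_op_def)
    show "scalar_op OPA \<phi> (x \<oplus>\<^bsub>IP\<^esub> y) = scalar_op OPA \<phi> x \<oplus>\<^bsub>IP\<^esub> scalar_op OPA \<phi> y" if "x \<in> T.OP" "y \<in> T.OP" for x y
      using that T.SubD(4)[OF T.Sub_OP that] T.C_act_add_right[OF \<phi>] T.completion_carrier by (simp add: scalar_op_def)
    show "scalar_op OPA \<phi> (r x) = r (scalar_op OPA \<phi> x)" if "r \<in> carrier (unital_mult_ring CM OPA)" "x \<in> T.OP" for r x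
      using l[OF that] that(2) by (simp add: scalar_op_def)
  qed
qed

text \<open>Among the operators of the completion are the multiplications by elements
  \<open>p\<close> of \<open>P\<close>, which coincide there with the actions of
  \<open>left_op P p\<close> and \<open>right_op P p\<close>. So linearity over them includes
  linearity over the generators of \<open>MP\<close>.\<close>

lemma End_MOP_subset:
  "carrier (mod_End (unital_mult_ring CM OPA) (mult_module OPA)) \<subseteq> carrier (mod_End MP (IP\<lparr>carrier := T.OP\<rparr>))"
proof
  let ?MOP = "unital_mult_ring CM OPA"
  fix f assume f: "f \<in> carrier (mod_End ?MOP (mult_module OPA))"
  have fO: "f x \<in> T.OP" if "x \<in> T.OP" for x using f that by (simp add: mod_End_iff)
  have lin: "f (r x) = r (f x)" if "r \<in> carrier ?MOP" "x \<in> T.OP" for r x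
    using f that by (simp add: mod_End_iff)
  have "\<forall>x\<in>T.OP. f (a \<odot>\<^bsub>IP\<^esub> x) = a \<odot>\<^bsub>IP\<^esub> f x" if "a \<in> carrier MP" for a
    using that
  proof (rule T.A_induct)
    fix p assume p: "p \<in> carrier P"
    have pO: "p \<in> carrier OPA" using T.P_OP[OF p] by simp
    show "\<forall>x\<in>T.OP. f (left_op P p \<odot>\<^bsub>IP\<^esub> x) = left_op P p \<odot>\<^bsub>IP\<^esub> f x"
    proof
      fix x assume x: "x \<in> T.OP"
      show "f (left_op P p \<odot>\<^bsub>IP\<^esub> x) = left_op P p \<odot>\<^bsub>IP\<^esub> f x"
        using lin[OF OA.left_op_unital[OF pO] x] x fO[OF x] OPA_mult[OF T.P_OP[OF p]] T.omul_P(1)[OF p]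
        by (simp add: left_op_def[of OPA])
    qed
    show "\<forall>x\<in>T.OP. f (right_op P p \<odot>\<^bsub>IP\<^esub> x) = right_op P p \<odot>\<^bsub>IP\<^esub> f x"
    proof
      fix x assume x: "x \<in> T.OP"
      show "f (right_op P p \<odot>\<^bsub>IP\<^esub> x) = right_op P p \<odot>\<^bsub>IP\<^esub> f x"
        using lin[OF OA.right_op_unital[OF pO] x] x fO[OF x] OPA_mult[OF _ T.P_OP[OF p]] T.omul_P(2)[OF p]
        by (simp add: right_op_def[of OPA])
    qed
  next
    fix c assume c: "c \<in> carrier CM"
    show "\<forall>x\<in>T.OP. f (c \<odot>\<^bsub>IP\<^esub> x) = c \<odot>\<^bsub>IP\<^esub> f x"
      using lin[OF OA.scalar_op_unital[OF c]] fO by (simp add: scalar_op_def)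
  next
    fix a b assume ab: "a \<in> carrier MP" "b \<in> carrier MP" "\<forall>x\<in>T.OP. f (a \<odot>\<^bsub>IP\<^esub> x) = a \<odot>\<^bsub>IP\<^esub> f x"
      "\<forall>x\<in>T.OP. f (b \<odot>\<^bsub>IP\<^esub> x) = b \<odot>\<^bsub>IP\<^esub> f x"
    note act = T.SubD(6)[OF T.Sub_OP]
    have fadd: "f (x \<oplus>\<^bsub>IP\<^esub> y) = f x \<oplus>\<^bsub>IP\<^esub> f y" if "x \<in> T.OP" "y \<in> T.OP" for x y
      using f that by (simp add: mod_End_iff)
    show "\<forall>x\<in>T.OP. f ((a \<oplus>\<^bsub>MP\<^esub> b) \<odot>\<^bsub>IP\<^esub> x) = (a \<oplus>\<^bsub>MP\<^esub> b) \<odot>\<^bsub>IP\<^esub> f x"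
      using ab act fadd fO T.act_add_left[OF ab(1,2)] T.completion_carrier[where S = "carrier P"]
      by (simp del: PA.unital_mult_ring_simps)
    show "\<forall>x\<in>T.OP. f ((a \<otimes>\<^bsub>MP\<^esub> b) \<odot>\<^bsub>IP\<^esub> x) = (a \<otimes>\<^bsub>MP\<^esub> b) \<odot>\<^bsub>IP\<^esub> f x"
      using ab act fO T.act_assoc[OF ab(1,2)] T.completion_carrier[where S = "carrier P"]
      by (simp del: PA.unital_mult_ring_simps)
  qed
  then show "f \<in> carrier (mod_End MP (IP\<lparr>carrier := T.OP\<rparr>))" using f by (simp add: mod_End_iff)
qed

text \<open>The three sets are compared in a cycle: endomorphisms over \<open>MP\<close> are
  scalars, scalars commute with all operators of the completion, and endomorphisms over these
  operators are linear over \<open>MP\<close>.\<close>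

lemma End_OP:
  "carrier (mod_End MP (IP\<lparr>carrier := T.OP\<rparr>)) = carrier (mod_End (unital_mult_ring CM OPA) (mult_module OPA))" (is "?X = ?Y")
  "carrier (mod_End (unital_mult_ring CM OPA) (mult_module OPA)) = {scalar_op OPA \<phi> | \<phi>. \<phi> \<in> carrier CM}" (is "_ = ?Z")
proof -
  have "?Z \<subseteq> ?Y"
  proof
    fix f assume "f \<in> ?Z"
    then obtain \<phi> where "\<phi> \<in> carrier CM" "f = scalar_op OPA \<phi>" by (elim CollectE exE conjE)
    then show "f \<in> ?Y" using scalar_op_End_MOP by (simp only:)
  qed
  note sub = this End_MP_subset End_MOP_subset
  show "?X = ?Y" by (rule equalityI[OF subset_trans[OF sub(2,1)] sub(3)])
  show "?Y = ?Z" by (rule equalityI[OF subset_trans[OF sub(3,2)] sub(1)])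
qed

section \<open>The completion of \<open>R\<close> as an algebra over \<open>F\<close>\<close>

abbreviation OPF :: "('f, 'a) module" where "OPF \<equiv> pullback_scalars (base_scalar F R IR) OPA"

lemma OPF_simps [simp]:
  "carrier OPF = T.OP" "x \<oplus>\<^bsub>OPF\<^esub> y = x \<oplus>\<^bsub>IP\<^esub> y" "\<zero>\<^bsub>OPF\<^esub> = \<zero>\<^bsub>IP\<^esub>"
  "c \<odot>\<^bsub>OPF\<^esub> x = base_scalar F R IR c \<odot>\<^bsub>IP\<^esub> x" "x \<otimes>\<^bsub>OPF\<^esub> y = x \<otimes>\<^bsub>OPA\<^esub> y"
  using OPA_simps by (simp_all add: pullback_scalars_def)

lemma OPF_algebra: "nonassoc_algebra F OPF"
proof -
  note D = T.SubD[OF T.Sub_OP]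
  have ab: "abelian_group OPF" by (rule T.Sub_abelian_group[OF T.Sub_OP]) simp_all
  show ?thesis
    by (intro nonassoc_algebra.intro moduleI nonassoc_algebra_axioms.intro R.R.is_cring ab)
      (use D T.OP_smult base_scalar_closed in \<open>simp_all add: base_scalar_hom base_scalar_hom(3)[OF R.R.one_closed R.R.one_closed] OPA_mult T.omul_closed T.omul_add_left
        T.omul_add_right T.omul_smult T.C_act_add T.C_act_add_right T.C_act_mult\<close>)
qed

abbreviation OR :: "'a set" where "OR \<equiv> T.completion (carrier R)"

lemma R_sub_P: "carrier R \<subseteq> carrier P"
  using R_P by (auto simp: carrier_P)

lemma R_sub_IP: "carrier R \<subseteq> carrier IP"
  using R_sub_P T.P_sub by blast

lemma R_hull: "\<lbrakk>x \<in> carrier R; y \<in> carrier R\<rbrakk> \<Longrightarrow> x \<oplus>\<^bsub>IP\<^esub> y = x \<oplus>\<^bsub>R\<^esub> y" "\<zero>\<^bsub>R\<^esub> = \<zero>\<^bsub>IP\<^esub>"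
  using hull_PD(4,5) R_P injective_hullD(4,5)[OF hull_R] by simp_all

lemma OR_zero: "\<zero>\<^bsub>IP\<^esub> \<in> OR"
  using T.completion_incl[OF R_sub_IP] R_hull(2) R.M.zero_closed by auto

lemma OR_add: "\<lbrakk>u \<in> OR; v \<in> OR\<rbrakk> \<Longrightarrow> u \<oplus>\<^bsub>IP\<^esub> v \<in> OR"
  by (rule T.completion_add[OF R_sub_IP]) (simp_all add: R_hull(1))

lemma OR_smult: "\<lbrakk>c \<in> carrier F; u \<in> OR\<rbrakk> \<Longrightarrow> base_scalar F R IR c \<odot>\<^bsub>IP\<^esub> u \<in> OR"
  by (rule T.completion_act[OF R_sub_IP])
    (simp_all add: hull_P_smult base_scalar_closed R_P base_scalar_R T.Z_closed)

lemma OR_sub: "OR \<subseteq> T.OP"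
  using T.completion_mono[OF R_sub_P] .

lemma OR_mult: "\<lbrakk>u \<in> OR; v \<in> OR\<rbrakk> \<Longrightarrow> T.omul u v \<in> OR"
  by (rule T.completion_omul[OF R_sub_P]) (simp_all add: S.cmul_R R.mult_closed)

sublocale OF: plain_algebra F OPF
  by (simp add: plain_algebra_def OPF_algebra)

lemma OR_subalgebra: "nonassoc_subalgebra OR F OPF"
proof -
  interpret OFM: right_mod F OPF using right_mod_module[OF OF.module_axioms] .
  have "submodule OR F OPF"
    by (rule OFM.SubI) (use OR_sub OR_zero OR_add OR_smult in auto)
  moreover have "x \<otimes>\<^bsub>OPF\<^esub> y \<in> OR" if "x \<in> OR" "y \<in> OR" for x y
  proof -
    have "x \<in> T.OP" "y \<in> T.OP" using OR_sub that by auto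
    then show ?thesis using OPA_mult OR_mult that by simp
  qed
  ultimately show ?thesis by (simp add: nonassoc_subalgebra_def)
qed

text \<open>\<open>R\<close> spans \<open>P\<close> over \<open>CM\<close>; in this form it is the
  hypothesis \<open>span\<close> of \<open>span_semiprime\<close>.\<close>

lemma P_span:
  assumes "\<zero>\<^bsub>IP\<^esub> \<in> S" "\<And>c a. \<lbrakk>c \<in> carrier CM; a \<in> carrier R\<rbrakk> \<Longrightarrow> c \<odot>\<^bsub>IP\<^esub> a \<in> S"
    "\<And>x y. \<lbrakk>x \<in> carrier P; y \<in> carrier P; x \<in> S; y \<in> S\<rbrakk> \<Longrightarrow> x \<oplus>\<^bsub>IP\<^esub> y \<in> S"
  shows "carrier P \<subseteq> S"
proof
  fix p assume "p \<in> carrier P"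
  then have "p \<in> S.qhull" by (simp add: carrier_P)
  then show "p \<in> S"
  proof (induction rule: S.qhull_induct)
    case zero then show ?case using assms(1) hull_PD(5) by simp
  next
    case (gen c a) then show ?case using assms(2)[of c a] hull_P_smult[of c a] R_P by (simp add: CM_eq)
  next
    case (add x y) then show ?case using assms(3)[of x y] hull_PD(4)[of x y] by (simp add: carrier_P)
  qed
qed

text \<open>An ideal of \<open>OR\<close> is a module over \<open>F\<close> only. As
  \<open>OR\<close> contains \<open>R\<close>, the ideal is closed under products with
  \<open>R\<close>, and \<open>span_semiprime\<close> applies with \<open>R\<close> as spanning
  set.\<close>

lemma OR_semiprime: "semiprime_algebra F (OPF\<lparr>carrier := OR\<rparr>)"
proof -
  interpret O: plain_algebra F "OPF\<lparr>carrier := OR\<rparr>"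
    using OF.subalgebra_nonassoc_algebra[OF OR_subalgebra] by (simp add: plain_algebra_def)
  show ?thesis
    unfolding O.semiprime_algebra_iff
  proof (intro allI impI)
    fix I assume "algebra_ideal I F (OPF\<lparr>carrier := OR\<rparr>) \<and> I \<noteq> {\<zero>\<^bsub>OPF\<lparr>carrier := OR\<rparr>\<^esub>}"
    then have I: "algebra_ideal I F (OPF\<lparr>carrier := OR\<rparr>)" "I \<noteq> {\<zero>\<^bsub>IP\<^esub>}" by auto
    note D = O.algebra_idealD[OF I(1), simplified]
    have IO: "x \<in> T.OP" if "x \<in> I" for x using D(1) OR_sub that by blast
    have RO: "a \<in> OR" "a \<in> T.OP" if "a \<in> carrier R" for a
      using T.completion_incl[OF R_sub_IP] OR_sub that by blast+
    obtain x y where xy: "x \<in> I" "y \<in> I" "T.omul x y \<noteq> \<zero>\<^bsub>IP\<^esub>"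
    proof -
      have "\<exists>x\<in>I. \<exists>y\<in>I. T.omul x y \<noteq> \<zero>\<^bsub>IP\<^esub>"
      proof (rule T.span_semiprime[OF P_span R_sub_P])
        show "I \<subseteq> T.OP" using IO by blast
        show "T.omul a u \<in> I" "T.omul u a \<in> I" if "a \<in> carrier R" "u \<in> I" for a u
          using D(5,6)[OF that(2) RO(1)[OF that(1)]] OPA_mult RO(2)[OF that(1)] IO[OF that(2)] by simp_all
      qed (use I(2) D(2) in auto)
      then show ?thesis using that by blast
    qed
    then have "x \<otimes>\<^bsub>OPF\<lparr>carrier := OR\<rparr>\<^esub> y \<noteq> \<zero>\<^bsub>OPF\<lparr>carrier := OR\<rparr>\<^esub>" using OPA_mult IO by simp
    then show "\<exists>x\<in>I. \<exists>y\<in>I. x \<otimes>\<^bsub>OPF\<lparr>carrier := OR\<rparr>\<^esub> y \<noteq> \<zero>\<^bsub>OPF\<lparr>carrier := OR\<rparr>\<^esub>" using xy by blast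
  qed
qed

lemma finsum_P:
  assumes "\<phi> \<in> {..<n::nat} \<rightarrow> carrier CM" "a \<in> {..<n} \<rightarrow> carrier R"
  shows "(\<Oplus>\<^bsub>P\<^esub> i \<in> {..<n}. \<phi> i \<odot>\<^bsub>P\<^esub> a i) = (\<Oplus>\<^bsub>IP\<^esub> i \<in> {..<n}. \<phi> i \<odot>\<^bsub>IP\<^esub> a i)"
proof -
  have *: "\<phi> i \<in> carrier CM" "a i \<in> S.qhull" if "i < n" for i using assms that R_P by auto
  have "(\<Oplus>\<^bsub>P\<^esub> i \<in> {..<n}. \<phi> i \<odot>\<^bsub>P\<^esub> a i) = (\<Oplus>\<^bsub>IP\<^esub> i \<in> {..<n}. \<phi> i \<odot>\<^bsub>P\<^esub> a i)"
    by (rule finsum_eq_of_subset[OF PA.M.abelian_group_axioms T.M.abelian_group_axioms])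
      (use * T.P_sub hull_PD(4,5) S.centroid_D(1) in \<open>auto simp: CM_eq carrier_P\<close>)
  also have "\<dots> = (\<Oplus>\<^bsub>IP\<^esub> i \<in> {..<n}. \<phi> i \<odot>\<^bsub>IP\<^esub> a i)"
    by (rule T.M.finsum_cong') (use * hull_P_smult T.P_smult T.P_sub in \<open>auto simp: carrier_P\<close>)
  finally show ?thesis .
qed

end

text \<open>The equality in 2) uses index sets in the type of the elements of \<open>CM\<close>,
  since a set comprehension cannot range over all types; sums over an arbitrary index type are
  covered by the membership that follows it. The subgroup generated in 5) is \<open>CM O(R)\<close>,
  because the multiples by scalars include the negatives. In 6) the empty set is excluded: as
  \<open>CM\<close> is nonzero, it is its own completion, and it contains no
  \<open>x\<close>.\<close>

theorem proposition2p4: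
  fixes F :: "'f ring" and R :: "('f, 'a) module"
    and IR P IP OP :: "('a \<Rightarrow> 'a, 'a) module"
    and CM :: "('a \<Rightarrow> 'a) ring"
    and MP MOP :: "('a \<Rightarrow> 'a) ring"
    and OS :: "'a set \<Rightarrow> 'a set"
    and OPF :: "('f, 'a) module"
  assumes R: "semiprime_algebra F R" "carrier R \<noteq> {\<zero>\<^bsub>R\<^esub>}"
    and IR: "injective_hull (unital_mult_ring F R) (mult_module R) IR"
    and CM: "CM = martindale_centroid F R IR"
    and P: "P = central_closure F R IR"
    and MP: "MP = unital_mult_ring CM P"
    and IP: "injective_hull MP (mult_module P) IP"
    and OS: "OS = orth_completion CM IP"
    and OP: "OP = orth_completion_algebra CM P IP"
    and MOP: "MOP = unital_mult_ring CM OP"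
    and OPF: "OPF = pullback_scalars (base_scalar F R IR) OP"
  shows
    \<comment> \<open>1)\<close>
    "carrier IP = OS (carrier IP) \<and> orth_complete CM IP (carrier IP)
    \<comment> \<open>2)\<close>
    \<and> (\<forall>S \<subseteq> carrier IP.
          OS S = OS (OS S)
        \<and> OS S = {orth_sum IP I \<xi> x | (I :: ('a \<Rightarrow> 'a) set) \<xi> x.
                    dense_orthogonal CM I \<xi> \<and> x \<in> I \<rightarrow> S}
        \<and> (\<forall>(I :: 'i set) \<xi> x. dense_orthogonal CM I \<xi> \<and> x \<in> I \<rightarrow> S \<longrightarrow> orth_sum IP I \<xi> x \<in> OS S))
    \<comment> \<open>3)\<close>
    \<and> semiprime_algebra CM OP
    \<and> (\<forall>(I :: 'i set) \<xi> x (J :: 'j set) \<chi> y.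
          dense_orthogonal CM I \<xi> \<and> x \<in> I \<rightarrow> carrier P \<and>
          dense_orthogonal CM J \<chi> \<and> y \<in> J \<rightarrow> carrier P \<longrightarrow>
            dense_orthogonal CM (I \<times> J) (\<lambda>(a, b). \<xi> a \<otimes>\<^bsub>CM\<^esub> \<chi> b)
          \<and> orth_sum IP I \<xi> x \<oplus>\<^bsub>OP\<^esub> orth_sum IP J \<chi> y =
              orth_sum IP (I \<times> J) (\<lambda>(a, b). \<xi> a \<otimes>\<^bsub>CM\<^esub> \<chi> b) (\<lambda>(a, b). x a \<oplus>\<^bsub>P\<^esub> y b)
          \<and> orth_sum IP I \<xi> x \<otimes>\<^bsub>OP\<^esub> orth_sum IP J \<chi> y =
              orth_sum IP (I \<times> J) (\<lambda>(a, b). \<xi> a \<otimes>\<^bsub>CM\<^esub> \<chi> b) (\<lambda>(a, b). x a \<otimes>\<^bsub>P\<^esub> y b))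
    \<comment> \<open>4)\<close>
    \<and> submodule (carrier OP) MP IP
    \<and> (\<forall>f \<in> carrier (mod_End MP IP). f ` carrier OP \<subseteq> carrier OP)
    \<and> carrier (mod_End MP (IP\<lparr>carrier := carrier OP\<rparr>)) = carrier (mod_End MOP (mult_module OP))
    \<and> carrier (mod_End MOP (mult_module OP)) = {scalar_op OP \<phi> | \<phi>. \<phi> \<in> carrier CM}
    \<comment> \<open>5)\<close>
    \<and> nonassoc_subalgebra (OS (carrier R)) F OPF
    \<and> semiprime_algebra F (OPF\<lparr>carrier := OS (carrier R)\<rparr>)
    \<and> ((\<exists>n::nat. n \<ge> 1 \<and> (\<forall>p \<in> carrier P. \<exists>\<phi> a. \<phi> \<in> {..<n} \<rightarrow> carrier CM \<and> a \<in> {..<n} \<rightarrow> carrier R \<and>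
            p = (\<Oplus>\<^bsub>P\<^esub> i \<in> {..<n}. \<phi> i \<odot>\<^bsub>P\<^esub> a i))) \<longrightarrow>
        carrier OP = generate (add_monoid IP) {\<phi> \<odot>\<^bsub>IP\<^esub> x | \<phi> x. \<phi> \<in> carrier CM \<and> x \<in> OS (carrier R)})
    \<comment> \<open>6)\<close>
    \<and> (\<forall>S \<subseteq> carrier IP. S = OS S \<and> S \<noteq> {} \<longrightarrow>
        (\<exists>x\<in>S. scalar_annihilator CM IP S = scalar_annihilator CM IP {x}))"
proof -
  interpret Q: orth_completion_setting F R IR IP
    using R IR IP unfolding MP P CM
    by (intro orth_completion_setting.intro orth_completion_setting_axioms.intro central_closure_setting.intro)
  have OS_eq: "OS S = Q.T.completion S" if "S \<subseteq> carrier IP" for S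
    using Q.T.orth_completion_eq[OF that] by (simp add: OS CM)
  have completion_sub: "Q.T.completion S \<subseteq> carrier IP" for S using Q.T.completion_carrier by blast
  have OP_carrier: "carrier OP = Q.T.OP" using Q.OPA_simps(1) by (simp add: OP CM P)
  have OR: "OS (carrier R) = Q.OR" using OS_eq[OF Q.R_sub_IP] .
  show ?thesis
  proof (intro conjI)
    show "carrier IP = OS (carrier IP)" using OS_eq[of "carrier IP"] Q.T.completion_carrier_eq by simp
    show "orth_complete CM IP (carrier IP)"
      using Q.T.orth_complete_completion[of "carrier IP"] Q.T.completion_carrier_eq by (simp add: CM)
    show "\<forall>S \<subseteq> carrier IP. OS S = OS (OS S)
        \<and> OS S = {orth_sum IP I \<xi> x | (I :: ('a \<Rightarrow> 'a) set) \<xi> x. dense_orthogonal CM I \<xi> \<and> x \<in> I \<rightarrow> S}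
        \<and> (\<forall>(I :: 'i set) \<xi> x. dense_orthogonal CM I \<xi> \<and> x \<in> I \<rightarrow> S \<longrightarrow> orth_sum IP I \<xi> x \<in> OS S)"
    proof (intro allI impI conjI)
      fix S assume S: "S \<subseteq> carrier IP"
      show "OS S = OS (OS S)" using OS_eq[OF S] OS_eq[OF completion_sub, of S] Q.T.completion_idem[OF S] by simp
      show "OS S = {orth_sum IP I \<xi> x | (I :: ('a \<Rightarrow> 'a) set) \<xi> x. dense_orthogonal CM I \<xi> \<and> x \<in> I \<rightarrow> S}"
        unfolding OS_eq[OF S] CM by (rule Q.T.completion_eq_orth_sums[OF S])
      fix I :: "'i set" and \<xi> x assume "dense_orthogonal CM I \<xi> \<and> x \<in> I \<rightarrow> S"
      then show "orth_sum IP I \<xi> x \<in> OS S" unfolding OS_eq[OF S] CM using Q.T.orth_sum_completion[OF S] by blast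
    qed
    show "semiprime_algebra CM OP" using Q.OPA_semiprime by (simp add: OP CM P)
    show "\<forall>(I :: 'i set) \<xi> x (J :: 'j set) \<chi> y.
          dense_orthogonal CM I \<xi> \<and> x \<in> I \<rightarrow> carrier P \<and>
          dense_orthogonal CM J \<chi> \<and> y \<in> J \<rightarrow> carrier P \<longrightarrow>
            dense_orthogonal CM (I \<times> J) (\<lambda>(a, b). \<xi> a \<otimes>\<^bsub>CM\<^esub> \<chi> b)
          \<and> orth_sum IP I \<xi> x \<oplus>\<^bsub>OP\<^esub> orth_sum IP J \<chi> y =
              orth_sum IP (I \<times> J) (\<lambda>(a, b). \<xi> a \<otimes>\<^bsub>CM\<^esub> \<chi> b) (\<lambda>(a, b). x a \<oplus>\<^bsub>P\<^esub> y b)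
          \<and> orth_sum IP I \<xi> x \<otimes>\<^bsub>OP\<^esub> orth_sum IP J \<chi> y =
              orth_sum IP (I \<times> J) (\<lambda>(a, b). \<xi> a \<otimes>\<^bsub>CM\<^esub> \<chi> b) (\<lambda>(a, b). x a \<otimes>\<^bsub>P\<^esub> y b)"
      unfolding OP CM P
      by (intro allI impI conjI; elim conjE) (rule Q.T.dense_orthogonal_prod Q.OPA_orth_sums; assumption)+
    show "submodule (carrier OP) MP IP" using Q.T.Sub_OP by (simp add: OP_carrier MP CM P)
    show "\<forall>f \<in> carrier (mod_End MP IP). f ` carrier OP \<subseteq> carrier OP"
    proof (intro ballI image_subsetI)
      fix f u assume f: "f \<in> carrier (mod_End MP IP)" and u: "u \<in> carrier OP"
      have "f \<in> carrier (mod_End Q.MP IP)" using f unfolding MP CM P .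
      then have "f \<in> Q.T.Hom (carrier IP)" by (rule Q.T.mod_End_Hom)
      then show "f u \<in> carrier OP" using Q.OP_invariant u unfolding OP_carrier by blast
    qed
    show "carrier (mod_End MP (IP\<lparr>carrier := carrier OP\<rparr>)) = carrier (mod_End MOP (mult_module OP))"
      "carrier (mod_End MOP (mult_module OP)) = {scalar_op OP \<phi> | \<phi>. \<phi> \<in> carrier CM}"
      unfolding OP_carrier unfolding MOP MP OP CM P by (rule Q.End_OP)+
    show "nonassoc_subalgebra (OS (carrier R)) F OPF"
      using Q.OR_subalgebra unfolding OR OPF OP CM P .
    show "semiprime_algebra F (OPF\<lparr>carrier := OS (carrier R)\<rparr>)"
      using Q.OR_semiprime unfolding OR OPF OP CM P .
    show "(\<exists>n::nat. n \<ge> 1 \<and> (\<forall>p \<in> carrier P. \<exists>\<phi> a. \<phi> \<in> {..<n} \<rightarrow> carrier CM \<and> a \<in> {..<n} \<rightarrow> carrier R \<and>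
            p = (\<Oplus>\<^bsub>P\<^esub> i \<in> {..<n}. \<phi> i \<odot>\<^bsub>P\<^esub> a i))) \<longrightarrow>
        carrier OP = generate (add_monoid IP) {\<phi> \<odot>\<^bsub>IP\<^esub> x | \<phi> x. \<phi> \<in> carrier CM \<and> x \<in> OS (carrier R)}"
    proof (intro impI; elim exE conjE)
      fix n :: nat
      assume n: "\<forall>p \<in> carrier P. \<exists>\<phi> a. \<phi> \<in> {..<n} \<rightarrow> carrier CM \<and> a \<in> {..<n} \<rightarrow> carrier R \<and>
            p = (\<Oplus>\<^bsub>P\<^esub> i \<in> {..<n}. \<phi> i \<odot>\<^bsub>P\<^esub> a i)"
      show "carrier OP = generate (add_monoid IP) {\<phi> \<odot>\<^bsub>IP\<^esub> x | \<phi> x. \<phi> \<in> carrier CM \<and> x \<in> OS (carrier R)}"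
        unfolding OP_carrier OR CM
      proof (rule Q.T.OP_eq_span[OF Q.R_sub_P, of n])
        fix p assume "p \<in> carrier Q.P"
        from bspec[OF n[unfolded P CM] this] obtain \<phi> a where \<phi>a: "\<phi> \<in> {..<n} \<rightarrow> carrier Q.CM" "a \<in> {..<n} \<rightarrow> carrier R"
          "p = (\<Oplus>\<^bsub>Q.P\<^esub> i \<in> {..<n}. \<phi> i \<odot>\<^bsub>Q.P\<^esub> a i)"
          by (elim exE conjE) (rule that)
        then show "\<exists>\<phi> a. \<phi> \<in> {..<n} \<rightarrow> carrier Q.CM \<and> a \<in> {..<n} \<rightarrow> carrier R \<and> p = (\<Oplus>\<^bsub>IP\<^esub> i \<in> {..<n}. \<phi> i \<odot>\<^bsub>IP\<^esub> a i)"
          unfolding Q.finsum_P[OF \<phi>a(1,2)] by (intro exI[of _ \<phi>] exI[of _ a] conjI)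
      qed
    qed
    show "\<forall>S \<subseteq> carrier IP. S = OS S \<and> S \<noteq> {} \<longrightarrow>
        (\<exists>x\<in>S. scalar_annihilator CM IP S = scalar_annihilator CM IP {x})"
    proof (intro allI impI; elim conjE)
      fix S assume "S \<subseteq> carrier IP" "S = OS S" "S \<noteq> {}"
      then show "\<exists>x\<in>S. scalar_annihilator CM IP S = scalar_annihilator CM IP {x}"
        using Q.T.annihilator_attained[of S] OS_eq[of S] unfolding CM by simp
    qed
  qed
qed

end
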